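(* Fix $q\in(2,4]$ and let $\mathcal{K}$ be a knot class with $\Sigma_{\mathcal{K}}\neq\emptyset$. Then for every $\vartheta>0$ there exists an arclength parametrized knot $\Gamma_\vartheta\in\Sigma_{\mathcal{K}}$ with $\mathscr{L}(\Gamma_\vartheta)=1$ such that $S_\vartheta(\Gamma_\vartheta)=\inf_{\Sigma_{\mathcal{K}}}S_\vartheta$.
   Context: $\mathscr{L}$ is length; $E(\gamma)=\int_\gamma\kappa^2ds$; $\mathrm{TP}_q(\gamma)=\iint_{(\mathbb{R}/\mathbb{Z})^2} r_{tp}(\gamma(s),\gamma(t))^{-q}|\gamma'(s)||\gamma'(t)|\,ds\,dt$ with $r_{tp}(\gamma(s),\gamma(t))$ the radius of the circle through $\gamma(s),\gamma(t)$ tangent to $\gamma$ at $\gamma(s)$; $E_\vartheta=E+\vartheta\mathrm{TP}_q^{1/(q-2)}$ and $S_\vartheta(\gamma)=\mathscr{L}(\gamma)E_\vartheta(\gamma)$ (the scale-invariant total energy). $\Omega^1_{\mathcal{K}}$ is the set of injective regular ($|\gamma'|>0$) closed curves $\gamma\in W^{2,2}(\mathbb{R}/\mathbb{Z},\mathbb{R}^3)$ of knot type $\mathcal{K}$. $D_2$-symmetry: $R_1=\mathrm{diag}(1,-1,-1)$, $R_2=\mathrm{diag}(-1,1,-1)$, $R_3=\mathrm{diag}(-1,-1,1)$; on $\mathbb{R}/\mathbb{Z}$: $\psi_1(t)=-t+1/2$, $\psi_2(t)=t-1/2$, $\psi_3(t)=-t$; $\Sigma^1$ is the set of $\gamma\in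 C^0(\mathbb{R}/\mathbb{Z},\mathbb{R}^3)$ of finite positive length with $R_i\gamma(\psi_i(t))=\gamma(t)$ for all $t$, $i=1,2,3$. $\Sigma_{\mathcal{K}}=\Sigma^1\cap\Omega^1_{\mathcal{K}}$. *)

theory Defs
  imports "HOL-Analysis.Analysis" "HOL-Analysis.Cross3"
begin

text \<open>Closed curves on R/Z are represented as 1-periodic maps real => real^3.\<close>

type_synonym curve = "real \<Rightarrow> real^3"

definition periodic1 :: "curve \<Rightarrow> bool" where
  "periodic1 \<gamma> \<longleftrightarrow> (\<forall>t. \<gamma> (t + 1) = \<gamma> t)"

abbreviation dcurve :: "curve \<Rightarrow> real \<Rightarrow> real^3" where
  "dcurve \<gamma> t \<equiv> vector_derivative \<gamma> (at t)"

definition weak_second_deriv :: "curve \<Rightarrow> (real \<Rightarrow> real^3) \<Rightarrow> bool" where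
  "weak_second_deriv \<gamma> g \<longleftrightarrow>
     g absolutely_integrable_on {0..1} \<and>
     (\<lambda>t. (norm (g t))\<^sup>2) integrable_on {0..1} \<and>
     (\<forall>s t. 0 \<le> s \<longrightarrow> s \<le> t \<longrightarrow> t \<le> 1 \<longrightarrow>
        dcurve \<gamma> t - dcurve \<gamma> s = integral {s..t} g)"

definition W22_closed :: "curve \<Rightarrow> bool" where
  "W22_closed \<gamma> \<longleftrightarrow> periodic1 \<gamma> \<and> (\<forall>t. \<gamma> differentiable (at t)) \<and>
     (\<exists>g. weak_second_deriv \<gamma> g)"

definition second_deriv :: "curve \<Rightarrow> real \<Rightarrow> real^3" where
  "second_deriv \<gamma> = (SOME g. weak_second_deriv \<gamma> g)"

definition regular_curve :: "curve \<Rightarrow> bool" where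
  "regular_curve \<gamma> \<longleftrightarrow> (\<forall>t. dcurve \<gamma> t \<noteq> 0)"

definition injective_closed :: "curve \<Rightarrow> bool" where
  "injective_closed \<gamma> \<longleftrightarrow> (\<forall>s t. \<gamma> s = \<gamma> t \<longrightarrow> s - t \<in> \<int>)"

definition curve_length :: "curve \<Rightarrow> real" where
  "curve_length \<gamma> = integral {0..1} (\<lambda>t. norm (dcurve \<gamma> t))"

definition arclength_param :: "curve \<Rightarrow> bool" where
  "arclength_param \<gamma> \<longleftrightarrow> (\<forall>t. norm (dcurve \<gamma> t) = curve_length \<gamma>)"

text \<open>Bending energy E = int kappa^2 ds, kappa = |g' x g''| / |g'|^3, ds = |g'| dt.\<close>
definition bending_energy :: "curve \<Rightarrow> ennreal" where
  "bending_energy \<gamma> = (\<integral>\<^sup>+ t. indicator {0..1} t *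
      ennreal ((norm (cross3 (dcurve \<gamma> t) (second_deriv \<gamma> t)))\<^sup>2 / norm (dcurve \<gamma> t) ^ 5) \<partial>lborel)"

text \<open>1 / r_tp(gamma s, gamma t): inverse radius of the circle through gamma s, gamma t
  tangent to gamma at gamma s.\<close>
definition inv_rtp :: "curve \<Rightarrow> real \<Rightarrow> real \<Rightarrow> real" where
  "inv_rtp \<gamma> s t = 2 * norm (cross3 (dcurve \<gamma> s) (\<gamma> t - \<gamma> s)) /
      (norm (dcurve \<gamma> s) * (norm (\<gamma> t - \<gamma> s))\<^sup>2)"

definition tangent_point :: "real \<Rightarrow> curve \<Rightarrow> ennreal" where
  "tangent_point q \<gamma> = (\<integral>\<^sup>+ p. indicator ({0..1} \<times> {0..1}) p *
      ennreal (inv_rtp \<gamma> (fst p) (snd p) powr q * norm (dcurve \<gamma> (fst p)) * norm (dcurve \<gamma> (snd p)))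
      \<partial>(lborel :: (real \<times> real) measure))"

definition tp_power :: "real \<Rightarrow> curve \<Rightarrow> ennreal" where
  "tp_power q \<gamma> = (if tangent_point q \<gamma> = \<infinity> then \<infinity>
      else ennreal (enn2real (tangent_point q \<gamma>) powr (1 / (q - 2))))"

definition E_theta :: "real \<Rightarrow> real \<Rightarrow> curve \<Rightarrow> ennreal" where
  "E_theta q \<theta> \<gamma> = bending_energy \<gamma> + ennreal \<theta> * tp_power q \<gamma>"

definition S_theta :: "real \<Rightarrow> real \<Rightarrow> curve \<Rightarrow> ennreal" where
  "S_theta q \<theta> \<gamma> = ennreal (curve_length \<gamma>) * E_theta q \<theta> \<gamma>"

definition ambient_isotopic :: "(real^3) set \<Rightarrow> (real^3) set \<Rightarrow> bool" where
  "ambient_isotopic A B \<longleftrightarrow> (\<exists>H :: real \<times> (real^3) \<Rightarrow> real^3.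
      continuous_on ({0..1} \<times> UNIV) H \<and>
      (\<forall>t\<in>{0..1}. \<exists>h. homeomorphism UNIV UNIV (\<lambda>x. H (t, x)) h) \<and>
      (\<forall>x. H (0, x) = x) \<and> (\<lambda>x. H (1, x)) ` A = B)"

definition closed_knot :: "curve \<Rightarrow> bool" where
  "closed_knot \<gamma> \<longleftrightarrow> continuous_on UNIV \<gamma> \<and> periodic1 \<gamma> \<and> injective_closed \<gamma>"

text \<open>The knot class K is given as the knot type of a reference knot gamma0.\<close>
definition Omega1 :: "curve \<Rightarrow> curve set" where
  "Omega1 \<gamma>0 = {\<gamma>. W22_closed \<gamma> \<and> regular_curve \<gamma> \<and> injective_closed \<gamma> \<and>
      ambient_isotopic (\<gamma>0 ` {0..1}) (\<gamma> ` {0..1})}"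

definition R1 :: "real^3 \<Rightarrow> real^3" where "R1 x = vector [x$1, - x$2, - x$3]"
definition R2 :: "real^3 \<Rightarrow> real^3" where "R2 x = vector [- x$1, x$2, - x$3]"
definition R3 :: "real^3 \<Rightarrow> real^3" where "R3 x = vector [- x$1, - x$2, x$3]"

definition D2_symmetric :: "curve \<Rightarrow> bool" where
  "D2_symmetric \<gamma> \<longleftrightarrow> (\<forall>t. R1 (\<gamma> (- t + 1/2)) = \<gamma> t \<and> R2 (\<gamma> (t - 1/2)) = \<gamma> t \<and>
      R3 (\<gamma> (- t)) = \<gamma> t)"

text \<open>Sigma_K = Sigma^1 intersected with Omega^1_K (for W22 curves, length = integral of |g'|).\<close>
definition Sigma_K :: "curve \<Rightarrow> curve set" where
  "Sigma_K \<gamma>0 = {\<gamma> \<in> Omega1 \<gamma>0. continuous_on UNIV \<gamma> \<and> periodic1 \<gamma> \<and>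
      0 < curve_length \<gamma> \<and> D2_symmetric \<gamma>}"

end

theory Submission
  imports Defs "HOL-Complex_Analysis.Great_Picard"
begin

text \<open>
  Every competitor has an arclength reparametrisation of length one with the same energy, so one may
  minimise over unit speed curves. For these the bending energy is the squared $L^2$ norm of the
  second derivative; bounded energy therefore makes the tangents equicontinuous, while the symmetry
  pins down the translations, and Arzela-Ascoli yields a $C^1$ limit of a minimising sequence.

  The limit stays in the knot class because of a uniform bilipschitz bound: at a pair of
  parameters that are not close but realise the smallest distance $\varepsilon$, the chord is orthogonal
  to the tangent, so the inverse tangent-point radius is at least $1/(2\varepsilon)$ on a square of side
  comparable to $\varepsilon$. Hence the tangent-point energy is at least a multiple of
  $\varepsilon^{2-q}$, which bounds $\varepsilon$ from below because $q > 2$. A curve that is $C^1$-close to a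
  bilipschitz one differs from it by a displacement with small Lipschitz constant; its McShane
  extension $V$ gives the ambient isotopy $x \mapsto x + tV(x)$.

  Both energies are lower semicontinuous: the tangent-point energy by Fatou's lemma, the bending
  energy by weak compactness in $L^2$.
\<close>

section \<open>Square-integrable functions and indefinite integrals\<close>

text \<open>The exponent 1/(q - 2) makes the problem scale invariant: the inverse radii contribute q
  inverse lengths and the two line elements cancel two of them, so the tangent-point energy scales
  like length^(2-q) and its power like length^(-1), just as the bending energy does.

  The two energies divide the work. Equicontinuity of the tangents excludes self-contact only
  between nearby parameters; strands far apart along the curve are separated by the tangent-point
  term, which \<theta> > 0 keeps bounded along a minimising sequence.

  The obstacle is regularity: the reparametrised tangent is a normalised, merely absolutely
  continuous derivative composed with the inverse arclength function, and its weak derivative has to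
  be exhibited. Moreover \<open>second_deriv\<close> is an arbitrary choice among weak second
  derivatives, so energy computations need their uniqueness almost everywhere.

  Extending a Lipschitz map to R^3 coordinatewise costs a factor 3. Hence C^1 closeness is demanded
  up to a sixth of the bilipschitz constant, which leaves the contraction constant 1/2.\<close>

definition square_integrable_on :: "(real \<Rightarrow> 'a::euclidean_space) \<Rightarrow> real set \<Rightarrow> bool"
    (infixr "square'_integrable'_on" 46) where
  "f square_integrable_on S \<longleftrightarrow>
     f absolutely_integrable_on S \<and> (\<lambda>t. (norm (f t))\<^sup>2) integrable_on S"

lemma square_integrable_on_D:
  assumes "f square_integrable_on {a..b}"
  shows "f absolutely_integrable_on {a..b}" "(\<lambda>t. (norm (f t))\<^sup>2) integrable_on {a..b}"
    "(\<lambda>t. (norm (f t))\<^sup>2) absolutely_integrable_on {a..b}"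
    "f \<in> borel_measurable (lebesgue_on {a..b})"
  using assms
  by (auto simp: square_integrable_on_def nonnegative_absolutely_integrable_1
      intro: absolutely_integrable_imp_borel_measurable)

text \<open>Bridge from the gauge-integral notions of the definitions to Bochner integrals over
  \<open>lebesgue_on\<close>, where Fatou's lemma and termwise integration of series are
  applied.\<close>

lemma absolutely_integrable_on_iff_lebesgue_on:
  fixes f :: "real \<Rightarrow> 'a::euclidean_space"
  shows "f absolutely_integrable_on {a..b} \<longleftrightarrow> integrable (lebesgue_on {a..b}) f"
  unfolding set_integrable_def by (rule integrable_restrict_space[symmetric]) auto

lemma norm_add_squared_le: "(norm (x + y))\<^sup>2 \<le> 2 * (norm x)\<^sup>2 + 2 * (norm y)\<^sup>2"
  for x y :: "'a::real_inner"
proof -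
  have "(norm (x + y))\<^sup>2 + (norm (x - y))\<^sup>2 = 2 * (norm x)\<^sup>2 + 2 * (norm y)\<^sup>2"
    by (simp add: power2_norm_eq_inner algebra_simps inner_commute)
  then show ?thesis
    by (smt (verit) zero_le_power2)
qed

lemma square_integrable_on_scaleR:
  assumes "f square_integrable_on S"
  shows "(\<lambda>t. c *\<^sub>R f t) square_integrable_on S"
  using assms unfolding square_integrable_on_def
  by (auto simp: power_mult_distrib intro: integrable_on_mult_right)

lemma square_integrable_on_add:
  fixes f g :: "real \<Rightarrow> 'a::euclidean_space"
  assumes "f square_integrable_on {a..b}" "g square_integrable_on {a..b}"
  shows "(\<lambda>t. f t + g t) square_integrable_on {a..b}"
proof -
  note f = square_integrable_on_D[OF assms(1)] and g = square_integrable_on_D[OF assms(2)]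
  have "(\<lambda>t. (norm (f t + g t))\<^sup>2) integrable_on {a..b}"
  proof (rule measurable_bounded_by_integrable_imp_integrable_real)
    show "(\<lambda>t. (norm (f t + g t))\<^sup>2) \<in> borel_measurable (lebesgue_on {a..b})"
      using f(4) g(4) by measurable
    show "(\<lambda>t. 2 * (norm (f t))\<^sup>2 + 2 * (norm (g t))\<^sup>2) integrable_on {a..b}"
      by (intro integrable_add integrable_on_mult_right f g)
  qed (auto intro: norm_add_squared_le)
  then show ?thesis
    using f(1) g(1) by (simp add: square_integrable_on_def set_integral_add(1))
qed

lemma square_integrable_on_diff:
  fixes f g :: "real \<Rightarrow> 'a::euclidean_space"
  assumes "f square_integrable_on {a..b}" "g square_integrable_on {a..b}"
  shows "(\<lambda>t. f t - g t) square_integrable_on {a..b}"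
  using square_integrable_on_add[OF assms(1) square_integrable_on_scaleR[OF assms(2), of "-1"]]
  by simp

text \<open>Written with the midpoint because midpoints stay in a convex set: two almost minimal
  elements of such a set are then forced to be close.\<close>

lemma integral_parallelogram:
  fixes f g :: "real \<Rightarrow> 'a::euclidean_space"
  assumes "f square_integrable_on {a..b}" "g square_integrable_on {a..b}"
  shows "integral {a..b} (\<lambda>t. (norm (f t - g t))\<^sup>2) =
    2 * integral {a..b} (\<lambda>t. (norm (f t))\<^sup>2) + 2 * integral {a..b} (\<lambda>t. (norm (g t))\<^sup>2)
    - 4 * integral {a..b} (\<lambda>t. (norm ((1/2) *\<^sub>R (f t + g t)))\<^sup>2)"
proof -
  note f = square_integrable_on_D(2)[OF assms(1)] and g = square_integrable_on_D(2)[OF assms(2)]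
  have m: "(\<lambda>t. (norm ((1/2) *\<^sub>R (f t + g t)))\<^sup>2) integrable_on {a..b}"
    by (intro square_integrable_on_D(2) square_integrable_on_scaleR square_integrable_on_add assms)
  have *: "(\<lambda>t. (norm (f t - g t))\<^sup>2) =
    (\<lambda>t. 2 * (norm (f t))\<^sup>2 + 2 * (norm (g t))\<^sup>2 - 4 * (norm ((1/2) *\<^sub>R (f t + g t)))\<^sup>2)"
    by (simp add: fun_eq_iff power2_norm_eq_inner algebra_simps inner_commute)
  show ?thesis
    unfolding *
    by (subst integral_diff integral_add; (intro integrable_add integrable_on_mult_right f g m)?)+
       simp
qed

text \<open>Young's inequality with a free weight in place of Cauchy-Schwarz. Taking
  \<open>k\<close> to be the square root of the interval length gives the Hoelder exponent 1/2;
  taking \<open>k\<close> = 2^j turns squared distances 4^(-j) into summable distances.\<close>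

lemma integral_norm_le_square:
  fixes f :: "real \<Rightarrow> 'a::euclidean_space"
  assumes "f square_integrable_on {a..b}" "a \<le> b" "0 < k"
  shows "integral {a..b} (\<lambda>t. norm (f t))
    \<le> (k * integral {a..b} (\<lambda>t. (norm (f t))\<^sup>2) + (b - a) / k) / 2"
proof -
  note f = square_integrable_on_D[OF assms(1)]
  have young: "x \<le> (k / 2) * x\<^sup>2 + 1 / (2 * k)" for x
  proof -
    have "0 \<le> (k * x - 1)\<^sup>2 / k"
      using assms by simp
    also have "\<dots> = k * x\<^sup>2 + 1 / k - 2 * x"
      using assms by (simp add: field_simps power2_eq_square)
    finally show ?thesis using assms by (simp add: field_simps)
  qed
  have "integral {a..b} (\<lambda>t. norm (f t))
      \<le> integral {a..b} (\<lambda>t. (k / 2) * (norm (f t))\<^sup>2 + 1 / (2 * k))"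
    using f(1)
    by (intro integral_le integrable_add integrable_on_mult_right f(2) young)
       (auto simp: absolutely_integrable_on_def)
  also have "\<dots> = (k / 2) * integral {a..b} (\<lambda>t. (norm (f t))\<^sup>2) + (b - a) / (2 * k)"
    using assms
    by (subst integral_add) (auto intro!: integrable_on_mult_right f(2))
  also have "\<dots> = (k * integral {a..b} (\<lambda>t. (norm (f t))\<^sup>2) + (b - a) / k) / 2"
    by (simp add: add_divide_distrib)
  finally show ?thesis .
qed

lemma square_integrable_on_subinterval:
  fixes f :: "real \<Rightarrow> 'a::euclidean_space"
  assumes "f square_integrable_on {a..b}" "a \<le> c" "d \<le> b"
  shows "f square_integrable_on {c..d}"
  using assms unfolding square_integrable_on_def
  by (auto intro: integrable_on_subinterval absolutely_integrable_on_subinterval)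

text \<open>The Riesz-Fischer argument: along a fast subsequence the increments are summable in L^1,
  hence summable almost everywhere, and Fatou bounds the norm of the limit. The limit is used only
  through its integrals over subintervals, so that is the convergence recorded.\<close>

lemma square_integrable_complete:
  fixes h :: "nat \<Rightarrow> real \<Rightarrow> 'a::euclidean_space"
  assumes ab: "a \<le> b" and h: "\<And>n. h n square_integrable_on {a..b}"
    and Cauchy: "\<And>e. 0 < e \<Longrightarrow>
      \<exists>N. \<forall>m\<ge>N. \<forall>n\<ge>N. integral {a..b} (\<lambda>t. (norm (h m t - h n t))\<^sup>2) < e"
    and bound: "\<And>n. integral {a..b} (\<lambda>t. (norm (h n t))\<^sup>2) \<le> C n" and C: "C \<longlonglongrightarrow> c"
  obtains G r where "G square_integrable_on {a..b}" "strict_mono (r :: nat \<Rightarrow> nat)"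
    "\<And>s t. a \<le> s \<Longrightarrow> s \<le> t \<Longrightarrow> t \<le> b \<Longrightarrow>
       (\<lambda>j. integral {s..t} (h (r j))) \<longlonglongrightarrow> integral {s..t} G"
    "integral {a..b} (\<lambda>t. (norm (G t))\<^sup>2) \<le> c"
proof -
  let ?M = "lebesgue_on {a..b}"
  have "\<forall>j. \<exists>N. \<forall>m\<ge>N. \<forall>n\<ge>N. integral {a..b} (\<lambda>t. (norm (h m t - h n t))\<^sup>2) < (1/4)^j"
    by (intro allI Cauchy) simp
  then obtain N where N: "\<And>j m n. N j \<le> m \<Longrightarrow> N j \<le> n \<Longrightarrow>
      integral {a..b} (\<lambda>t. (norm (h m t - h n t))\<^sup>2) < (1/4)^j"
    by (auto dest!: choice)
  \<comment> \<open>The sum makes \<open>r j\<close> dominate \<open>N j\<close>, the added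
    \<open>j\<close> makes \<open>r\<close> strictly increasing.\<close>
  define r where "r j = (\<Sum>i\<le>j. N i) + j" for j
  have r: "strict_mono r"
    by (auto simp: strict_mono_Suc_iff r_def)
  have rN: "N j \<le> r j" for j
    unfolding r_def by (simp add: member_le_sum trans_le_add1)
  define d where "d j t = h (r (Suc j)) t - h (r j) t" for j t
  have d: "d j square_integrable_on {a..b}" for j
    unfolding d_def by (intro square_integrable_on_diff h)
  have dint: "integrable ?M (d j)" for j
    using square_integrable_on_D(1)[OF d[of j]]
    by (simp add: absolutely_integrable_on_iff_lebesgue_on)
  have hint: "integrable ?M (h n)" for n
    using square_integrable_on_D(1)[OF h[of n]]
    by (simp add: absolutely_integrable_on_iff_lebesgue_on)
  \<comment> \<open>The weight 2^j balances Young's inequality: both 2^j * 4^(-j) and (b - a) / 2^j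
    decay like 2^(-j).\<close>
  have nd: "(\<integral>x. norm (d j x) \<partial>?M) \<le> (1 + (b - a)) / 2 * (1/2)^j" for j
  proof -
    have "(\<integral>x. norm (d j x) \<partial>?M) = integral {a..b} (\<lambda>t. norm (d j t))"
      by (rule lebesgue_integral_eq_integral) (use dint[of j] in auto)
    also have "\<dots> \<le> (2^j * integral {a..b} (\<lambda>t. (norm (d j t))\<^sup>2) + (b - a) / 2^j) / 2"
      by (rule integral_norm_le_square) (use d ab in auto)
    also have "\<dots> \<le> (2^j * (1/4)^j + (b - a) / 2^j) / 2"
      using N[of j "r (Suc j)" "r j"] rN[of j] strict_mono_leD[OF r, of j "Suc j"]
      by (simp add: d_def)
    also have "(2::real)^j * (1/4)^j = (1/2)^j"
      by (simp flip: power_mult_distrib)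
    finally show ?thesis by (simp add: power_one_over field_simps)
  qed
  have sumd: "summable (\<lambda>j. \<integral>x. norm (d j x) \<partial>?M)"
    by (rule summable_comparison_test'[where g="\<lambda>j. (1 + (b - a)) / 2 * (1/2)^j" and N=0])
       (use nd in \<open>auto intro!: summable_mult summable_geometric\<close>)
  have AEd: "AE x in ?M. summable (\<lambda>j. norm (d j x))"
  proof -
    have "(\<integral>\<^sup>+x. (\<Sum>j. ennreal (norm (d j x))) \<partial>?M) = (\<Sum>j. \<integral>\<^sup>+x. ennreal (norm (d j x)) \<partial>?M)"
      by (rule nn_integral_suminf) (use dint in auto)
    also have "\<dots> = (\<Sum>j. ennreal (\<integral>x. norm (d j x) \<partial>?M))"
      by (intro suminf_cong nn_integral_eq_integral) (use dint in auto)
    also have "\<dots> < \<infinity>"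
      using sumd by (simp add: suminf_ennreal2 ennreal_less_top)
    finally have "AE x in ?M. (\<Sum>j. ennreal (norm (d j x))) \<noteq> \<infinity>"
      by (intro nn_integral_PInf_AE) (use dint in auto)
    then show ?thesis
      by (rule AE_mp) (auto intro!: AE_I2 summable_suminf_not_top)
  qed
  \<comment> \<open>Where the series diverges the value is unspecified; \<open>AEd\<close> confines
    this to a null set.\<close>
  define G where "G = (\<lambda>x. h (r 0) x + (\<Sum>j. d j x))"
  have tele: "h (r 0) x + (\<Sum>j<n. d j x) = h (r n) x" for n x
    unfolding d_def using sum_lessThan_telescope[of "\<lambda>j. h (r j) x" n] by (simp add: d_def)
  have sumint: "integrable ?M (\<lambda>x. \<Sum>j. d j x)"
    by (rule integrable_suminf) (use dint sumd AEd in auto)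
  have Gint: "integrable ?M G"
    unfolding G_def by (intro Bochner_Integration.integrable_add hint sumint)
  have Gabs: "G absolutely_integrable_on {a..b}"
    by (rule absolutely_integrable_on_iff_lebesgue_on[THEN iffD2, OF Gint])
  have lim: "AE x in ?M. (\<lambda>j. h (r j) x) \<longlonglongrightarrow> G x"
  proof (rule AE_mp[OF AEd], intro AE_I2 impI)
    fix x assume "summable (\<lambda>j. norm (d j x))"
    then have "(\<lambda>j. d j x) sums (\<Sum>j. d j x)"
      by (rule summable_sums[OF summable_norm_cancel])
    then have "(\<lambda>n. h (r 0) x + (\<Sum>j<n. d j x)) \<longlonglongrightarrow> G x"
      unfolding G_def sums_def by (rule tendsto_add[OF tendsto_const])
    then show "(\<lambda>j. h (r j) x) \<longlonglongrightarrow> G x" by (simp add: tele)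
  qed
  have Gsq: "(\<integral>\<^sup>+x. ennreal ((norm (G x))\<^sup>2) \<partial>?M) \<le> ennreal c"
  proof -
    have "(\<integral>\<^sup>+x. ennreal ((norm (G x))\<^sup>2) \<partial>?M)
        = (\<integral>\<^sup>+x. liminf (\<lambda>j. ennreal ((norm (h (r j) x))\<^sup>2)) \<partial>?M)"
    proof (rule nn_integral_cong_AE, rule AE_mp[OF lim], intro AE_I2 impI)
      fix x assume "(\<lambda>j. h (r j) x) \<longlonglongrightarrow> G x"
      then have "(\<lambda>j. ennreal ((norm (h (r j) x))\<^sup>2)) \<longlonglongrightarrow> ennreal ((norm (G x))\<^sup>2)"
        by (intro tendsto_intros) auto
      then show "ennreal ((norm (G x))\<^sup>2) = liminf (\<lambda>j. ennreal ((norm (h (r j) x))\<^sup>2))"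
        by (rule lim_imp_Liminf[symmetric, rotated]) simp
    qed
    also have "\<dots> \<le> liminf (\<lambda>j. \<integral>\<^sup>+x. ennreal ((norm (h (r j) x))\<^sup>2) \<partial>?M)"
      by (intro nn_integral_liminf measurable_compose[OF _ measurable_ennreal] borel_measurable_power
          measurable_compose[OF square_integrable_on_D(4)[OF h]]
          borel_measurable_continuous_onI continuous_on_norm_id)
    also have "\<dots> \<le> liminf (\<lambda>j. ennreal (C (r j)))"
    proof (intro Liminf_mono always_eventually allI)
      fix j
      have i: "integrable ?M (\<lambda>x. (norm (h (r j) x))\<^sup>2)"
        using square_integrable_on_D(3)[OF h[of "r j"]]
        by (simp add: absolutely_integrable_on_iff_lebesgue_on)
      have "(\<integral>\<^sup>+x. ennreal ((norm (h (r j) x))\<^sup>2) \<partial>?M) = ennreal (\<integral>x. (norm (h (r j) x))\<^sup>2 \<partial>?M)"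
        using i by (intro nn_integral_eq_integral) auto
      also have "(\<integral>x. (norm (h (r j) x))\<^sup>2 \<partial>?M) = integral {a..b} (\<lambda>x. (norm (h (r j) x))\<^sup>2)"
        using i by (intro lebesgue_integral_eq_integral) auto
      finally show "(\<integral>\<^sup>+x. ennreal ((norm (h (r j) x))\<^sup>2) \<partial>?M) \<le> ennreal (C (r j))"
        using bound[of "r j"] by (simp add: ennreal_leI)
    qed
    also have "\<dots> = ennreal c"
      using LIMSEQ_subseq_LIMSEQ[OF C r]
      by (intro lim_imp_Liminf tendsto_ennrealI) (auto simp: o_def)
    finally show ?thesis .
  qed
  have c: "0 \<le> c"
  proof (rule LIMSEQ_le_const[OF C], intro exI allI impI)
    fix n
    have "0 \<le> integral {a..b} (\<lambda>t. (norm (h n t))\<^sup>2)"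
      by (intro integral_nonneg square_integrable_on_D(2) h) auto
    then show "0 \<le> C n" using bound[of n] by linarith
  qed
  have Gi: "integrable ?M (\<lambda>x. (norm (G x))\<^sup>2)"
  proof (rule integrableI_bounded)
    show "(\<integral>\<^sup>+x. ennreal (norm ((norm (G x))\<^sup>2)) \<partial>?M) < \<infinity>"
      using Gsq by (simp add: order_le_less_trans)
  qed (use Gint in auto)
  show ?thesis
  proof (rule that[of G r])
    show "G square_integrable_on {a..b}"
      using Gabs Gi integrable_on_lebesgue_on[OF Gi] by (simp add: square_integrable_on_def)
    show "strict_mono r" by fact
    have "ennreal (\<integral>x. (norm (G x))\<^sup>2 \<partial>?M) \<le> ennreal c"
      using Gsq Gi by (subst (asm) nn_integral_eq_integral) auto
    moreover have "(\<integral>x. (norm (G x))\<^sup>2 \<partial>?M) = integral {a..b} (\<lambda>x. (norm (G x))\<^sup>2)"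
      using Gi by (intro lebesgue_integral_eq_integral) auto
    ultimately show "integral {a..b} (\<lambda>t. (norm (G t))\<^sup>2) \<le> c"
      using c by (simp add: ennreal_le_iff)
    fix s t assume st: "a \<le> s" "s \<le> t" "t \<le> b"
    \<comment> \<open>Restriction is expressed by an indicator, so that termwise integration over
      {a..b} serves every subinterval.\<close>
    have *: "(\<integral>x. indicat_real {s..t} x *\<^sub>R f x \<partial>?M) = integral {s..t} f"
      if "integrable ?M f" for f :: "real \<Rightarrow> 'a"
    proof -
      have "(\<integral>x. indicat_real {s..t} x *\<^sub>R f x \<partial>?M) =
          integral {a..b} (\<lambda>x. indicat_real {s..t} x *\<^sub>R f x)"
        by (intro lebesgue_integral_eq_integral integrable_mult_indicator that)
           (auto simp: sets_restrict_space_iff st)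
      also have "\<dots> = integral {a..b} (\<lambda>x. if x \<in> {s..t} then f x else 0)"
        by (intro integral_cong) auto
      also have "\<dots> = integral ({s..t} \<inter> {a..b}) f"
        by (rule integral_restrict_Int)
      also have "{s..t} \<inter> {a..b} = {s..t}" using st by auto
      finally show ?thesis .
    qed
    have ind: "integrable ?M (\<lambda>x. indicat_real {s..t} x *\<^sub>R d i x)" for i
      by (intro integrable_mult_indicator dint) (auto simp: sets_restrict_space_iff st)
    have "(\<lambda>i. \<integral>x. indicat_real {s..t} x *\<^sub>R d i x \<partial>?M) sums
        (\<integral>x. (\<Sum>i. indicat_real {s..t} x *\<^sub>R d i x) \<partial>?M)"
    proof (rule sums_integral[OF ind])
      show "AE x in ?M. summable (\<lambda>i. norm (indicat_real {s..t} x *\<^sub>R d i x))"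
        using AEd by (rule AE_mp) (auto intro!: AE_I2 simp: indicator_def)
      show "summable (\<lambda>i. \<integral>x. norm (indicat_real {s..t} x *\<^sub>R d i x) \<partial>?M)"
      proof (rule summable_comparison_test'[OF sumd, of 0])
        fix i
        have "(\<integral>x. norm (indicat_real {s..t} x *\<^sub>R d i x) \<partial>?M) \<le> (\<integral>x. norm (d i x) \<partial>?M)"
          by (intro integral_mono integrable_norm ind dint) (auto simp: indicator_def)
        then show "norm (\<integral>x. norm (indicat_real {s..t} x *\<^sub>R d i x) \<partial>?M) \<le> (\<integral>x. norm (d i x) \<partial>?M)"
          by simp
      qed
    qed
    also have "(\<lambda>x. \<Sum>i. indicat_real {s..t} x *\<^sub>R d i x) = (\<lambda>x. indicat_real {s..t} x *\<^sub>R (\<Sum>i. d i x))"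
      by (auto simp: fun_eq_iff indicator_def)
    finally have "(\<lambda>i. integral {s..t} (d i)) sums integral {s..t} (\<lambda>x. \<Sum>i. d i x)"
      using *[OF dint] *[OF sumint] by simp
    then have "(\<lambda>n. integral {s..t} (h (r 0)) + (\<Sum>i<n. integral {s..t} (d i)))
        \<longlonglongrightarrow> integral {s..t} (h (r 0)) + integral {s..t} (\<lambda>x. \<Sum>i. d i x)"
      unfolding sums_def by (rule tendsto_add[OF tendsto_const])
    moreover have hi: "h n integrable_on {s..t}" for n
      using square_integrable_on_subinterval[OF h[of n] st(1,3)]
      by (auto dest: square_integrable_on_D(1) simp: absolutely_integrable_on_def)
    moreover have "integral {s..t} (h (r 0)) + (\<Sum>i<n. integral {s..t} (d i)) = integral {s..t} (h (r n))" for n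
    proof (induction n)
      case (Suc n)
      have "integral {s..t} (d n) = integral {s..t} (h (r (Suc n))) - integral {s..t} (h (r n))"
        unfolding d_def by (intro integral_diff hi)
      with Suc show ?case by (simp add: algebra_simps)
    qed simp
    moreover have "(\<lambda>x. \<Sum>i. d i x) integrable_on {s..t}"
      using integrable_on_subinterval[OF integrable_on_lebesgue_on[OF sumint]] st by auto
    then have "integral {s..t} G = integral {s..t} (h (r 0)) + integral {s..t} (\<lambda>x. \<Sum>i. d i x)"
      unfolding G_def using hi by (intro integral_add)
    ultimately show "(\<lambda>j. integral {s..t} (h (r j))) \<longlonglongrightarrow> integral {s..t} G"
      by simp
  qed
qed

text \<open>
  The weak limit is found without weak topologies: almost minimal elements of the decreasing convex
  sets \<open>A n\<close> of approximate derivatives of \<open>T\<close> form a strong Cauchy sequence by the parallelogram law.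
\<close>

lemma L2_weak_limit:
  fixes g :: "nat \<Rightarrow> real \<Rightarrow> 'a::euclidean_space"
  assumes ab: "a \<le> b" and g: "\<And>n. g n square_integrable_on {a..b}"
    and T: "\<And>e. 0 < e \<Longrightarrow> \<exists>N. \<forall>n\<ge>N. \<forall>s t. a \<le> s \<longrightarrow> s \<le> t \<longrightarrow> t \<le> b \<longrightarrow>
          norm (integral {s..t} (g n) - (T t - T s)) \<le> e"
    and lim: "(\<lambda>n. integral {a..b} (\<lambda>t. (norm (g n t))\<^sup>2)) \<longlonglongrightarrow> c"
  obtains G where "G square_integrable_on {a..b}"
    "\<And>s t. a \<le> s \<Longrightarrow> s \<le> t \<Longrightarrow> t \<le> b \<Longrightarrow> T t - T s = integral {s..t} G"
    "integral {a..b} (\<lambda>t. (norm (G t))\<^sup>2) \<le> c"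
proof -
  define sq where "sq h = integral {a..b} (\<lambda>t. (norm (h t))\<^sup>2)" for h :: "real \<Rightarrow> 'a"
  define A where "A n = {h. h square_integrable_on {a..b} \<and>
     (\<forall>s t. a \<le> s \<longrightarrow> s \<le> t \<longrightarrow> t \<le> b \<longrightarrow>
        norm (integral {s..t} h - (T t - T s)) \<le> 1 / real (Suc n))}" for n
  define \<alpha> where "\<alpha> n = Inf (sq ` A n)" for n
  have sq_nonneg: "0 \<le> sq h" if "h \<in> A n" for h n
    unfolding sq_def
    by (rule integral_nonneg[OF square_integrable_on_D(2)]) (use that in \<open>auto simp: A_def\<close>)
  have bdd: "bdd_below (sq ` A n)" for n
    by (rule bdd_belowI2[where m=0]) (rule sq_nonneg)
  \<comment> \<open>A tail of \<open>g\<close> lies in every \<open>A n\<close>; hence these sets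
    are nonempty and the infima of the squared norms stay below \<open>c\<close>.\<close>
  have ev: "\<exists>N. \<forall>m\<ge>N. g m \<in> A n" for n
    using T[of "1 / real (Suc n)"] g unfolding A_def by auto
  have ne: "A n \<noteq> {}" for n
    using ev[of n] by auto
  have \<alpha>c: "\<alpha> n \<le> c" for n
  proof (rule LIMSEQ_le_const[OF lim])
    obtain N where "\<forall>m\<ge>N. g m \<in> A n" using ev by blast
    then show "\<exists>N. \<forall>m\<ge>N. \<alpha> n \<le> integral {a..b} (\<lambda>t. (norm (g m t))\<^sup>2)"
      unfolding \<alpha>_def sq_def[symmetric] by (intro exI[of _ N] allI impI cInf_lower bdd imageI) auto
  qed
  have Amono: "A n \<subseteq> A m" if "m \<le> n" for m n
  proof -
    have "1 / real (Suc n) \<le> 1 / real (Suc m)"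
      using that by (simp add: frac_le)
    then show ?thesis unfolding A_def by (blast intro: order_trans)
  qed
  have \<alpha>mono: "\<alpha> m \<le> \<alpha> n" if "m \<le> n" for m n
    unfolding \<alpha>_def using Amono[OF that] ne by (intro cInf_superset_mono bdd) auto
  have \<alpha>0: "0 \<le> \<alpha> n" for n
    unfolding \<alpha>_def using ne by (intro cInf_greatest) (auto simp: sq_nonneg)
  obtain \<beta> where \<beta>: "\<alpha> \<longlonglongrightarrow> \<beta>" "\<And>n. \<alpha> n \<le> \<beta>"
    using incseq_convergent[of \<alpha> c] \<alpha>c \<alpha>mono by (auto simp: incseq_def)
  have "\<exists>h. h \<in> A n \<and> sq h < \<alpha> n + 1 / real (Suc n)" for n
    using cInf_lessD[of "sq ` A n" "\<alpha> n + 1 / real (Suc n)"] ne unfolding \<alpha>_def by auto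
  then obtain h where h: "\<And>n. h n \<in> A n \<and> sq (h n) < \<alpha> n + 1 / real (Suc n)"
    using choice[of "\<lambda>n h. h \<in> A n \<and> sq h < \<alpha> n + 1 / real (Suc n)"] by blast
  note h = conjunct1[OF h] conjunct2[OF h]
  have hsq: "h n square_integrable_on {a..b}" for n
    using h(1)[of n] by (simp add: A_def)
  have half: "(\<lambda>t. (1/2) *\<^sub>R (f t + k t)) \<in> A n" if "f \<in> A n" "k \<in> A n" for f k n
    unfolding A_def
  proof (intro CollectI conjI allI impI)
    have f: "f square_integrable_on {a..b}" and k: "k square_integrable_on {a..b}"
      using that by (auto simp: A_def)
    then show "(\<lambda>t. (1/2) *\<^sub>R (f t + k t)) square_integrable_on {a..b}"
      by (intro square_integrable_on_scaleR square_integrable_on_add)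
    fix s t assume st: "a \<le> s" "s \<le> t" "t \<le> b"
    have fk: "f integrable_on {s..t}" "k integrable_on {s..t}"
      using square_integrable_on_subinterval[OF f st(1,3)] square_integrable_on_subinterval[OF k st(1,3)]
      by (auto simp: square_integrable_on_def absolutely_integrable_on_def)
    have "integral {s..t} (\<lambda>t. (1/2) *\<^sub>R (f t + k t)) - (T t - T s) =
       (1/2) *\<^sub>R ((integral {s..t} f - (T t - T s)) + (integral {s..t} k - (T t - T s)))"
    proof -
      have "integral {s..t} (\<lambda>t. (1/2) *\<^sub>R (f t + k t)) = (1/2) *\<^sub>R (integral {s..t} f + integral {s..t} k)"
        by (simp only: integral_cmul integral_add[OF fk])
      moreover have "(x - z) + (y - z) = (x + y) - (z + z)" for x y z :: 'a by simp
      ultimately show ?thesis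
        by (simp only: scaleR_diff_right scaleR_half_double)
    qed
    also have "norm \<dots> \<le> (1/2) * (norm (integral {s..t} f - (T t - T s)) + norm (integral {s..t} k - (T t - T s)))"
      by (simp add: norm_triangle_ineq)
    also have "\<dots> \<le> (1/2) * (1 / real (Suc n) + 1 / real (Suc n))"
      using that st unfolding A_def by (intro mult_left_mono add_mono) auto
    finally show "norm (integral {s..t} (\<lambda>t. (1/2) *\<^sub>R (f t + k t)) - (T t - T s)) \<le> 1 / real (Suc n)"
      by simp
  qed
  \<comment> \<open>Parallelogram law: the squared norms are at most \<beta> + 1 / Suc N, while the
    midpoint lies in \<open>A N\<close> and so has squared norm at least \<alpha> N. The bound
    vanishes in the limit because \<alpha> N increases to \<beta>.\<close>
  have diff: "sq (\<lambda>t. h m t - h n t) \<le> 2 * (\<beta> - \<alpha> N) * 2 + 4 / real (Suc N)"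
    if "N \<le> m" "N \<le> n" for m n N
  proof -
    have "h m \<in> A N" "h n \<in> A N"
      using h(1) Amono that by blast+
    then have "\<alpha> N \<le> sq (\<lambda>t. (1/2) *\<^sub>R (h m t + h n t))"
      unfolding \<alpha>_def by (intro cInf_lower bdd imageI half)
    moreover have hb: "sq (h k) \<le> \<beta> + 1 / real (Suc N)" if "N \<le> k" for k
    proof -
      have "1 / real (Suc k) \<le> 1 / real (Suc N)"
        using that by (simp add: frac_le)
      then show ?thesis using h(2)[of k] \<beta>(2)[of k] by linarith
    qed
    have "sq (h m) \<le> \<beta> + 1 / real (Suc N)" "sq (h n) \<le> \<beta> + 1 / real (Suc N)"
      using that hb by blast+
    moreover have "sq (\<lambda>t. h m t - h n t) = 2 * sq (h m) + 2 * sq (h n) - 4 * sq (\<lambda>t. (1/2) *\<^sub>R (h m t + h n t))"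
      unfolding sq_def by (rule integral_parallelogram[OF hsq hsq])
    moreover have "4 / real (Suc N) = 4 * (1 / real (Suc N))" by simp
    moreover have "S \<le> 2 * (\<beta> - a) * 2 + q"
      if "a \<le> m" "x \<le> \<beta> + p" "y \<le> \<beta> + p" "S = 2 * x + 2 * y - 4 * m" "q = 4 * p" for a m x y S p q :: real
      using that by argo
    ultimately show ?thesis by blast
  qed
  have "(\<lambda>N. 2 * (\<beta> - \<alpha> N) * 2 + 4 / real (Suc N)) \<longlonglongrightarrow> 2 * (\<beta> - \<beta>) * 2 + 0"
    by (intro tendsto_intros \<beta> LIMSEQ_Suc lim_const_over_n)
  then have lim0: "(\<lambda>N. 2 * (\<beta> - \<alpha> N) * 2 + 4 / real (Suc N)) \<longlonglongrightarrow> 0" by simp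
  have Cau: "\<exists>N. \<forall>m\<ge>N. \<forall>n\<ge>N. integral {a..b} (\<lambda>t. (norm (h m t - h n t))\<^sup>2) < e" if e: "0 < e" for e
  proof -
    obtain N where "2 * (\<beta> - \<alpha> N) * 2 + 4 / real (Suc N) < e"
      using order_tendstoD(2)[OF lim0 e] by (auto simp: eventually_sequentially)
    then show ?thesis
      using diff[of N] unfolding sq_def by (intro exI[of _ N] allI impI) (rule order_le_less_trans)
  qed
  have "(\<lambda>n. \<alpha> n + 1 / real (Suc n)) \<longlonglongrightarrow> \<beta> + 0"
    by (intro tendsto_intros \<beta> LIMSEQ_Suc lim_const_over_n)
  then have limC: "(\<lambda>n. \<alpha> n + 1 / real (Suc n)) \<longlonglongrightarrow> \<beta>" by simp
  have bound: "integral {a..b} (\<lambda>t. (norm (h n t))\<^sup>2) \<le> \<alpha> n + 1 / real (Suc n)" for n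
    using h(2)[of n] by (simp add: sq_def)
  obtain G r where G: "G square_integrable_on {a..b}" "strict_mono (r :: nat \<Rightarrow> nat)"
    "\<And>s t. a \<le> s \<Longrightarrow> s \<le> t \<Longrightarrow> t \<le> b \<Longrightarrow>
       (\<lambda>j. integral {s..t} (h (r j))) \<longlonglongrightarrow> integral {s..t} G"
    "integral {a..b} (\<lambda>t. (norm (G t))\<^sup>2) \<le> \<beta>"
    using square_integrable_complete[OF ab hsq Cau bound limC] by blast
  have \<beta>c: "\<beta> \<le> c"
    by (rule LIMSEQ_le_const2[OF \<beta>(1)]) (auto simp: \<alpha>c)
  show ?thesis
  proof (rule that[OF G(1)])
    show "integral {a..b} (\<lambda>t. (norm (G t))\<^sup>2) \<le> c"
      using G(4) \<beta>c by linarith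
    fix s t assume st: "a \<le> s" "s \<le> t" "t \<le> b"
    have "(\<lambda>j. norm (integral {s..t} (h (r j)) - (T t - T s))) \<longlonglongrightarrow> norm (integral {s..t} G - (T t - T s))"
      by (intro tendsto_intros G st)
    moreover have "(\<lambda>j. norm (integral {s..t} (h (r j)) - (T t - T s))) \<longlonglongrightarrow> 0"
    proof (rule Lim_null_comparison)
      show "(\<lambda>j. 1 / real (Suc (r j))) \<longlonglongrightarrow> 0"
        using LIMSEQ_subseq_LIMSEQ[OF LIMSEQ_Suc[OF lim_1_over_n] G(2)] by (simp add: o_def)
      show "\<forall>\<^sub>F j in sequentially. norm (norm (integral {s..t} (h (r j)) - (T t - T s))) \<le> 1 / real (Suc (r j))"
        using h(1)[unfolded A_def] st by simp
    qed
    ultimately have "norm (integral {s..t} G - (T t - T s)) = 0"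
      by (rule LIMSEQ_unique)
    then show "T t - T s = integral {s..t} G" by simp
  qed
qed

section \<open>Almost everywhere differentiation of indefinite integrals\<close>

lemma indefinite_integral_right_derivative_AE:
  fixes f g :: "real \<Rightarrow> 'a::euclidean_space"
  assumes g: "g integrable_on {a..b}"
    and f: "\<And>s t. a \<le> s \<Longrightarrow> s \<le> t \<Longrightarrow> t \<le> b \<Longrightarrow> f t - f s = integral {s..t} g"
  obtains N where "negligible N"
    "\<And>x. x \<in> {a..<b} - N \<Longrightarrow> ((\<lambda>h. (f (x + h) - f x) /\<^sub>R h) \<longlongrightarrow> g x) (at_right 0)"
proof -
  \<comment> \<open>Extension by zero supplies integrability on every cube. The differentiation
    theorem averages over cubes with corner x, that is over {x..x + h}, which is why the derivative
    is one-sided.\<close>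
  define k where "k x = (if x \<in> {a..b} then g x else 0)" for x
  have "k integrable_on UNIV"
    using g unfolding k_def by (simp only: integrable_restrict_UNIV)
  then have "k integrable_on cbox c d" for c d
    by (rule integrable_on_subcbox) simp
  then obtain N where N: "negligible N"
       "\<And>x e. \<lbrakk>x \<notin> N; 0 < e\<rbrakk> \<Longrightarrow>
               \<exists>d>0. \<forall>h. 0 < h \<and> h < d \<longrightarrow>
                         norm(integral (cbox x (x + h *\<^sub>R One)) k /\<^sub>R h ^ DIM(real) - k x) < e"
    using integrable_ccontinuous_explicit[of k] by blast
  show ?thesis
  proof (rule that[OF N(1)])
    fix x assume x: "x \<in> {a..<b} - N"
    show "((\<lambda>h. (f (x + h) - f x) /\<^sub>R h) \<longlongrightarrow> g x) (at_right 0)"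
    proof (rule tendstoI)
      fix e :: real assume "0 < e"
      then obtain d where d: "0 < d" "\<And>h. 0 < h \<Longrightarrow> h < d \<Longrightarrow> norm (integral {x..x + h} k /\<^sub>R h - k x) < e"
        using N(2)[of x e] x by auto
      have "dist ((f (x + h) - f x) /\<^sub>R h) (g x) < e" if "0 < h" "h < min d (b - x)" for h
      proof -
        have "integral {x..x + h} k = integral {x..x + h} g"
          using that x by (intro integral_cong) (auto simp: k_def)
        also have "\<dots> = f (x + h) - f x"
          using that x by (intro f[symmetric]) auto
        finally show ?thesis
          using d(2)[of h] that x by (auto simp: dist_norm k_def)
      qed
      moreover have "\<forall>\<^sub>F h in at_right 0. 0 < h \<and> h < min d (b - x)"
        using d(1) x by (intro eventually_at_rightI[of _ "min d (b - x)"]) auto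
      ultimately show "\<forall>\<^sub>F h in at_right 0. dist ((f (x + h) - f x) /\<^sub>R h) (g x) < e"
        by (auto elim: eventually_mono)
    qed
  qed
qed

text \<open>Both densities are the right derivative of \<open>f\<close> off a null set. This makes
  the choice hidden in \<open>second_deriv\<close> harmless for the bending energy.\<close>

lemma indefinite_integral_unique_AE:
  fixes f g h :: "real \<Rightarrow> 'a::euclidean_space"
  assumes "g integrable_on {a..b}" "h integrable_on {a..b}"
    and "\<And>s t. a \<le> s \<Longrightarrow> s \<le> t \<Longrightarrow> t \<le> b \<Longrightarrow> f t - f s = integral {s..t} g"
    and "\<And>s t. a \<le> s \<Longrightarrow> s \<le> t \<Longrightarrow> t \<le> b \<Longrightarrow> f t - f s = integral {s..t} h"
  shows "negligible {x \<in> {a..b}. g x \<noteq> h x}"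
proof -
  obtain N where N: "negligible N"
    "\<And>x. x \<in> {a..<b} - N \<Longrightarrow> ((\<lambda>h. (f (x + h) - f x) /\<^sub>R h) \<longlongrightarrow> g x) (at_right 0)"
    using indefinite_integral_right_derivative_AE[OF assms(1,3)] by blast
  obtain N' where N': "negligible N'"
    "\<And>x. x \<in> {a..<b} - N' \<Longrightarrow> ((\<lambda>h. (f (x + h) - f x) /\<^sub>R h) \<longlongrightarrow> h x) (at_right 0)"
    using indefinite_integral_right_derivative_AE[OF assms(2,4)] by blast
  have "negligible (N \<union> N' \<union> {b})"
    using N(1) N'(1) by simp
  moreover have "g x = h x" if "x \<in> {a..<b}" "x \<notin> N" "x \<notin> N'" for x
    using tendsto_unique[OF trivial_limit_at_right_real N(2) N'(2)] that by blast
  then have "{x \<in> {a..b}. g x \<noteq> h x} \<subseteq> N \<union> N' \<union> {b}"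
    by force
  ultimately show ?thesis by (rule negligible_subset)
qed

text \<open>Differentiate the constant squared norm of \<open>f\<close>. Applied to unit tangents it
  says that the curvature vector is normal.\<close>

lemma indefinite_integral_orthogonal_AE:
  fixes f g :: "real \<Rightarrow> 'a::euclidean_space"
  assumes "g integrable_on {a..b}"
    and f: "\<And>s t. a \<le> s \<Longrightarrow> s \<le> t \<Longrightarrow> t \<le> b \<Longrightarrow> f t - f s = integral {s..t} g"
    and const: "\<And>t. t \<in> {a..b} \<Longrightarrow> norm (f t) = c"
  shows "negligible {x \<in> {a..b}. f x \<bullet> g x \<noteq> 0}"
proof -
  obtain N where N: "negligible N"
    "\<And>x. x \<in> {a..<b} - N \<Longrightarrow> ((\<lambda>h. (f (x + h) - f x) /\<^sub>R h) \<longlongrightarrow> g x) (at_right 0)"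
    using indefinite_integral_right_derivative_AE[OF assms(1,2)] by blast
  have "f x \<bullet> g x = 0" if x: "x \<in> {a..<b} - N" for x
  proof -
    have h0: "((\<lambda>h. h) \<longlongrightarrow> 0) (at_right (0::real))"
      by (rule tendsto_ident_at)
    have "((\<lambda>h. h *\<^sub>R ((f (x + h) - f x) /\<^sub>R h)) \<longlongrightarrow> 0 *\<^sub>R g x) (at_right 0)"
      by (intro tendsto_scaleR h0 N x)
    then have "((\<lambda>h. f x + f x + h *\<^sub>R ((f (x + h) - f x) /\<^sub>R h)) \<longlongrightarrow> f x + f x + 0) (at_right 0)"
      by (intro tendsto_add tendsto_const) simp
    \<comment> \<open>The first factor is f x + f (x + h) in disguise, so its product with the
      difference quotient is the difference quotient of the squared norm, which is zero; written
      this way its limit can be read off.\<close>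
    then have "((\<lambda>h. (f x + f x + h *\<^sub>R ((f (x + h) - f x) /\<^sub>R h)) \<bullet> ((f (x + h) - f x) /\<^sub>R h))
        \<longlongrightarrow> (f x + f x + 0) \<bullet> g x) (at_right 0)"
      by (intro tendsto_inner N x)
    moreover have "\<forall>\<^sub>F h in at_right 0.
        (f x + f x + h *\<^sub>R ((f (x + h) - f x) /\<^sub>R h)) \<bullet> ((f (x + h) - f x) /\<^sub>R h) = 0"
    proof (rule eventually_at_rightI[of _ "b - x"])
      fix h assume h: "h \<in> {0<..<b - x}"
      have "norm (f (x + h)) = norm (f x)"
        using h x by (simp add: const)
      then have "f (x + h) \<bullet> f (x + h) = f x \<bullet> f x"
        by (simp flip: power2_norm_eq_inner)
      then have "(f x + f (x + h)) \<bullet> (f (x + h) - f x) = 0"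
        by (simp add: inner_add_left inner_diff_right inner_commute[of "f (x + h)" "f x"])
      then show "(f x + f x + h *\<^sub>R ((f (x + h) - f x) /\<^sub>R h)) \<bullet> ((f (x + h) - f x) /\<^sub>R h) = 0"
        using h by simp
    qed (use x in auto)
    ultimately have "((\<lambda>h. 0) \<longlongrightarrow> (f x + f x + 0) \<bullet> g x) (at_right (0::real))"
      by (rule Lim_transform_eventually)
    then have "(f x + f x + 0) \<bullet> g x = 0"
      by (simp add: tendsto_const_iff)
    then show ?thesis by (simp add: inner_add_left)
  qed
  then have "{x \<in> {a..b}. f x \<bullet> g x \<noteq> 0} \<subseteq> N \<union> {b}"
    by force
  moreover have "negligible (N \<union> {b})"
    using N(1) by simp
  ultimately show ?thesis by (rule negligible_subset[rotated])
qed

section \<open>Uniform bilipschitz bound\<close>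

lemma periodic1_int:
  assumes "periodic1 \<gamma>"
  shows "\<gamma> (t + of_int k) = \<gamma> t"
proof (induction k rule: int_induct[of _ 0])
  case (step1 i)
  have "\<gamma> (t + of_int (i + 1)) = \<gamma> ((t + of_int i) + 1)" by (simp add: add.assoc)
  then show ?case using step1 assms by (simp add: periodic1_def)
next
  case (step2 i)
  have "\<gamma> (t + of_int (i - 1)) = \<gamma> ((t + of_int (i - 1)) + 1)"
    using assms[unfolded periodic1_def, rule_format, of "t + of_int (i - 1)"] by (rule sym)
  also have "\<dots> = \<gamma> (t + of_int i)" by (simp add: algebra_simps)
  finally show ?case using step2 by simp
qed simp

lemma periodic1_diff_int:
  assumes "periodic1 \<gamma>"
  shows "\<gamma> (t - of_int k) = \<gamma> t"
  using periodic1_int[OF assms, of t "- k"] by simp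

lemma has_vector_derivative_shift:
  "(f has_vector_derivative D) (at (t + c)) \<Longrightarrow> ((\<lambda>x. f (x + c)) has_vector_derivative D) (at t)"
  using vector_diff_chain_at[of "\<lambda>x. x + c" 1 t f D]
  by (simp add: o_def has_vector_derivative_add_const)

lemma W22_closed_has_vector_derivative:
  "W22_closed \<gamma> \<Longrightarrow> (\<gamma> has_vector_derivative dcurve \<gamma> t) (at t)"
  by (simp add: W22_closed_def vector_derivative_works[symmetric])

lemma periodic1_dcurve:
  assumes "W22_closed \<gamma>"
  shows "periodic1 (\<lambda>t. dcurve \<gamma> t)"
  unfolding periodic1_def
proof
  fix t
  have "((\<lambda>x. \<gamma> (x + 1)) has_vector_derivative dcurve \<gamma> (t + 1)) (at t)"
    by (intro has_vector_derivative_shift W22_closed_has_vector_derivative assms)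
  moreover have "(\<lambda>x. \<gamma> (x + 1)) = \<gamma>"
    using assms by (auto simp: W22_closed_def periodic1_def)
  ultimately show "dcurve \<gamma> (t + 1) = dcurve \<gamma> t"
    by (simp add: vector_derivative_at)
qed

text \<open>Inside one period Young's inequality with weight sqrt (t - s) gives the constant (M + 1)
  / 2. An interval containing an integer is split there, using that \<open>f\<close> takes the same
  value at 0 and 1, and the two pieces cost the factor 2.\<close>

lemma periodic1_holder:
  fixes f :: curve
  assumes per: "periodic1 f" and g: "g square_integrable_on {0..1}"
    and f: "\<And>s t. 0 \<le> s \<Longrightarrow> s \<le> t \<Longrightarrow> t \<le> 1 \<Longrightarrow> f t - f s = integral {s..t} g"
    and M: "integral {0..1} (\<lambda>t. (norm (g t))\<^sup>2) \<le> M" and st: "\<bar>t - s\<bar> \<le> 1"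
  shows "norm (f t - f s) \<le> (M + 1) * sqrt \<bar>t - s\<bar>"
proof -
  have "0 \<le> integral {0..1} (\<lambda>t. (norm (g t))\<^sup>2)"
    by (intro integral_nonneg square_integrable_on_D g) auto
  then have M0: "0 \<le> M" using M by simp
  have unit: "norm (f t - f s) \<le> (M + 1) / 2 * sqrt (t - s)" if "0 \<le> s" "s \<le> t" "t \<le> 1" for s t
  proof (cases "s = t")
    case False
    then have lt: "s < t" using that by simp
    have gst: "g square_integrable_on {s..t}"
      by (rule square_integrable_on_subinterval[OF g]) (use that in auto)
    have "norm (f t - f s) \<le> integral {s..t} (\<lambda>t. norm (g t))"
      unfolding f[OF that]
      using square_integrable_on_D(1)[OF gst]
      by (intro integral_norm_bound_integral) (auto simp: absolutely_integrable_on_def)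
    also have "\<dots> \<le> (sqrt (t - s) * integral {s..t} (\<lambda>t. (norm (g t))\<^sup>2) + (t - s) / sqrt (t - s)) / 2"
      by (rule integral_norm_le_square[OF gst]) (use lt in auto)
    also have "(t - s) / sqrt (t - s) = sqrt (t - s)"
      using lt by (simp add: real_div_sqrt)
    also have "integral {s..t} (\<lambda>t. (norm (g t))\<^sup>2) \<le> integral {0..1} (\<lambda>t. (norm (g t))\<^sup>2)"
      by (rule integral_subset_le) (use that in \<open>auto intro!: square_integrable_on_D g gst\<close>)
    then have "(sqrt (t - s) * integral {s..t} (\<lambda>t. (norm (g t))\<^sup>2) + sqrt (t - s)) / 2
        \<le> (sqrt (t - s) * M + sqrt (t - s)) / 2"
      using M lt by (intro divide_right_mono add_right_mono mult_left_mono) auto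
    finally show ?thesis by (simp add: distrib_right mult.commute)
  qed simp
  have main: "norm (f t - f s) \<le> (M + 1) * sqrt (t - s)" if "s \<le> t" "t \<le> s + 1" for s t
  proof -
    define k where "k = \<lfloor>s\<rfloor>"
    define s' where "s' = s - of_int k"
    define t' where "t' = t - of_int k"
    have s': "0 \<le> s'" "s' < 1" unfolding s'_def k_def by linarith+
    have t': "s' \<le> t'" "t' \<le> s' + 1" using that by (auto simp: s'_def t'_def)
    have eq: "f t - f s = f t' - f s'" "t - s = t' - s'"
      by (simp_all add: s'_def t'_def periodic1_diff_int[OF per])
    show ?thesis unfolding eq
    proof (cases "t' \<le> 1")
      case True
      have "norm (f t' - f s') \<le> (M + 1) / 2 * sqrt (t' - s')"
        using unit[of s' t'] s' t' True by simp
      also have "\<dots> \<le> (M + 1) * sqrt (t' - s')"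
        using M0 t' by (intro mult_right_mono) auto
      finally show "norm (f t' - f s') \<le> (M + 1) * sqrt (t' - s')" .
    next
      case False
      have "f t' = f (t' - 1)" "f 1 = f 0"
        using periodic1_diff_int[OF per, of t' 1] periodic1_diff_int[OF per, of 1 1] by auto
      then have "norm (f t' - f s') \<le> norm (f (t' - 1) - f 0) + norm (f 1 - f s')"
        using norm_triangle_ineq[of "f (t' - 1) - f 0" "f 1 - f s'"] by simp
      also have "\<dots> \<le> (M + 1) / 2 * sqrt (t' - 1 - 0) + (M + 1) / 2 * sqrt (1 - s')"
        using s' t' False by (intro add_mono unit) auto
      also have "\<dots> \<le> (M + 1) / 2 * sqrt (t' - s') + (M + 1) / 2 * sqrt (t' - s')"
        using s' t' False M0 by (intro add_mono mult_left_mono) auto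
      finally show "norm (f t' - f s') \<le> (M + 1) * sqrt (t' - s')" by simp
    qed
  qed
  show ?thesis
    using main[of s t] main[of t s] st by (cases "s \<le> t") (auto simp: norm_minus_commute)
qed

lemma holder_half_imp_continuous:
  fixes f :: "real \<Rightarrow> 'a::real_normed_vector"
  assumes "\<And>s t. \<bar>t - s\<bar> \<le> 1 \<Longrightarrow> norm (f t - f s) \<le> C * sqrt \<bar>t - s\<bar>"
  shows "continuous_on UNIV f"
proof -
  have "(f \<longlongrightarrow> f x) (at x)" for x
  proof (rule Lim_transform[OF tendsto_const], rule Lim_null_comparison)
    show "\<forall>\<^sub>F t in at x. norm (f t - f x) \<le> C * sqrt \<bar>t - x\<bar>"
      using assms by (auto simp: eventually_at dist_real_def intro!: exI[of _ 1])
    have "((\<lambda>t. C * sqrt \<bar>t - x\<bar>) \<longlongrightarrow> C * sqrt \<bar>x - x\<bar>) (at x)"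
      by (intro tendsto_intros)
    then show "((\<lambda>t. C * sqrt \<bar>t - x\<bar>) \<longlongrightarrow> 0) (at x)" by simp
  qed
  then show ?thesis by (simp add: continuous_on_def)
qed

lemma W22_closed_weak_second_deriv:
  assumes "weak_second_deriv \<gamma> g"
  shows "g square_integrable_on {0..1}"
    "\<And>s t. 0 \<le> s \<Longrightarrow> s \<le> t \<Longrightarrow> t \<le> 1 \<Longrightarrow> dcurve \<gamma> t - dcurve \<gamma> s = integral {s..t} g"
  using assms by (auto simp: weak_second_deriv_def square_integrable_on_def)

lemma W22_closed_holder:
  assumes "W22_closed \<gamma>" "weak_second_deriv \<gamma> g"
    and "integral {0..1} (\<lambda>t. (norm (g t))\<^sup>2) \<le> M" "\<bar>t - s\<bar> \<le> 1"
  shows "norm (dcurve \<gamma> t - dcurve \<gamma> s) \<le> (M + 1) * sqrt \<bar>t - s\<bar>"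
  by (rule periodic1_holder[OF periodic1_dcurve[OF assms(1)] W22_closed_weak_second_deriv[OF assms(2)] assms(3,4)])

lemma W22_closed_continuous_dcurve:
  assumes "W22_closed \<gamma>"
  shows "continuous_on UNIV (\<lambda>t. dcurve \<gamma> t)"
proof -
  obtain g where g: "weak_second_deriv \<gamma> g" using assms by (auto simp: W22_closed_def)
  show ?thesis
    by (rule holder_half_imp_continuous) (rule W22_closed_holder[OF assms g order_refl])
qed

lemma W22_closed_continuous:
  "W22_closed \<gamma> \<Longrightarrow> continuous_on S \<gamma>"
  by (rule continuous_on_subset[OF differentiable_imp_continuous_on])
     (auto simp: W22_closed_def differentiable_on_def differentiable_at_withinI)

section \<open>Tangent-point energy of strands that nearly touch\<close>

lemma norm_cross3_le: "norm (cross3 x y) \<le> norm x * norm y"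
proof (rule power2_le_imp_le)
  show "(norm (cross3 x y))\<^sup>2 \<le> (norm x * norm y)\<^sup>2"
    using norm_cross_dot[of x y] zero_le_power2[of "x \<bullet> y"] by linarith
qed simp

text \<open>For the chord \<open>v\<close> orthogonal to the tangent \<open>a\<close> the inverse
  radius is 2 / \<epsilon>. The perturbations cost at most 1/4 + 5/16 of the cross product and
  lengthen the chord by at most a factor 5/4, so a quarter of that value survives.\<close>

lemma inv_rtp_ge:
  fixes a b v w :: "real^3"
  assumes "norm a = 1" "norm b = 1" "a \<bullet> v = 0" "norm v = \<epsilon>" "0 < \<epsilon>"
    and wv: "norm (w - v) \<le> \<epsilon> / 4" and ba: "norm (b - a) \<le> 1 / 4"
  shows "2 * norm (cross3 b w) / (norm b * (norm w)\<^sup>2) \<ge> 1 / (2 * \<epsilon>)"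
proof -
  have "(norm (cross3 a v))\<^sup>2 = \<epsilon>\<^sup>2"
    using assms by (simp add: norm_cross)
  then have av: "norm (cross3 a v) = \<epsilon>"
    using assms by (simp add: power2_eq_iff_nonneg)
  have w: "norm w \<le> 5 / 4 * \<epsilon>" "norm w \<ge> 3 / 4 * \<epsilon>"
    using wv norm_triangle_ineq2[of w v] norm_triangle_ineq2[of v w] assms(4) by (auto simp: norm_minus_commute)
  have "cross3 b w = cross3 a v + cross3 a (w - v) + cross3 (b - a) w"
    by (simp add: Cross3.left_diff_distrib Cross3.right_diff_distrib)
  then have "norm (cross3 a v) \<le> norm (cross3 b w) + norm (cross3 a (w - v)) + norm (cross3 (b - a) w)"
    using norm_triangle_ineq4[of "cross3 b w" "cross3 a (w - v) + cross3 (b - a) w"]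
      norm_triangle_ineq[of "cross3 a (w - v)" "cross3 (b - a) w"] by (simp add: algebra_simps)
  moreover have "norm (cross3 a (w - v)) \<le> \<epsilon> / 4"
    using norm_cross3_le[of a "w - v"] assms by simp
  moreover have "norm (cross3 (b - a) w) \<le> 1 / 4 * (5 / 4 * \<epsilon>)"
    using norm_cross3_le[of "b - a" w] mult_mono[OF ba w(1)] by simp
  ultimately have bw: "norm (cross3 b w) \<ge> 7 / 16 * \<epsilon>"
    using av by simp
  \<comment> \<open>25/64 is chosen to make the quotient come out exactly; it lies below the
    available 7/16 = 28/64.\<close>
  have "1 / (2 * \<epsilon>) = 2 * (25 / 64 * \<epsilon>) / (25 / 16 * \<epsilon>\<^sup>2)"
    using assms by (simp add: power2_eq_square)
  also have "\<dots> \<le> 2 * norm (cross3 b w) / (norm w)\<^sup>2"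
  proof (rule frac_le)
    show "2 * (25 / 64 * \<epsilon>) \<le> 2 * norm (cross3 b w)" using bw assms by simp
    have "(norm w)\<^sup>2 \<le> (5 / 4 * \<epsilon>)\<^sup>2" by (rule power_mono[OF w(1)]) simp
    then show "(norm w)\<^sup>2 \<le> 25 / 16 * \<epsilon>\<^sup>2" by (simp add: power_mult_distrib power2_eq_square)
    have "norm w > 0" using w(2) assms by linarith
    then show "0 < (norm w)\<^sup>2" by simp
  qed simp
  finally show ?thesis using assms by simp
qed

text \<open>The energy integrates over the unit square only, so a parameter near the boundary needs
  its neighbourhood on the inner side.\<close>

lemma exists_subinterval_unit:
  fixes x h :: real
  assumes "x \<in> {0..1}" "0 \<le> h" "h \<le> 1/2"
  obtains a where "{a..a + h} \<subseteq> {0..1}" "\<And>y. y \<in> {a..a + h} \<Longrightarrow> \<bar>y - x\<bar> \<le> h"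
proof (cases "x \<le> 1/2")
  case True then show ?thesis using assms by (intro that[of x]) auto
next
  case False then show ?thesis using assms by (intro that[of "x - h"]) auto
qed

lemma tangent_point_ge_const:
  assumes "{a..a + h} \<subseteq> {0..1}" "{b..b + h} \<subseteq> {0..1}" "0 \<le> h" "0 \<le> K"
    and unit: "\<And>t. norm (dcurve \<gamma> t) = 1"
    and K: "\<And>s t. s \<in> {a..a + h} \<Longrightarrow> t \<in> {b..b + h} \<Longrightarrow> K \<le> inv_rtp \<gamma> s t powr q"
  shows "ennreal (K * h\<^sup>2) \<le> tangent_point q \<gamma>"
proof -
  let ?Q = "{a..a + h} \<times> {b..b + h}"
  have Q: "?Q \<in> sets lborel"
    by (simp add: borel_closed closed_Times)
  have "emeasure (lborel :: (real \<times> real) measure) ?Q = ennreal (h\<^sup>2)"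
    unfolding lborel_prod[symmetric]
    using assms(3) by (subst lborel.emeasure_pair_measure_Times) (auto simp: power2_eq_square ennreal_mult)
  then have "ennreal (K * h\<^sup>2) = (\<integral>\<^sup>+ p. ennreal K * indicator ?Q p \<partial>lborel)"
    using Q assms by (simp add: nn_integral_cmult_indicator ennreal_mult)
  also have "\<dots> \<le> tangent_point q \<gamma>"
    unfolding tangent_point_def
  proof (rule nn_integral_mono)
    fix p :: "real \<times> real"
    show "ennreal K * indicator ?Q p \<le> indicator ({0..1} \<times> {0..1}) p *
        ennreal (inv_rtp \<gamma> (fst p) (snd p) powr q * norm (dcurve \<gamma> (fst p)) * norm (dcurve \<gamma> (snd p)))"
    proof (cases "p \<in> ?Q")
      case True
      then have "p \<in> {0..1} \<times> {0..1}" using assms(1,2) by auto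
      then show ?thesis using True K[of "fst p" "snd p"] by (auto simp: unit intro!: ennreal_leI)
    qed simp
  qed
  finally show ?thesis .
qed

lemma unit_speed_lipschitz:
  assumes der: "\<And>t. (\<gamma> has_vector_derivative dcurve \<gamma> t) (at t)" and unit: "\<And>t. norm (dcurve \<gamma> t) = 1"
  shows "norm (\<gamma> t - \<gamma> s) \<le> \<bar>t - s\<bar>"
proof -
  have "onorm (\<lambda>h. h *\<^sub>R dcurve \<gamma> x) \<le> 1" for x
    by (rule onorm_le) (simp add: unit)
  then show ?thesis
    using differentiable_bound[of UNIV \<gamma> "\<lambda>x h. h *\<^sub>R dcurve \<gamma> x" 1 t s] der
    by (simp add: has_vector_derivative_def)
qed

text \<open>Linearise at \<open>s\<close>: the tangent turns by at most 1/2 on the segment, so the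
  chord differs from (t - s) times the unit tangent by at most half its length.\<close>

lemma local_bilipschitz:
  fixes \<gamma> :: curve
  assumes der: "\<And>t. (\<gamma> has_vector_derivative dcurve \<gamma> t) (at t)"
    and unit: "\<And>t. norm (dcurve \<gamma> t) = 1"
    and hold: "\<And>s t. \<bar>t - s\<bar> \<le> 1 \<Longrightarrow> norm (dcurve \<gamma> t - dcurve \<gamma> s) \<le> C * sqrt \<bar>t - s\<bar>"
    and C: "0 \<le> C" and \<delta>: "\<delta> \<le> 1" "C * sqrt \<delta> \<le> 1 / 2" and st: "\<bar>t - s\<bar> \<le> \<delta>"
  shows "\<bar>t - s\<bar> / 2 \<le> norm (\<gamma> t - \<gamma> s)"
proof -
  have "norm (\<gamma> t - \<gamma> s - (t - s) *\<^sub>R dcurve \<gamma> s) \<le> norm (t - s) * (1/2)"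
  proof (rule vector_differentiable_bound_linearization[where S="closed_segment s t"])
    show "(\<gamma> has_vector_derivative dcurve \<gamma> x) (at x within closed_segment s t)" for x
      by (rule has_vector_derivative_at_within[OF der])
    fix x assume "x \<in> closed_segment s t"
    then have x: "\<bar>x - s\<bar> \<le> \<bar>t - s\<bar>"
      by (auto simp: closed_segment_eq_real_ivl split: if_splits)
    have "norm (dcurve \<gamma> x - dcurve \<gamma> s) \<le> C * sqrt \<bar>x - s\<bar>"
      using x st \<delta> by (intro hold) simp
    also have "\<dots> \<le> C * sqrt \<delta>"
      using x st C by (intro mult_left_mono) auto
    finally show "norm (dcurve \<gamma> x - dcurve \<gamma> s) \<le> 1 / 2"
      using \<delta> by simp
  qed auto
  moreover have "norm ((t - s) *\<^sub>R dcurve \<gamma> s) = \<bar>t - s\<bar>"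
    by (simp add: unit)
  ultimately show ?thesis
    using norm_triangle_ineq2[of "(t - s) *\<^sub>R dcurve \<gamma> s" "\<gamma> t - \<gamma> s"]
      norm_minus_commute[of "(t - s) *\<^sub>R dcurve \<gamma> s" "\<gamma> t - \<gamma> s"]
    unfolding real_norm_def by argo
qed

text \<open>The order of quantifiers is the point: \<open>c\<close> is fixed before the curve, so it
  serves a whole minimising sequence and its limit. The condition on \<bar>t - s\<bar> selects the
  shorter arc; periodicity would violate the bound at distance 1.\<close>

lemma uniform_bilipschitz:
  fixes q C P :: real
  assumes q: "2 < q" and C: "0 \<le> C" and P: "0 < P"
  obtains c where "0 < c"
    "\<And>\<gamma> s t. \<lbrakk>W22_closed \<gamma>; injective_closed \<gamma>; \<And>t. norm (dcurve \<gamma> t) = 1;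
       \<And>s t. \<bar>t - s\<bar> \<le> 1 \<Longrightarrow> norm (dcurve \<gamma> t - dcurve \<gamma> s) \<le> C * sqrt \<bar>t - s\<bar>;
       tangent_point q \<gamma> \<le> ennreal P; \<bar>t - s\<bar> \<le> 1/2\<rbrakk> \<Longrightarrow> c * \<bar>t - s\<bar> \<le> norm (\<gamma> t - \<gamma> s)"
proof -
  \<comment> \<open>Small enough that C * sqrt \<delta> is at most 1/2, as
    \<open>local_bilipschitz\<close> demands, and at most 1/4, so that {\<delta>..1 - \<delta>} is
    nonempty.\<close>
  define \<delta> where "\<delta> = 1 / (4 * (1 + C\<^sup>2))"
  have C2: "0 < 1 + C\<^sup>2" by (simp add: add_pos_nonneg)
  have \<delta>: "0 < \<delta>" "\<delta> \<le> 1/4" "C\<^sup>2 * \<delta> \<le> 1/4"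
    using C2 by (auto simp: \<delta>_def field_simps)
  have Csqrt: "C * sqrt x \<le> 1/2 * sqrt (x / \<delta>)" if "0 \<le> x" for x
  proof -
    have "C * sqrt x = sqrt (C\<^sup>2 * \<delta>) * sqrt (x / \<delta>)"
      using C \<delta>(1) by (simp add: real_sqrt_mult real_sqrt_divide)
    also have "\<dots> \<le> sqrt (1/4) * sqrt (x / \<delta>)"
      using \<delta> that by (intro mult_right_mono) auto
    also have "sqrt (1/4) = (1/2::real)"
      by (simp add: real_sqrt_divide)
    finally show ?thesis .
  qed
  \<comment> \<open>The solution of \<epsilon>^(2-q) = 64 * 2^q * P: here 2^q comes from the inverse
    radius 1 / (2 * \<epsilon>), and 64 from the square of side \<epsilon> / 8.\<close>
  define \<epsilon>0 where "\<epsilon>0 = (64 * 2 powr q * P) powr (- 1 / (q - 2))"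
  have \<epsilon>0: "0 < \<epsilon>0" using P by (simp add: \<epsilon>0_def)
  define c where "c = min (1/2) (min (\<delta> / 2) \<epsilon>0)"
  have c: "0 < c" "c \<le> 1/2" "c \<le> \<delta> / 2" "c \<le> \<epsilon>0" using \<delta> \<epsilon>0 by (auto simp: c_def)
  show ?thesis
  proof (rule that[OF c(1)])
    fix \<gamma> :: curve and s t :: real
    assume W: "W22_closed \<gamma>" and inj: "injective_closed \<gamma>" and unit: "\<And>t. norm (dcurve \<gamma> t) = 1"
      and hold: "\<And>s t. \<bar>t - s\<bar> \<le> 1 \<Longrightarrow> norm (dcurve \<gamma> t - dcurve \<gamma> s) \<le> C * sqrt \<bar>t - s\<bar>"
      and TP: "tangent_point q \<gamma> \<le> ennreal P" and st: "\<bar>t - s\<bar> \<le> 1/2"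
    note der = W22_closed_has_vector_derivative[OF W]
    have per: "periodic1 \<gamma>" using W by (simp add: W22_closed_def)
    have loc: "\<bar>t - s\<bar> / 2 \<le> norm (\<gamma> t - \<gamma> s)" if "\<bar>t - s\<bar> \<le> \<delta>" for s t
    proof (rule local_bilipschitz[OF der unit hold C _ _ that])
      show "\<delta> \<le> 1" using \<delta> by simp
      show "C * sqrt \<delta> \<le> 1/2" using Csqrt[of \<delta>] \<delta> by simp
    qed
    have lip: "norm (\<gamma> t - \<gamma> s) \<le> \<bar>t - s\<bar>" for s t
      by (rule unit_speed_lipschitz[OF der unit])
    \<comment> \<open>Pairs are coded as (parameter, difference), so that \<open>K\<close> meets every pair modulo periodicity.\<close>
    define K where "K = {p :: real \<times> real. fst p \<in> {0..1} \<and> snd p \<in> {\<delta>..1 - \<delta>}}"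
    have "K = {0..1} \<times> {\<delta>..1 - \<delta>}" by (auto simp: K_def)
    then have "compact K" by (simp add: compact_Times)
    moreover have "(0, 1/2) \<in> K" using \<delta> by (simp add: K_def)
    moreover have "continuous_on K (\<lambda>p. norm (\<gamma> (fst p + snd p) - \<gamma> (fst p)))"
      by (intro continuous_intros continuous_on_compose2[OF W22_closed_continuous[OF W, of UNIV]]) auto
    ultimately obtain p0 where p0: "p0 \<in> K"
      "\<And>p. p \<in> K \<Longrightarrow> norm (\<gamma> (fst p0 + snd p0) - \<gamma> (fst p0)) \<le> norm (\<gamma> (fst p + snd p) - \<gamma> (fst p))"
      using continuous_attains_inf[of K "\<lambda>p. norm (\<gamma> (fst p + snd p) - \<gamma> (fst p))"] by blast
    define s0 where "s0 = fst p0"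
    define t0 where "t0 = fst p0 + snd p0"
    define v where "v = \<gamma> t0 - \<gamma> s0"
    define \<epsilon> where "\<epsilon> = norm v"
    have s0: "s0 \<in> {0..1}" and t0: "t0 - s0 \<in> {\<delta>..1 - \<delta>}"
      using p0(1) by (auto simp: K_def s0_def t0_def)
    have min: "\<epsilon> \<le> norm (\<gamma> y - \<gamma> x)" if "y - x \<in> {\<delta>..1 - \<delta>}" for x y
    proof -
      define k where "k = \<lfloor>x\<rfloor>"
      have "(x - of_int k, y - x) \<in> K"
        using that unfolding K_def k_def by (auto; linarith)
      from p0(2)[OF this] have "\<epsilon> \<le> norm (\<gamma> (y - of_int k) - \<gamma> (x - of_int k))"
        by (simp add: \<epsilon>_def v_def s0_def t0_def)
      then show ?thesis by (simp add: periodic1_diff_int[OF per])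
    qed
    have "\<gamma> t0 \<noteq> \<gamma> s0"
    proof
      assume "\<gamma> t0 = \<gamma> s0"
      then have "t0 - s0 \<in> \<int>" using inj by (simp add: injective_closed_def)
      then obtain k where "t0 - s0 = of_int k" by (auto elim: Ints_cases)
      then have "0 < real_of_int k" "real_of_int k < 1" using t0 \<delta> by auto
      then show False by simp
    qed
    then have \<epsilon>pos: "0 < \<epsilon>" by (simp add: \<epsilon>_def v_def)
    have \<epsilon>ge: "c \<le> \<epsilon>"
    proof (rule ccontr)
      assume "\<not> c \<le> \<epsilon>"
      then have \<epsilon>lt: "\<epsilon> < \<delta> / 2" "\<epsilon> < \<epsilon>0" using c by auto
      \<comment> \<open>At either end of the range of differences the local bound gives a chord of
        at least \<delta> / 2 > \<epsilon>. So the minimum is interior and a first-order condition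
        holds.\<close>
      have "t0 - s0 \<noteq> \<delta>"
        using loc[of t0 s0] \<epsilon>lt \<delta> by (auto simp: \<epsilon>_def v_def)
      moreover have "t0 - s0 \<noteq> 1 - \<delta>"
      proof
        assume "t0 - s0 = 1 - \<delta>"
        then have "\<bar>(t0 - 1) - s0\<bar> = \<delta>" using \<delta> by simp
        then have "\<delta> / 2 \<le> norm (\<gamma> (t0 - 1) - \<gamma> s0)" using loc[of "t0 - 1" s0] by simp
        then show False
          using \<epsilon>lt periodic1_diff_int[OF per, of t0 1] by (simp add: \<epsilon>_def v_def)
      qed
      ultimately have int: "\<delta> < t0 - s0" "t0 - s0 < 1 - \<delta>" using t0 by auto
      define r where "r = min (t0 - s0 - \<delta>) (1 - \<delta> - (t0 - s0))"
      have r: "0 < r" using int by (simp add: r_def)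
      \<comment> \<open>Squared distance to the fixed point \<gamma> t0. Within \<open>r\<close> of
        s0 the difference of parameters stays admissible, so s0 is a local minimum and the tangent
        there is orthogonal to the chord.\<close>
      define \<phi> where "\<phi> x = (\<gamma> t0 - \<gamma> x) \<bullet> (\<gamma> t0 - \<gamma> x)" for x
      have "((\<lambda>x. (\<gamma> t0 - \<gamma> x) \<bullet> (\<gamma> t0 - \<gamma> x)) has_derivative
          (\<lambda>h. (\<gamma> t0 - \<gamma> s0) \<bullet> (0 - h *\<^sub>R dcurve \<gamma> s0) + (0 - h *\<^sub>R dcurve \<gamma> s0) \<bullet> (\<gamma> t0 - \<gamma> s0))) (at s0)"
        using der[of s0] by (intro derivative_intros) (simp_all add: has_vector_derivative_def)
      then have "(\<phi> has_real_derivative (- 2 * (dcurve \<gamma> s0 \<bullet> v))) (at s0)"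
        unfolding \<phi>_def has_field_derivative_def
        by (rule has_derivative_eq_rhs) (auto simp: v_def inner_commute algebra_simps)
      then have "- 2 * (dcurve \<gamma> s0 \<bullet> v) = 0"
      proof (rule DERIV_local_min[OF _ r], intro allI impI)
        fix y assume "\<bar>s0 - y\<bar> < r"
        then have "\<epsilon> \<le> norm (\<gamma> t0 - \<gamma> y)"
          by (intro min) (auto simp: r_def)
        then have "\<epsilon>\<^sup>2 \<le> (norm (\<gamma> t0 - \<gamma> y))\<^sup>2"
          using \<epsilon>pos by (intro power_mono) auto
        then show "\<phi> s0 \<le> \<phi> y"
          by (simp add: \<phi>_def \<epsilon>_def v_def flip: power2_norm_eq_inner)
      qed
      then have orth: "dcurve \<gamma> s0 \<bullet> v = 0" by simp
      \<comment> \<open>Moving each end of the chord by \<epsilon> / 8 changes it by at most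
        \<epsilon> / 4. Since \<epsilon> < \<delta> / 2 this also gives h \<le> \<delta> / 16, so
        the tangent turns by at most 1/8.\<close>
      define h where "h = \<epsilon> / 8"
      have h: "0 < h" "h \<le> 1/2" "h \<le> \<delta> / 16" using \<epsilon>pos \<epsilon>lt \<delta> by (auto simp: h_def)
      \<comment> \<open>t0 may exceed 1; its representative in the unit interval is needed to place
        the square inside the domain of integration.\<close>
      define t1 where "t1 = t0 - of_int \<lfloor>t0\<rfloor>"
      have t1: "t1 \<in> {0..1}" unfolding t1_def by (simp; linarith)
      have \<gamma>t1: "\<gamma> t1 = \<gamma> t0" by (simp add: t1_def periodic1_diff_int[OF per])
      obtain a where a: "{a..a + h} \<subseteq> {0..1}" "\<And>y. y \<in> {a..a + h} \<Longrightarrow> \<bar>y - s0\<bar> \<le> h"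
        using exists_subinterval_unit[OF s0, of h] h by auto
      obtain b where b: "{b..b + h} \<subseteq> {0..1}" "\<And>y. y \<in> {b..b + h} \<Longrightarrow> \<bar>y - t1\<bar> \<le> h"
        using exists_subinterval_unit[OF t1, of h] h by auto
      have "ennreal ((1 / (2 * \<epsilon>)) powr q * h\<^sup>2) \<le> tangent_point q \<gamma>"
      proof (rule tangent_point_ge_const[OF a(1) b(1) _ _ unit])
        fix x y assume xy: "x \<in> {a..a + h}" "y \<in> {b..b + h}"
        have "1 / (2 * \<epsilon>) \<le> inv_rtp \<gamma> x y"
          unfolding inv_rtp_def
        proof (rule inv_rtp_ge[OF unit unit orth \<epsilon>_def[symmetric] \<epsilon>pos])
          have "(\<gamma> y - \<gamma> x) - v = (\<gamma> y - \<gamma> t1) - (\<gamma> x - \<gamma> s0)"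
            by (simp add: v_def \<gamma>t1)
          then have "norm ((\<gamma> y - \<gamma> x) - v) \<le> norm (\<gamma> y - \<gamma> t1) + norm (\<gamma> x - \<gamma> s0)"
            by (metis norm_triangle_ineq4)
          also have "\<dots> \<le> h + h"
            using lip[of y t1] lip[of x s0] a(2)[OF xy(1)] b(2)[OF xy(2)] by linarith
          finally show "norm (\<gamma> y - \<gamma> x - v) \<le> \<epsilon> / 4" by (simp add: h_def)
          have "norm (dcurve \<gamma> x - dcurve \<gamma> s0) \<le> C * sqrt \<bar>x - s0\<bar>"
            using a(2)[OF xy(1)] h by (intro hold) simp
          also have "\<dots> \<le> C * sqrt (\<delta> / 16)"
            using a(2)[OF xy(1)] h C by (intro mult_left_mono real_sqrt_le_mono) auto
          also have "\<dots> \<le> 1/2 * sqrt (1/16)"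
            using Csqrt[of "\<delta> / 16"] \<delta> by simp
          also have "sqrt (1/16) = (1/4::real)"
            by (rule real_sqrt_unique) (simp_all add: power2_eq_square)
          finally show "norm (dcurve \<gamma> x - dcurve \<gamma> s0) \<le> 1/4" by simp
        qed
        then show "(1 / (2 * \<epsilon>)) powr q \<le> inv_rtp \<gamma> x y powr q"
          using \<epsilon>pos q by (intro powr_mono2) auto
      qed (use h in auto)
      also note TP
      finally have "(1 / (2 * \<epsilon>)) powr q * h\<^sup>2 \<le> P"
        using P by (simp add: ennreal_le_iff)
      also have "(1 / (2 * \<epsilon>)) powr q * h\<^sup>2 = \<epsilon> powr (2 - q) / (64 * 2 powr q)"
        using \<epsilon>pos by (simp add: h_def powr_divide powr_mult powr_diff power2_eq_square field_simps)
      finally have "\<epsilon> powr (2 - q) \<le> 64 * 2 powr q * P"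
        by (simp add: field_simps)
      \<comment> \<open>The exponent is negative because q > 2, so the upper bound on the power
        becomes the lower bound \<epsilon>0 \<le> \<epsilon>, a contradiction.\<close>
      then have "(64 * 2 powr q * P) powr (- 1 / (q - 2)) \<le> (\<epsilon> powr (2 - q)) powr (- 1 / (q - 2))"
        using q \<epsilon>pos by (intro powr_mono2') (auto simp: divide_nonpos_pos)
      also have "\<dots> = \<epsilon> powr ((2 - q) * (- 1 / (q - 2)))"
        by (rule powr_powr)
      also have "(2 - q) * (- 1 / (q - 2)) = 1"
        using q by (simp add: field_simps)
      finally show False using \<epsilon>lt \<epsilon>pos by (simp add: \<epsilon>0_def)
    qed
    have far: "c * \<bar>y - x\<bar> \<le> norm (\<gamma> y - \<gamma> x)" if "x \<le> y" "y - x \<le> 1/2" for x y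
    proof (cases "y - x \<le> \<delta>")
      case True
      have "c * \<bar>y - x\<bar> \<le> 1/2 * \<bar>y - x\<bar>"
        using c by (intro mult_right_mono) auto
      then show ?thesis using loc[of y x] True that by simp
    next
      case False
      then have "\<epsilon> \<le> norm (\<gamma> y - \<gamma> x)" using that \<delta> by (intro min) auto
      moreover have "c * \<bar>y - x\<bar> \<le> c * 1"
        using c that by (intro mult_left_mono) auto
      ultimately show ?thesis using \<epsilon>ge by linarith
    qed
    show "c * \<bar>t - s\<bar> \<le> norm (\<gamma> t - \<gamma> s)"
      using far[of s t] far[of t s] st by (cases "s \<le> t") (auto simp: norm_minus_commute abs_minus_commute)
  qed
qed

section \<open>Ambient isotopies\<close>

text \<open>\<open>F\<close> is the lower envelope of cones of slope \<open>L\<close> with apexes on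
  the graph. An infimum of L-Lipschitz functions is L-Lipschitz, and over a point of
  \<open>S\<close> no other cone dips below its own apex.\<close>

lemma lipschitz_extension_real:
  fixes f :: "'a::metric_space \<Rightarrow> real"
  assumes "S \<noteq> {}" "0 \<le> L" and f: "\<And>x y. x \<in> S \<Longrightarrow> y \<in> S \<Longrightarrow> \<bar>f x - f y\<bar> \<le> L * dist x y"
  obtains F where "\<And>x. x \<in> S \<Longrightarrow> F x = f x" "\<And>x y. \<bar>F x - F y\<bar> \<le> L * dist x y"
proof -
  define F where "F x = (INF y\<in>S. f y + L * dist x y)" for x
  obtain z where z: "z \<in> S" using assms by auto
  have bdd: "bdd_below ((\<lambda>y. f y + L * dist x y) ` S)" for x
  proof (rule bdd_belowI2[where m="f z - L * dist x z"])
    fix y assume y: "y \<in> S"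
    have "L * dist z y \<le> L * (dist x z + dist x y)"
      using assms by (intro mult_left_mono) (metis dist_commute dist_triangle, simp)
    then show "f z - L * dist x z \<le> f y + L * dist x y"
      using f[OF z y] by (simp add: algebra_simps)
  qed
  have le: "F x \<le> F y + L * dist x y" for x y
  proof -
    have "F x - L * dist x y \<le> F y"
      unfolding F_def[of y]
    proof (rule cINF_greatest[OF assms(1)])
      fix w assume w: "w \<in> S"
      have "F x \<le> f w + L * dist x w"
        unfolding F_def by (rule cINF_lower[OF bdd w])
      moreover have "L * dist x w \<le> L * (dist x y + dist y w)"
        using assms by (intro mult_left_mono dist_triangle)
      ultimately show "F x - L * dist x y \<le> f w + L * dist y w"
        by (simp add: algebra_simps)
    qed
    then show ?thesis by simp
  qed
  show ?thesis
  proof (rule that[of F])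
    show "\<bar>F x - F y\<bar> \<le> L * dist x y" for x y
      using le[of x y] le[of y x] by (simp add: dist_commute)
    fix x assume x: "x \<in> S"
    have "F x \<le> f x"
      using cINF_lower[OF bdd x, of x] by (simp add: F_def)
    moreover have "f x \<le> F x"
      unfolding F_def
    proof (rule cINF_greatest[OF assms(1)])
      fix y assume "y \<in> S"
      then show "f x \<le> f y + L * dist x y"
        using f[OF x] by (smt (verit))
    qed
    ultimately show "F x = f x" by simp
  qed
qed

text \<open>The coordinates are extended one at a time and recombined by the triangle inequality,
  whence the dimension factor.\<close>

lemma lipschitz_extension:
  fixes f :: "'a::metric_space \<Rightarrow> 'b::euclidean_space" and L :: real
  assumes S: "S \<noteq> {}" "0 \<le> L" and f: "\<And>x y. x \<in> S \<Longrightarrow> y \<in> S \<Longrightarrow> norm (f x - f y) \<le> L * dist x y"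
  obtains F where "\<And>x. x \<in> S \<Longrightarrow> F x = f x" "\<And>x y. norm (F x - F y) \<le> DIM('b) * L * dist x y"
proof -
  have "\<exists>F. (\<forall>x\<in>S. F x = f x \<bullet> i) \<and> (\<forall>x y. \<bar>F x - F y\<bar> \<le> L * dist x y)" if "i \<in> Basis" for i
  proof -
    have "\<bar>f x \<bullet> i - f y \<bullet> i\<bar> \<le> L * dist x y" if "x \<in> S" "y \<in> S" for x y
      using f[OF that] Basis_le_norm[OF \<open>i \<in> Basis\<close>, of "f x - f y"] by (simp add: inner_diff_left)
    then show ?thesis
      using lipschitz_extension_real[OF S, of "\<lambda>x. f x \<bullet> i"] by metis
  qed
  then obtain F where F: "\<And>i x. i \<in> Basis \<Longrightarrow> x \<in> S \<Longrightarrow> F i x = f x \<bullet> i"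
    "\<And>i x y. i \<in> Basis \<Longrightarrow> \<bar>F i x - F i y\<bar> \<le> L * dist x y"
    by metis
  show ?thesis
  proof (rule that[of "\<lambda>x. \<Sum>i\<in>Basis. F i x *\<^sub>R i"])
    show "(\<Sum>i\<in>Basis. F i x *\<^sub>R i) = f x" if "x \<in> S" for x
      using that by (simp add: F euclidean_representation)
    fix x y
    have "norm ((\<Sum>i\<in>Basis. F i x *\<^sub>R i) - (\<Sum>i\<in>Basis. F i y *\<^sub>R i)) = norm (\<Sum>i\<in>Basis. (F i x - F i y) *\<^sub>R (i::'b))"
      by (simp add: sum_subtractf scaleR_diff_left)
    also have "\<dots> \<le> (\<Sum>i\<in>(Basis::'b set). L * dist x y)"
      by (rule sum_norm_le) (use F(2) in auto)
    finally show "norm ((\<Sum>i\<in>Basis. F i x *\<^sub>R i) - (\<Sum>i\<in>Basis. F i y *\<^sub>R i)) \<le> DIM('b) * L * dist x y"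
      by simp
  qed
qed

text \<open>Solving x + V x = y means finding the fixed point of x \<mapsto> y - V x. Subtracting
  two such equations shows that the inverse is Lipschitz with constant 1 / (1 - K).\<close>

lemma homeomorphism_id_plus_contraction:
  fixes V :: "'a::banach \<Rightarrow> 'a"
  assumes K: "0 \<le> K" "K < 1" and V: "\<And>x y. norm (V x - V y) \<le> K * norm (x - y)"
  shows "\<exists>h. homeomorphism UNIV UNIV (\<lambda>x. x + V x) h"
proof -
  have "\<exists>!x. x \<in> UNIV \<and> y - V x = x" for y
    using K V by (intro Banach_fix[where c=K]) (auto simp: dist_norm complete_UNIV norm_minus_commute)
  then have ex: "\<exists>!x. x + V x = y" for y
    by (metis (no_types, lifting) UNIV_I diff_eq_eq)
  define h where "h y = (THE x. x + V x = y)" for y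
  have h: "h y + V (h y) = y" for y
    unfolding h_def by (rule theI'[OF ex])
  have hx: "h (x + V x) = x" for x
    using ex[of "x + V x"] h[of "x + V x"] by blast
  have "norm (h y - h z) \<le> (1 / (1 - K)) * norm (y - z)" for y z
  proof -
    have "h y - h z = (y - z) - (V (h y) - V (h z))"
      using h[of y] h[of z] by (simp add: algebra_simps)
    then have "norm (h y - h z) \<le> norm (y - z) + K * norm (h y - h z)"
      by (metis V add_left_mono norm_triangle_ineq4 order_trans)
    then show ?thesis using K by (simp add: field_simps)
  qed
  then have "(1 / (1 - K))-lipschitz_on UNIV h"
    using K by (intro lipschitz_onI) (auto simp: dist_norm)
  moreover have "K-lipschitz_on UNIV V"
    using K V by (intro lipschitz_onI) (auto simp: dist_norm)
  ultimately have "homeomorphism UNIV UNIV (\<lambda>x. x + V x) h"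
    by (intro homeomorphismI continuous_on_add continuous_on_id)
       (auto simp: h hx intro: lipschitz_on_continuous_on)
  then show ?thesis by blast
qed

text \<open>The isotopies are composed at each time instead of being run one after the other, so
  there is no gluing at an intermediate time.\<close>

lemma ambient_isotopic_trans:
  assumes "ambient_isotopic A B" "ambient_isotopic B C"
  shows "ambient_isotopic A C"
proof -
  obtain H :: "real \<times> (real^3) \<Rightarrow> real^3" where H: "continuous_on ({0..1} \<times> UNIV) H"
      "\<And>t. t\<in>{0..1} \<Longrightarrow> \<exists>h. homeomorphism UNIV UNIV (\<lambda>x. H (t, x)) h"
      "\<And>x. H (0, x) = x" "(\<lambda>x. H (1, x)) ` A = B"
    using assms(1) unfolding ambient_isotopic_def by blast
  obtain J :: "real \<times> (real^3) \<Rightarrow> real^3" where J: "continuous_on ({0..1} \<times> UNIV) J"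
      "\<And>t. t\<in>{0..1} \<Longrightarrow> \<exists>h. homeomorphism UNIV UNIV (\<lambda>x. J (t, x)) h"
      "\<And>x. J (0, x) = x" "(\<lambda>x. J (1, x)) ` B = C"
    using assms(2) unfolding ambient_isotopic_def by blast
  show ?thesis
    unfolding ambient_isotopic_def
  proof (intro exI[of _ "\<lambda>p. J (fst p, H p)"] conjI allI ballI)
    show "continuous_on ({0..1} \<times> UNIV) (\<lambda>p. J (fst p, H p))"
      by (rule continuous_on_compose2[OF J(1)]) (auto intro!: continuous_intros H(1))
    fix t :: real assume t: "t \<in> {0..1}"
    obtain h j where "homeomorphism UNIV UNIV (\<lambda>x. H (t, x)) h" "homeomorphism UNIV UNIV (\<lambda>x. J (t, x)) j"
      using H(2)[OF t] J(2)[OF t] by blast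
    then have "homeomorphism UNIV UNIV ((\<lambda>x. J (t, x)) \<circ> (\<lambda>x. H (t, x))) (h \<circ> j)"
      by (rule homeomorphism_compose)
    then show "\<exists>h. homeomorphism UNIV UNIV (\<lambda>x. J (fst (t, x), H (t, x))) h"
      by (auto simp: o_def)
  next
    show "(\<lambda>x. J (fst (1, x), H (1, x))) ` A = C"
      using H(4) J(4) by (auto simp: image_image)
  qed (simp add: H J)
qed

text \<open>Normalising the length to one must not change the knot class. The dilation factor moves
  linearly from 1 to \<open>c\<close> and stays positive.\<close>

lemma ambient_isotopic_scaleR:
  assumes "0 < c"
  shows "ambient_isotopic A ((\<lambda>x. c *\<^sub>R x) ` A)"
  unfolding ambient_isotopic_def
proof (intro exI[of _ "\<lambda>p. ((1 - fst p) + fst p * c) *\<^sub>R snd p"] conjI allI ballI)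
  fix t :: real assume t: "t \<in> {0..1}"
  define d where "d = 1 - t + t * c"
  have "0 < d"
    using t assms unfolding d_def
    by (cases "t = 0") (auto intro!: add_nonneg_pos)
  then have "homeomorphism UNIV UNIV (\<lambda>x::real^3. d *\<^sub>R x) (\<lambda>x. (1 / d) *\<^sub>R x)"
    by (intro homeomorphismI continuous_intros) auto
  then show "\<exists>h. homeomorphism UNIV UNIV (\<lambda>x::real^3. (1 - fst (t, x) + fst (t, x) * c) *\<^sub>R snd (t, x)) h"
    by (auto simp: d_def)
qed (auto intro!: continuous_intros)

lemma ambient_isotopic_displacement:
  assumes "A \<noteq> {}" "0 \<le> L" "3 * L < 1"
    and V: "\<And>x y. x \<in> A \<Longrightarrow> y \<in> A \<Longrightarrow> norm ((f x - x) - (f y - y)) \<le> L * norm (x - y)"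
  shows "ambient_isotopic A (f ` A)"
proof -
  obtain V where V: "\<And>x. x \<in> A \<Longrightarrow> V x = f x - x" "\<And>x y. norm (V x - V y) \<le> 3 * L * norm (x - y)"
    using lipschitz_extension[of A L "\<lambda>x. f x - x"] assms by (auto simp: dist_norm)
  have "(3 * L)-lipschitz_on UNIV V"
    using assms V(2) by (intro lipschitz_onI) (auto simp: dist_norm)
  then have cont: "continuous_on UNIV V"
    by (rule lipschitz_on_continuous_on)
  show ?thesis
    unfolding ambient_isotopic_def
  proof (intro exI[of _ "\<lambda>p. snd p + fst p *\<^sub>R V (snd p)"] conjI allI ballI)
    show "continuous_on ({0..1} \<times> UNIV) (\<lambda>p. snd p + fst p *\<^sub>R V (snd p))"
      by (intro continuous_intros continuous_on_compose2[OF cont]) auto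
    fix t :: real assume t: "t \<in> {0..1}"
    \<comment> \<open>Shrinking the displacement keeps its Lipschitz constant, so one contraction
      argument covers all times.\<close>
    have "norm (t *\<^sub>R V x - t *\<^sub>R V y) \<le> 3 * L * norm (x - y)" for x y
    proof -
      have "norm (t *\<^sub>R V x - t *\<^sub>R V y) = t * norm (V x - V y)"
        using t by (simp flip: scaleR_diff_right)
      also have "\<dots> \<le> 1 * norm (V x - V y)"
        using t by (intro mult_right_mono) auto
      finally show ?thesis using V(2)[of x y] by simp
    qed
    then show "\<exists>h. homeomorphism UNIV UNIV (\<lambda>x. snd (t, x) + fst (t, x) *\<^sub>R V (snd (t, x))) h"
      using assms homeomorphism_id_plus_contraction[of "3 * L" "\<lambda>x. t *\<^sub>R V x"] by simp
  qed (use V(1) in auto)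
qed

section \<open>Arclength reparametrisation\<close>

text \<open>
  This replaces the chain rule for absolutely continuous functions: the defect of a fundamental
  theorem of calculus is an additive interval function.
\<close>

lemma additive_interval_function_eq_0:
  fixes D :: "real \<Rightarrow> real \<Rightarrow> 'a::real_normed_vector" and G :: "real \<Rightarrow> real \<Rightarrow> real"
  assumes ab: "a \<le> b"
    and D: "\<And>s t u. a \<le> s \<Longrightarrow> s \<le> t \<Longrightarrow> t \<le> u \<Longrightarrow> u \<le> b \<Longrightarrow> D s u = D s t + D t u"
    and G: "\<And>s t u. a \<le> s \<Longrightarrow> s \<le> t \<Longrightarrow> t \<le> u \<Longrightarrow> u \<le> b \<Longrightarrow> G s u = G s t + G t u"
    and small: "\<And>e. 0 < e \<Longrightarrow> \<exists>d>0. \<forall>s t. a \<le> s \<longrightarrow> s \<le> t \<longrightarrow> t \<le> b \<longrightarrow> t - s < d \<longrightarrow> norm (D s t) \<le> e * G s t"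
  shows "D a b = 0"
proof (rule ccontr)
  assume nz: "D a b \<noteq> 0"
  \<comment> \<open>A positive majorant of G a b: with the next choice of \<open>e\<close>, summing
    the small bounds gives at most half of the norm of D a b, which is absurd.\<close>
  define A where "A = \<bar>G a b\<bar> + 1"
  define e where "e = norm (D a b) / (2 * A)"
  have A: "0 < A" unfolding A_def by linarith
  then have e: "0 < e" using nz by (simp add: e_def)
  obtain d where d: "0 < d" "\<And>s t. a \<le> s \<Longrightarrow> s \<le> t \<Longrightarrow> t \<le> b \<Longrightarrow> t - s < d \<Longrightarrow> norm (D s t) \<le> e * G s t"
    using small[OF e] by blast
  obtain n :: nat where n: "(b - a) / d < real n" using reals_Archimedean2 by blast
  have "0 \<le> (b - a) / d" using ab d by simp
  then have n0: "0 < real n" using n by linarith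
  define \<eta> where "\<eta> = (b - a) / real n"
  have \<eta>: "0 \<le> \<eta>" "\<eta> < d" using n n0 d ab by (auto simp: \<eta>_def field_simps)
  define x where "x i = a + real i * \<eta>" for i
  have xn: "x n = b" using n0 by (simp add: x_def \<eta>_def)
  have xm: "x i \<le> x j" if "i \<le> j" for i j using that \<eta> by (simp add: x_def mult_right_mono)
  have "norm (D a (x i)) \<le> e * G a (x i)" if "i \<le> n" for i
    using that
  proof (induction i)
    case 0
    have "D a a = 0" "G a a = 0" using D[of a a a] G[of a a a] ab by simp_all
    then show ?case by (simp add: x_def)
  next
    case (Suc i)
    have o: "a \<le> x i" "x i \<le> x (Suc i)" "x (Suc i) \<le> b"
      using xm[of 0 i] xm[of i "Suc i"] xm[of "Suc i" n] Suc.prems xn by (auto simp: x_def)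
    have "x (Suc i) - x i < d" using \<eta> by (simp add: x_def algebra_simps)
    then have "norm (D (x i) (x (Suc i))) \<le> e * G (x i) (x (Suc i))"
      using d(2) o by blast
    moreover have "norm (D a (x i)) \<le> e * G a (x i)" using Suc by simp
    ultimately show ?case
      using D[of a "x i" "x (Suc i)"] G[of a "x i" "x (Suc i)"] o
        norm_triangle_ineq[of "D a (x i)" "D (x i) (x (Suc i))"] by (simp add: algebra_simps)
  qed
  from this[of n] have "norm (D a b) \<le> e * G a b" by (simp add: xn)
  also have "\<dots> \<le> e * A" using e by (intro mult_left_mono) (auto simp: A_def)
  also have "\<dots> = norm (D a b) / 2" using A by (simp add: e_def)
  finally show False using nz by simp
qed

text \<open>An exact difference formula, linear in the increment y - x once its coefficients are
  frozen. It rests on 1/X - 1/Y = (Y^2 - X^2) / (X * Y * (X + Y)); as y tends to x the coefficients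
  become those of the differential of \<open>sgn\<close>.\<close>

lemma sgn_diff_eq:
  fixes x y :: "'a::real_inner"
  assumes "x \<noteq> 0" "y \<noteq> 0"
  shows "sgn y - sgn x = (y - x) /\<^sub>R norm x -
    ((y - x) \<bullet> ((y + x) /\<^sub>R (norm x * norm y * (norm x + norm y)))) *\<^sub>R y"
proof -
  define X Y where "X = norm x" and "Y = norm y"
  have XY: "0 < X" "0 < Y" using assms by (auto simp: X_def Y_def)
  have "(y - x) \<bullet> (y + x) = Y\<^sup>2 - X\<^sup>2"
    by (simp add: X_def Y_def power2_norm_eq_inner inner_diff_left inner_add_right inner_commute[of x y])
  also have "\<dots> = (Y - X) * (X + Y)" by (simp add: power2_eq_square algebra_simps)
  finally have eq: "(y - x) \<bullet> (y + x) = (Y - X) * (X + Y)" .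
  have "(y - x) \<bullet> ((y + x) /\<^sub>R (X * Y * (X + Y))) = ((y - x) \<bullet> (y + x)) / (X * Y * (X + Y))"
    by (simp only: inner_scaleR_right divide_inverse mult.commute)
  also have "\<dots> = (Y - X) / (X * Y)"
    unfolding eq using XY by simp
  also have "\<dots> = 1 / X - 1 / Y" using XY by (simp add: field_simps)
  finally have "(y - x) \<bullet> ((y + x) /\<^sub>R (X * Y * (X + Y))) = 1 / X - 1 / Y" .
  then show ?thesis
    unfolding sgn_div_norm X_def[symmetric] Y_def[symmetric]
    by (simp add: scaleR_diff_left scaleR_diff_right divide_inverse)
qed

lemma absolutely_integrable_bounded_by:
  fixes f :: "real \<Rightarrow> 'a::euclidean_space" and g :: "real \<Rightarrow> real"
  assumes "f \<in> borel_measurable (lebesgue_on {a..b})" "g integrable_on {a..b}"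
    "\<And>x. x \<in> {a..b} \<Longrightarrow> norm (f x) \<le> g x"
  shows "f absolutely_integrable_on {a..b}"
  by (rule measurable_bounded_by_integrable_imp_absolutely_integrable[OF assms(1) _ assms(2,3)]) auto

lemma continuous_imp_measurable_lebesgue_on:
  fixes f :: "real \<Rightarrow> 'a::euclidean_space"
  shows "continuous_on {a..b} f \<Longrightarrow> f \<in> borel_measurable (lebesgue_on {a..b})"
  by (rule continuous_imp_measurable_on_sets_lebesgue) auto

text \<open>The vector is the differential of \<open>sgn\<close> at \<open>f\<close> applied to
  \<open>g\<close>. For f = 0 both sides vanish by the convention for division by zero.\<close>

lemma norm_sgn_derivative_le:
  fixes f g :: "'a::real_inner"
  shows "norm (g /\<^sub>R norm f - ((f \<bullet> g) / norm f ^ 3) *\<^sub>R f) \<le> 2 * (norm g / norm f)"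
proof -
  have "\<bar>f \<bullet> g\<bar> / norm f ^ 3 * norm f \<le> norm f * norm g / norm f ^ 3 * norm f"
    by (intro mult_right_mono divide_right_mono Cauchy_Schwarz_ineq2) auto
  also have "\<dots> = norm g / norm f" by (simp add: power3_eq_cube)
  finally show ?thesis
    using norm_triangle_ineq4[of "g /\<^sub>R norm f" "((f \<bullet> g) / norm f ^ 3) *\<^sub>R f"]
    by (simp add: divide_inverse mult.commute abs_mult)
qed

text \<open>By \<open>sgn_diff_eq\<close> the increment over {s..t} is the integral of L (g r), with
  \<open>L\<close> linear and its coefficients frozen at (s, t). The function \<open>h\<close> has
  the same form with coefficients at (r, r). Uniform continuity of the coefficients bounds the
  defect by a small multiple of the integral of norm (g r), so additivity makes it vanish.\<close>

lemma sgn_indefinite_integral: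
  fixes f g :: "real \<Rightarrow> 'a::euclidean_space"
  assumes ab: "a \<le> b" and g: "g absolutely_integrable_on {a..b}"
    and f: "\<And>s t. a \<le> s \<Longrightarrow> s \<le> t \<Longrightarrow> t \<le> b \<Longrightarrow> f t - f s = integral {s..t} g"
    and cont: "continuous_on {a..b} f" and nz: "\<And>t. t \<in> {a..b} \<Longrightarrow> f t \<noteq> 0"
  defines "h \<equiv> \<lambda>t. g t /\<^sub>R norm (f t) - ((f t \<bullet> g t) / norm (f t) ^ 3) *\<^sub>R f t"
  shows "h absolutely_integrable_on {a..b}"
    and "\<And>s t. a \<le> s \<Longrightarrow> s \<le> t \<Longrightarrow> t \<le> b \<Longrightarrow> sgn (f t) - sgn (f s) = integral {s..t} h"
proof -
  define w where "w = (\<lambda>t. inverse (norm (f t)))"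
  define B where "B = (\<lambda>p. (f (snd p) + f (fst p)) /\<^sub>R
     (norm (f (fst p)) * norm (f (snd p)) * (norm (f (fst p)) + norm (f (snd p)))))"
  let ?Q = "{a..b} \<times> {a..b}"
  have cw: "continuous_on {a..b} w"
    unfolding w_def using nz by (intro continuous_intros cont) auto
  have cont1: "continuous_on ?Q (\<lambda>p. f (fst p))" "continuous_on ?Q (\<lambda>p. f (snd p))"
    by (auto intro!: continuous_on_compose2[OF cont] continuous_intros)
  have cB: "continuous_on ?Q B"
    unfolding B_def using nz
    by (intro continuous_intros cont1) (auto simp: add_nonneg_eq_0_iff)
  have Brr: "B (r, r) = f r /\<^sub>R norm (f r) ^ 3" if "r \<in> {a..b}" for r
    using nz[OF that] by (simp add: B_def power3_eq_cube mult_2[symmetric] scaleR_2[symmetric])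
  have hB: "h r = w r *\<^sub>R g r - (g r \<bullet> B (r, r)) *\<^sub>R f r" if "r \<in> {a..b}" for r
    using that by (simp add: h_def w_def Brr inner_commute divide_inverse mult.commute)
  obtain F where F: "\<And>t. t \<in> {a..b} \<Longrightarrow> norm (f t) \<le> F"
    using compact_imp_bounded[OF compact_continuous_image[OF cont compact_Icc]]
    unfolding bounded_iff by blast
  obtain Bm where Bm: "\<And>p. p \<in> ?Q \<Longrightarrow> norm (B p) \<le> Bm"
    using compact_imp_bounded[OF compact_continuous_image[OF cB]] by (auto simp: bounded_iff compact_Times)
  obtain W where W: "\<And>t. t \<in> {a..b} \<Longrightarrow> norm (w t) \<le> W"
    using compact_imp_bounded[OF compact_continuous_image[OF cw compact_Icc]]
    unfolding bounded_iff by blast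
  have FB: "0 \<le> F" "0 \<le> Bm"
    using order_trans[OF norm_ge_zero F[of a]] order_trans[OF norm_ge_zero Bm[of "(a, a)"]] ab by auto
  have gm: "g \<in> borel_measurable (lebesgue_on {a..b})"
    by (rule absolutely_integrable_imp_borel_measurable[OF g]) auto
  have fm: "f \<in> borel_measurable (lebesgue_on {a..b})"
    by (rule continuous_imp_measurable_lebesgue_on[OF cont])
  have gn: "(\<lambda>t. norm (g t)) integrable_on {a..b}"
    using g by (simp add: absolutely_integrable_on_def)
  show habs: "h absolutely_integrable_on {a..b}"
  proof (rule absolutely_integrable_bounded_by)
    show "h \<in> borel_measurable (lebesgue_on {a..b})"
      unfolding h_def using fm gm by measurable
    show "(\<lambda>t. 2 * W * norm (g t)) integrable_on {a..b}"
      using gn by (rule integrable_on_mult_right)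
    fix t assume t: "t \<in> {a..b}"
    have "norm (h t) \<le> 2 * (norm (g t) / norm (f t))"
      unfolding h_def by (rule norm_sgn_derivative_le)
    also have "\<dots> = 2 * w t * norm (g t)" by (simp add: w_def divide_inverse)
    also have "\<dots> \<le> 2 * W * norm (g t)"
      using W[OF t] by (intro mult_right_mono) auto
    finally show "norm (h t) \<le> 2 * W * norm (g t)" .
  qed
  fix s0 t0 assume st0: "a \<le> s0" "s0 \<le> t0" "t0 \<le> b"
  have hi: "h integrable_on {s..t}" "g integrable_on {s..t}" "(\<lambda>t. norm (g t)) integrable_on {s..t}"
    if "a \<le> s" "t \<le> b" for s t
    using habs g gn that
    by (auto simp: absolutely_integrable_on_def intro: integrable_on_subinterval)
  define D where "D s t = sgn (f t) - sgn (f s) - integral {s..t} h" for s t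
  define G where "G s t = integral {s..t} (\<lambda>t. norm (g t))" for s t
  have "D s0 t0 = 0"
  proof (rule additive_interval_function_eq_0[where G=G])
    show "s0 \<le> t0" by fact
    fix s t u assume "s0 \<le> s" "s \<le> t" "t \<le> u" "u \<le> t0"
    then have "integral {s..u} h = integral {s..t} h + integral {t..u} h"
      "integral {s..u} (\<lambda>t. norm (g t)) = integral {s..t} (\<lambda>t. norm (g t)) + integral {t..u} (\<lambda>t. norm (g t))"
      using st0 by (intro Henstock_Kurzweil_Integration.integral_combine[symmetric] hi; simp)+
    then show "D s u = D s t + D t u" "G s u = G s t + G t u"
      by (simp_all add: D_def G_def)
  next
    fix e :: real assume e: "0 < e"
    \<comment> \<open>Three coefficients vary; their errors carry the factors 1, \<open>F\<close>
      and \<open>Bm\<close>.\<close>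
    define e' where "e' = e / (1 + F + Bm)"
    have e': "0 < e'" using e FB by (simp add: e'_def)
    obtain d1 where d1: "0 < d1" "\<And>s t. s \<in> {a..b} \<Longrightarrow> t \<in> {a..b} \<Longrightarrow> dist s t < d1 \<Longrightarrow> dist (w s) (w t) < e'"
      using compact_uniformly_continuous[OF cw compact_Icc, unfolded uniformly_continuous_on_def,
          rule_format, OF e'] by blast
    obtain d2 where d2: "0 < d2" "\<And>s t. s \<in> {a..b} \<Longrightarrow> t \<in> {a..b} \<Longrightarrow> dist s t < d2 \<Longrightarrow> dist (f s) (f t) < e'"
      using compact_uniformly_continuous[OF cont compact_Icc, unfolded uniformly_continuous_on_def,
          rule_format, OF e'] by blast
    obtain d3 where d3: "0 < d3" "\<And>s t. s \<in> ?Q \<Longrightarrow> t \<in> ?Q \<Longrightarrow> dist s t < d3 \<Longrightarrow> dist (B s) (B t) < e'"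
      using compact_uniformly_continuous[OF cB compact_Times[OF compact_Icc compact_Icc],
          unfolded uniformly_continuous_on_def, rule_format, OF e'] by blast
    \<comment> \<open>Half of d3, because the distance of (s, t) to (r, r) is bounded by the sum of
      two coordinate distances.\<close>
    define d where "d = min d1 (min d2 (d3 / 2))"
    have d: "0 < d" using d1 d2 d3 by (simp add: d_def)
    show "\<exists>d>0. \<forall>s t. s0 \<le> s \<longrightarrow> s \<le> t \<longrightarrow> t \<le> t0 \<longrightarrow> t - s < d \<longrightarrow> norm (D s t) \<le> e * G s t"
    proof (intro exI[of _ d] conjI allI impI d)
      fix s t assume st: "s0 \<le> s" "s \<le> t" "t \<le> t0" "t - s < d"
      then have st': "a \<le> s" "s \<le> t" "t \<le> b" using st0 by auto
      then have in_ab: "s \<in> {a..b}" "t \<in> {a..b}" by auto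
      define L where "L k = w s *\<^sub>R k - (k \<bullet> B (s, t)) *\<^sub>R f t" for k
      have bl: "bounded_linear L"
        unfolding L_def
        by (intro bounded_linear_sub bounded_linear_scaleR_right
            bounded_linear_scaleR_const bounded_linear_inner_left)
      have "sgn (f t) - sgn (f s) = L (f t - f s)"
        using nz in_ab by (simp add: sgn_diff_eq L_def w_def B_def)
      also have "\<dots> = integral {s..t} (\<lambda>r. L (g r))"
        using integral_linear[OF hi(2)[OF st'(1,3)] bl] by (simp add: f[OF st'] o_def)
      finally have "D s t = integral {s..t} (\<lambda>r. L (g r) - h r)"
        using integrable_linear[OF hi(2)[OF st'(1,3)] bl] hi(1)[OF st'(1,3)]
        by (simp add: D_def integral_diff o_def)
      moreover have "norm (L (g r) - h r) \<le> e * norm (g r)" if r: "r \<in> {s..t}" for r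
      proof -
        have rab: "r \<in> {a..b}" using r st' by auto
        have dr: "dist s r < d1" "dist t r < d2"
          using r st by (auto simp: dist_real_def d_def)
        have "dist (s, t) (r, r) \<le> dist s r + dist t r"
          using sqrt_sum_squares_le_sum[of "dist s r" "dist t r"] by (simp add: dist_Pair_Pair)
        then have "dist (s, t) (r, r) < d3"
          using r st by (auto simp: dist_real_def d_def)
        then have dB: "norm (B (s, t) - B (r, r)) \<le> e'"
          using d3(2)[of "(s, t)" "(r, r)"] rab in_ab by (simp add: dist_norm)
        have dw: "\<bar>w s - w r\<bar> \<le> e'"
          using d1(2)[OF in_ab(1) rab] dr by (simp add: dist_real_def)
        have df: "norm (f t - f r) \<le> e'"
          using d2(2)[OF in_ab(2) rab] dr by (simp add: dist_norm)
        \<comment> \<open>The coefficients \<open>w\<close>, \<open>B\<close> and \<open>f\<close>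
          are replaced one after another.\<close>
        have "L (g r) - h r = (w s - w r) *\<^sub>R g r - (g r \<bullet> (B (s, t) - B (r, r))) *\<^sub>R f t
            - (g r \<bullet> B (r, r)) *\<^sub>R (f t - f r)"
          by (simp add: L_def hB[OF rab] scaleR_diff_left scaleR_diff_right inner_diff_right)
        then have "norm (L (g r) - h r) \<le> norm ((w s - w r) *\<^sub>R g r)
            + norm ((g r \<bullet> (B (s, t) - B (r, r))) *\<^sub>R f t) + norm ((g r \<bullet> B (r, r)) *\<^sub>R (f t - f r))"
          by (simp only: norm_triangle_le_diff[OF add_right_mono[OF norm_triangle_ineq4]])
        also have "\<dots> \<le> e' * norm (g r) + (norm (g r) * e') * F + (norm (g r) * Bm) * e'"
        proof (intro add_mono)
          show "norm ((w s - w r) *\<^sub>R g r) \<le> e' * norm (g r)"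
            using dw by (simp add: mult_right_mono)
          have "\<bar>g r \<bullet> (B (s, t) - B (r, r))\<bar> \<le> norm (g r) * e'"
            using Cauchy_Schwarz_ineq2[of "g r" "B (s, t) - B (r, r)"] mult_left_mono[OF dB norm_ge_zero[of "g r"]]
            by linarith
          then show "norm ((g r \<bullet> (B (s, t) - B (r, r))) *\<^sub>R f t) \<le> (norm (g r) * e') * F"
            using F[OF in_ab(2)] e' by (simp add: mult_mono)
          have "\<bar>g r \<bullet> B (r, r)\<bar> \<le> norm (g r) * Bm"
            using Cauchy_Schwarz_ineq2[of "g r" "B (r, r)"] mult_left_mono[OF Bm[of "(r, r)"] norm_ge_zero[of "g r"]] rab
            by auto
          then show "norm ((g r \<bullet> B (r, r)) *\<^sub>R (f t - f r)) \<le> (norm (g r) * Bm) * e'"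
            using df FB by (simp add: mult_mono)
        qed
        also have "\<dots> = (e' * (1 + F + Bm)) * norm (g r)" by (simp add: algebra_simps)
        also have "e' * (1 + F + Bm) = e" using FB by (simp add: e'_def)
        finally show ?thesis .
      qed
      ultimately show "norm (D s t) \<le> e * G s t"
        using integral_norm_bound_integral[of "\<lambda>r. L (g r) - h r" "{s..t}" "\<lambda>r. e * norm (g r)"]
          integrable_linear[OF hi(2)[OF st'(1,3)] bl] hi(1,3)[OF st'(1,3)]
        by (simp add: G_def o_def integrable_diff integrable_on_mult_right)
    qed
  qed
  then show "sgn (f t0) - sgn (f s0) = integral {s0..t0} h"
    by (simp add: D_def)
qed

lemma has_real_derivative_antiderivative:
  fixes v :: "real \<Rightarrow> real"
  assumes "continuous_on UNIV v"
  obtains S where "\<And>t. (S has_real_derivative v t) (at t)" "S 0 = 0"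
proof -
  obtain F where F: "\<And>x. (F has_vector_derivative v x) (at x)"
    using einterval_antiderivative[of "-\<infinity>" "\<infinity>" v] assms
    by (auto simp: continuous_on_eq_continuous_at)
  have "((\<lambda>x. F x - F 0) has_real_derivative v x) (at x)" for x
    using F[of x] unfolding has_real_derivative_iff_has_vector_derivative
    by (simp add: has_vector_derivative_diff_const)
  then show ?thesis by (intro that[of "\<lambda>x. F x - F 0"]) auto
qed

section \<open>The dihedral symmetry and the speed of the curve\<close>

lemma R_linear:
  "bounded_linear R1" "bounded_linear R2" "bounded_linear R3"
  by (simp_all add: linear_conv_bounded_linear[symmetric] linear_iff R1_def R2_def R3_def vec_eq_iff forall_3)

lemma norm_R: "norm (R1 x) = norm x" "norm (R2 x) = norm x" "norm (R3 x) = norm x"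
  by (simp_all add: norm_eq_sqrt_inner inner_vec_def sum_3 R1_def R2_def R3_def)

text \<open>Because the R_i are linear isometries, the speed shares the symmetry of the curve. This
  is what makes arclength compatible with the parameter maps \<psi>_i.\<close>

lemma D2_symmetric_speed:
  assumes W: "W22_closed \<gamma>" and sym: "D2_symmetric \<gamma>"
  shows "norm (dcurve \<gamma> (- t)) = norm (dcurve \<gamma> t)" "norm (dcurve \<gamma> (t - 1/2)) = norm (dcurve \<gamma> t)"
proof -
  have "((\<lambda>x. \<gamma> (- x)) has_vector_derivative (- 1) *\<^sub>R dcurve \<gamma> (- t)) (at t)"
    using vector_diff_chain_at[of uminus "-1" t \<gamma> "dcurve \<gamma> (- t)"] W22_closed_has_vector_derivative[OF W, of "- t"]
    by (simp add: o_def has_vector_derivative_minus[OF has_vector_derivative_id, simplified])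
  then have "((\<lambda>x. R3 (\<gamma> (- x))) has_vector_derivative R3 ((- 1) *\<^sub>R dcurve \<gamma> (- t))) (at t)"
    by (rule bounded_linear.has_vector_derivative[OF R_linear(3)])
  moreover have "(\<lambda>x. R3 (\<gamma> (- x))) = \<gamma>" using sym by (auto simp: D2_symmetric_def)
  ultimately have "dcurve \<gamma> t = R3 ((- 1) *\<^sub>R dcurve \<gamma> (- t))"
    by (simp add: vector_derivative_at)
  then show "norm (dcurve \<gamma> (- t)) = norm (dcurve \<gamma> t)" by (simp add: norm_R)
  have "((\<lambda>x. \<gamma> (x + - (1/2))) has_vector_derivative dcurve \<gamma> (t + - (1/2))) (at t)"
    by (intro has_vector_derivative_shift W22_closed_has_vector_derivative W)
  then have "((\<lambda>x. R2 (\<gamma> (x - 1/2))) has_vector_derivative R2 (dcurve \<gamma> (t - 1/2))) (at t)"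
    using bounded_linear.has_vector_derivative[OF R_linear(2)] by fastforce
  moreover have "(\<lambda>x. R2 (\<gamma> (x - 1/2))) = \<gamma>" using sym by (auto simp: D2_symmetric_def)
  ultimately have "dcurve \<gamma> t = R2 (dcurve \<gamma> (t - 1/2))"
    by (simp add: vector_derivative_at)
  then show "norm (dcurve \<gamma> (t - 1/2)) = norm (dcurve \<gamma> t)" by (simp add: norm_R)
qed

lemma DERIV_zero_imp_eq:
  fixes f :: "real \<Rightarrow> real"
  assumes "\<And>t. (f has_real_derivative 0) (at t)"
  shows "f x = f y"
  using DERIV_isconst_all[of f x y] assms by blast

lemma regular_curve_speed_ge:
  assumes "W22_closed \<gamma>" "regular_curve \<gamma>"
  obtains m where "0 < m" "\<And>t. t \<in> {0..1} \<Longrightarrow> m \<le> norm (dcurve \<gamma> t)"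
proof -
  have "continuous_on {0..1} (\<lambda>t. norm (dcurve \<gamma> t))"
    using W22_closed_continuous_dcurve[OF assms(1)]
    by (intro continuous_on_norm) (auto intro: continuous_on_subset)
  then obtain t0 where "\<And>t. t \<in> {0..1} \<Longrightarrow> norm (dcurve \<gamma> t0) \<le> norm (dcurve \<gamma> t)"
    using continuous_attains_inf[OF compact_Icc, of 0 1 "\<lambda>t. norm (dcurve \<gamma> t)"] by fastforce
  then show ?thesis using that[of "norm (dcurve \<gamma> t0)"] assms(2) by (auto simp: regular_curve_def)
qed

text \<open>\<open>s\<close> is arclength divided by \<open>L\<close> and \<sigma> its inverse. Both
  live on the whole line and commute with translation by 1, so they describe a change of parameter
  on the circle; \<open>s_per\<close> is what forces \<open>L\<close> to be the length.\<close>

locale arclength_change =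
  fixes \<gamma> :: curve and s \<sigma> :: "real \<Rightarrow> real" and L :: real
  assumes W: "W22_closed \<gamma>" and reg: "regular_curve \<gamma>" and L: "0 < L"
    and s_der: "\<And>t. (s has_real_derivative norm (dcurve \<gamma> t) / L) (at t)"
    and s0: "s 0 = 0" and s_per: "\<And>t. s (t + 1) = s t + 1"
    and s_\<sigma>: "\<And>u. s (\<sigma> u) = u" and \<sigma>_s: "\<And>t. \<sigma> (s t) = t"
begin

abbreviation v where "v t \<equiv> norm (dcurve \<gamma> t)"

lemma v_pos: "0 < v t"
  using reg by (simp add: regular_curve_def)

lemma s_less: "x < y \<Longrightarrow> s x < s y"
  by (rule DERIV_pos_imp_increasing[of x y s]) (use s_der v_pos L in \<open>auto intro!: exI divide_pos_pos\<close>)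

lemma \<sigma>_less: "x < y \<Longrightarrow> \<sigma> x < \<sigma> y"
  by (metis s_\<sigma> s_less linorder_neqE_linordered_idom order_less_asym)

lemma \<sigma>_le: "x \<le> y \<Longrightarrow> \<sigma> x \<le> \<sigma> y"
  by (metis \<sigma>_less order_le_less)

lemma \<sigma>_cong: "s t = u \<Longrightarrow> \<sigma> u = t"
  using \<sigma>_s by auto

lemma \<sigma>_0: "\<sigma> 0 = 0" and \<sigma>_1: "\<sigma> 1 = 1"
  using s0 s_per[of 0] by (auto intro!: \<sigma>_cong)

lemma \<sigma>_per: "\<sigma> (u + 1) = \<sigma> u + 1"
  by (rule \<sigma>_cong) (simp add: s_per s_\<sigma>)

lemma \<sigma>_int: "\<sigma> (u + of_int k) = \<sigma> u + of_int k"
proof -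
  \<comment> \<open>\<open>vec\<close> merely turns the real 1-periodic function \<sigma> u - u into
    a curve, so that \<open>periodic1_int\<close> applies.\<close>
  have "periodic1 (\<lambda>u. vec (\<sigma> u - u))" by (simp add: periodic1_def \<sigma>_per)
  from periodic1_int[OF this, of u k] show ?thesis by (simp add: vec_eq_iff)
qed

lemma \<sigma>_cont: "isCont \<sigma> u"
  using isCont_inverse_function[of 1 "\<sigma> u" \<sigma> s] DERIV_isCont[OF s_der] by (simp add: \<sigma>_s s_\<sigma>)

lemma \<sigma>_der: "(\<sigma> has_real_derivative L / v (\<sigma> u)) (at u)"
proof -
  have "(\<sigma> has_real_derivative inverse (v (\<sigma> u) / L)) (at u)"
    by (rule DERIV_inverse_function[OF s_der, where a="u - 1" and b="u + 1"])
       (use L v_pos[of "\<sigma> u"] \<sigma>_cont in \<open>auto simp: s_\<sigma>\<close>)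
  then show ?thesis by simp
qed

lemma \<sigma>_image: "\<sigma> ` {a..b} = {\<sigma> a..\<sigma> b}" if "a \<le> b"
proof
  show "\<sigma> ` {a..b} \<subseteq> {\<sigma> a..\<sigma> b}" by (auto simp: \<sigma>_le)
  show "{\<sigma> a..\<sigma> b} \<subseteq> \<sigma> ` {a..b}"
  proof
    fix x assume x: "x \<in> {\<sigma> a..\<sigma> b}"
    have "a \<le> s x" "s x \<le> b"
      using x \<sigma>_less[of "s x" a] \<sigma>_less[of b "s x"] by (force simp: \<sigma>_s)+
    then show "x \<in> \<sigma> ` {a..b}" by (intro image_eqI[of _ _ "s x"]) (auto simp: \<sigma>_s)
  qed
qed

lemma \<sigma>_inj: "inj \<sigma>"
  by (metis injI s_\<sigma>)

definition \<Gamma> :: curve where "\<Gamma> u = (1 / L) *\<^sub>R \<gamma> (\<sigma> u)"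

lemma \<Gamma>_der: "(\<Gamma> has_vector_derivative sgn (dcurve \<gamma> (\<sigma> u))) (at u)"
proof -
  have "((\<gamma> \<circ> \<sigma>) has_vector_derivative (L / v (\<sigma> u)) *\<^sub>R dcurve \<gamma> (\<sigma> u)) (at u)"
    by (rule vector_diff_chain_at)
       (use \<sigma>_der W22_closed_has_vector_derivative[OF W] in
         \<open>auto simp: has_real_derivative_iff_has_vector_derivative\<close>)
  then have "((\<lambda>u. (1 / L) *\<^sub>R \<gamma> (\<sigma> u)) has_vector_derivative
      (1 / L) *\<^sub>R ((L / v (\<sigma> u)) *\<^sub>R dcurve \<gamma> (\<sigma> u))) (at u)"
    unfolding o_def by (rule bounded_linear.has_vector_derivative[OF bounded_linear_scaleR_right])
  moreover have "\<Gamma> = (\<lambda>u. (1 / L) *\<^sub>R \<gamma> (\<sigma> u))" by (simp add: fun_eq_iff \<Gamma>_def)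
  moreover have "(1 / L) *\<^sub>R ((L / v (\<sigma> u)) *\<^sub>R dcurve \<gamma> (\<sigma> u)) = sgn (dcurve \<gamma> (\<sigma> u))"
    using L by (simp add: sgn_div_norm inverse_eq_divide)
  ultimately show ?thesis by simp
qed

lemma dcurve_\<Gamma>: "dcurve \<Gamma> u = sgn (dcurve \<gamma> (\<sigma> u))"
  by (rule vector_derivative_at[OF \<Gamma>_der])

lemma norm_dcurve_\<Gamma>: "norm (dcurve \<Gamma> u) = 1"
  using v_pos[of "\<sigma> u"] by (simp add: dcurve_\<Gamma> norm_sgn)

lemma curve_length_\<Gamma>: "curve_length \<Gamma> = 1"
  by (simp add: curve_length_def norm_dcurve_\<Gamma>)

lemma periodic1_\<Gamma>: "periodic1 \<Gamma>"
  using W by (simp add: periodic1_def \<Gamma>_def \<sigma>_per W22_closed_def)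

text \<open>The weak derivative, in the original parameter, of the unit tangent: the differential of
  \<open>sgn\<close> at the velocity, applied to \<open>g\<close>.\<close>

definition tangent_deriv :: "(real \<Rightarrow> real^3) \<Rightarrow> real \<Rightarrow> real^3" where
  "tangent_deriv g t = g t /\<^sub>R v t - ((dcurve \<gamma> t \<bullet> g t) / v t ^ 3) *\<^sub>R dcurve \<gamma> t"

text \<open>The chain-rule candidate for the second derivative of \<Gamma>; the scalar factor is the
  derivative of \<sigma>.\<close>

definition \<Gamma>2 :: "(real \<Rightarrow> real^3) \<Rightarrow> real \<Rightarrow> real^3" where
  "\<Gamma>2 g u = (L / v (\<sigma> u)) *\<^sub>R tangent_deriv g (\<sigma> u)"

lemma change_of_variables:
  fixes f :: "real \<Rightarrow> 'a::euclidean_space"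
  assumes f: "f absolutely_integrable_on {0..1}" and ab: "0 \<le> a" "a \<le> b" "b \<le> 1"
  shows "(\<lambda>u. (L / v (\<sigma> u)) *\<^sub>R f (\<sigma> u)) absolutely_integrable_on {a..b}"
    "integral {a..b} (\<lambda>u. (L / v (\<sigma> u)) *\<^sub>R f (\<sigma> u)) = integral {\<sigma> a..\<sigma> b} f"
proof -
  have sub: "{\<sigma> a..\<sigma> b} \<subseteq> {0..1}"
    using \<sigma>_le[of 0 a] \<sigma>_le[of b 1] ab by (auto simp: \<sigma>_0 \<sigma>_1)
  have f': "f absolutely_integrable_on \<sigma> ` {a..b}"
    unfolding \<sigma>_image[OF ab(2)] by (rule absolutely_integrable_on_subinterval[OF f sub])
  have "(\<lambda>u. \<bar>L / v (\<sigma> u)\<bar> *\<^sub>R f (\<sigma> u)) absolutely_integrable_on {a..b} \<and>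
      integral {a..b} (\<lambda>u. \<bar>L / v (\<sigma> u)\<bar> *\<^sub>R f (\<sigma> u)) = integral {\<sigma> a..\<sigma> b} f"
    by (subst has_absolute_integral_change_of_variables_real)
       (use f' in \<open>auto intro: has_field_derivative_at_within \<sigma>_der inj_on_subset[OF \<sigma>_inj] simp: \<sigma>_image[OF ab(2)]\<close>)
  moreover have "\<bar>L / v (\<sigma> u)\<bar> = L / v (\<sigma> u)" for u using L by (intro abs_of_nonneg) simp
  ultimately show "(\<lambda>u. (L / v (\<sigma> u)) *\<^sub>R f (\<sigma> u)) absolutely_integrable_on {a..b}"
    "integral {a..b} (\<lambda>u. (L / v (\<sigma> u)) *\<^sub>R f (\<sigma> u)) = integral {\<sigma> a..\<sigma> b} f" by (simp_all only:)
qed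

lemma dcurve_cont: "continuous_on S (\<lambda>t. dcurve \<gamma> t)"
  using W22_closed_continuous_dcurve[OF W] by (rule continuous_on_subset) simp

lemma weak_second_deriv_\<Gamma>:
  assumes g: "weak_second_deriv \<gamma> g"
  shows "weak_second_deriv \<Gamma> (\<Gamma>2 g)"
proof -
  note g2 = W22_closed_weak_second_deriv[OF g]
  have nz: "dcurve \<gamma> t \<noteq> 0" for t using reg by (simp add: regular_curve_def)
  have tabs: "tangent_deriv g absolutely_integrable_on {0..1}"
    unfolding tangent_deriv_def[abs_def]
    by (rule sgn_indefinite_integral(1)) (use g2 nz dcurve_cont square_integrable_on_D(1) in auto)
  have T: "sgn (dcurve \<gamma> t) - sgn (dcurve \<gamma> s) = integral {s..t} (tangent_deriv g)"
    if "0 \<le> s" "s \<le> t" "t \<le> 1" for s t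
    unfolding tangent_deriv_def[abs_def]
    by (rule sgn_indefinite_integral(2)[OF zero_le_one])
       (use that g2 nz dcurve_cont square_integrable_on_D(1) in auto)
  obtain m where m: "0 < m" "\<And>t. t \<in> {0..1} \<Longrightarrow> m \<le> v t" 
    using regular_curve_speed_ge[OF W reg] by blast
  have tm: "tangent_deriv g \<in> borel_measurable (lebesgue_on {0..1})"
    by (rule absolutely_integrable_imp_borel_measurable[OF tabs]) auto
  have vm: "v \<in> borel_measurable (lebesgue_on {0..1})"
    by (intro continuous_imp_measurable_lebesgue_on continuous_on_norm dcurve_cont)
  \<comment> \<open>Only one of the two factors L / v in the squared norm of
    \<open>\<Gamma>2 g\<close> appears: the other is the Jacobian supplied by
    \<open>change_of_variables\<close>.\<close>
  have sq: "(\<lambda>t. (L / v t) * (norm (tangent_deriv g t))\<^sup>2) absolutely_integrable_on {0..1}"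
  proof (rule absolutely_integrable_bounded_by)
    show "(\<lambda>t. (L / v t) * (norm (tangent_deriv g t))\<^sup>2) \<in> borel_measurable (lebesgue_on {0..1})"
      using tm vm by measurable
    show "(\<lambda>t. (L / m * (2 / m)\<^sup>2) * (norm (g t))\<^sup>2) integrable_on {0..1}"
      by (intro integrable_on_mult_right square_integrable_on_D g2)
    fix t :: real assume t: "t \<in> {0..1}"
    have "norm (tangent_deriv g t) \<le> 2 * (norm (g t) / v t)"
      unfolding tangent_deriv_def by (rule norm_sgn_derivative_le)
    also have "\<dots> \<le> 2 * (norm (g t) / m)"
      using m(1) m(2)[OF t] by (intro mult_left_mono divide_left_mono mult_pos_pos) (auto simp: v_pos)
    finally have "(norm (tangent_deriv g t))\<^sup>2 \<le> (2 / m * norm (g t))\<^sup>2"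
      by (intro power_mono) auto
    moreover have "L / v t \<le> L / m"
      using L m(1) m(2)[OF t] by (intro divide_left_mono mult_pos_pos) (auto simp: v_pos)
    ultimately have "(L / v t) * (norm (tangent_deriv g t))\<^sup>2 \<le> (L / m) * (2 / m * norm (g t))\<^sup>2"
      using L m(1) by (intro mult_mono) auto
    moreover have "0 \<le> (L / v t) * (norm (tangent_deriv g t))\<^sup>2" using L by simp
    ultimately show "norm ((L / v t) * (norm (tangent_deriv g t))\<^sup>2) \<le> (L / m * (2 / m)\<^sup>2) * (norm (g t))\<^sup>2"
      unfolding power_mult_distrib[of "2 / m"] mult.assoc[symmetric] real_norm_def by linarith
  qed
  show ?thesis
    unfolding weak_second_deriv_def
  proof (intro conjI allI impI)
    show "\<Gamma>2 g absolutely_integrable_on {0..1}"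
      using change_of_variables(1)[OF tabs, of 0 1] by (simp add: \<Gamma>2_def[abs_def])
    have "(norm (\<Gamma>2 g u))\<^sup>2 = (L / v (\<sigma> u)) *\<^sub>R ((L / v (\<sigma> u)) * (norm (tangent_deriv g (\<sigma> u)))\<^sup>2)" for u
      by (simp add: \<Gamma>2_def power2_eq_square)
    then show "(\<lambda>u. (norm (\<Gamma>2 g u))\<^sup>2) integrable_on {0..1}"
      using change_of_variables(1)[OF sq, of 0 1] by (simp add: absolutely_integrable_on_def)
    fix a b :: real assume ab: "0 \<le> a" "a \<le> b" "b \<le> 1"
    have "dcurve \<Gamma> b - dcurve \<Gamma> a = integral {\<sigma> a..\<sigma> b} (tangent_deriv g)"
      unfolding dcurve_\<Gamma>
      using \<sigma>_le[of 0 a] \<sigma>_le[of b 1] ab by (intro T \<sigma>_le) (auto simp: \<sigma>_0 \<sigma>_1)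
    also have "\<dots> = integral {a..b} (\<Gamma>2 g)"
      using change_of_variables(2)[OF tabs ab] by (simp add: \<Gamma>2_def[abs_def])
    finally show "dcurve \<Gamma> b - dcurve \<Gamma> a = integral {a..b} (\<Gamma>2 g)" .
  qed
qed

lemma W22_closed_\<Gamma>: "W22_closed \<Gamma>"
  unfolding W22_closed_def
proof (intro conjI allI)
  show "\<Gamma> differentiable at t" for t
    using \<Gamma>_der by (rule differentiableI_vector)
  show "\<exists>g. weak_second_deriv \<Gamma> g"
    using W weak_second_deriv_\<Gamma> by (auto simp: W22_closed_def)
qed (rule periodic1_\<Gamma>)

lemma injective_closed_\<Gamma>:
  assumes "injective_closed \<gamma>"
  shows "injective_closed \<Gamma>"
  unfolding injective_closed_def
proof (intro allI impI)
  fix x y assume "\<Gamma> x = \<Gamma> y"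
  then have "\<gamma> (\<sigma> x) = \<gamma> (\<sigma> y)" using L by (simp add: \<Gamma>_def)
  then have "\<sigma> x - \<sigma> y \<in> \<int>" using assms by (simp add: injective_closed_def)
  then obtain k where "\<sigma> x = \<sigma> y + of_int k" by (auto elim!: Ints_cases simp: algebra_simps)
  then have "\<sigma> x = \<sigma> (y + of_int k)" by (simp add: \<sigma>_int)
  then have "x = y + of_int k" using \<sigma>_inj by (simp add: inj_eq)
  then show "x - y \<in> \<int>" by simp
qed

lemma \<Gamma>_image: "\<Gamma> ` {0..1} = (\<lambda>x. (1 / L) *\<^sub>R x) ` \<gamma> ` {0..1}"
proof -
  have "\<gamma> ` {0..1} = \<gamma> ` \<sigma> ` {0..1}" using \<sigma>_image[of 0 1] by (simp add: \<sigma>_0 \<sigma>_1)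
  then show ?thesis by (simp add: \<Gamma>_def image_image)
qed

end

section \<open>The two energies as integrals\<close>

lemma nn_integral_eq_HK_integral:
  fixes F :: "real \<Rightarrow> real"
  assumes F: "F absolutely_integrable_on {a..b}" and pos: "\<And>t. 0 \<le> F t"
  shows "(\<integral>\<^sup>+ t. indicator {a..b} t * ennreal (F t) \<partial>lborel) = ennreal (integral {a..b} F)"
proof -
  have i: "integrable (lebesgue_on {a..b}) F"
    using F by (simp only: absolutely_integrable_on_iff_lebesgue_on)
  \<comment> \<open>The integrand is only Lebesgue measurable, hence the passage from
    \<open>lborel\<close> to its completion.\<close>
  have "(\<integral>\<^sup>+ t. indicator {a..b} t * ennreal (F t) \<partial>lborel) = (\<integral>\<^sup>+ t. ennreal (F t) * indicator {a..b} t \<partial>lebesgue)"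
    by (simp add: nn_integral_completion mult.commute)
  also have "\<dots> = (\<integral>\<^sup>+ t. ennreal (F t) \<partial>lebesgue_on {a..b})"
    by (rule nn_integral_restrict_space[symmetric]) auto
  also have "\<dots> = ennreal (\<integral>t. F t \<partial>lebesgue_on {a..b})"
    using i pos by (intro nn_integral_eq_integral) auto
  also have "(\<integral>t. F t \<partial>lebesgue_on {a..b}) = integral {a..b} F"
    using i by (intro lebesgue_integral_eq_integral) auto
  finally show ?thesis .
qed

lemma continuous_on_cross3_pair: "continuous_on UNIV (\<lambda>p. cross3 (fst p) (snd p))"
  by (intro continuous_on_cross continuous_intros)

lemma borel_measurable_cross3:
  assumes "f \<in> borel_measurable M" "g \<in> borel_measurable M"
  shows "(\<lambda>x. cross3 (f x) (g x)) \<in> borel_measurable M"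
  by (rule borel_measurable_continuous_Pair[OF assms continuous_on_cross3_pair])

lemma weak_second_deriv_second_deriv:
  assumes "W22_closed \<gamma>"
  shows "weak_second_deriv \<gamma> (second_deriv \<gamma>)"
  using assms unfolding W22_closed_def second_deriv_def by (metis someI_ex)

text \<open>Any weak second derivative may stand in for the chosen one, since two of them agree
  almost everywhere. Integrability holds because the speed is bounded away from zero.\<close>

lemma bending_energy_eq:
  assumes W: "W22_closed \<gamma>" and reg: "regular_curve \<gamma>" and g: "weak_second_deriv \<gamma> g"
  defines "F \<equiv> \<lambda>t. (norm (cross3 (dcurve \<gamma> t) (g t)))\<^sup>2 / norm (dcurve \<gamma> t) ^ 5"
  shows "F absolutely_integrable_on {0..1}" "bending_energy \<gamma> = ennreal (integral {0..1} F)"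
proof -
  let ?v = "\<lambda>t. norm (dcurve \<gamma> t)"
  note g2 = W22_closed_weak_second_deriv[OF g]
  obtain m where m: "0 < m" "\<And>t. t \<in> {0..1} \<Longrightarrow> m \<le> ?v t"
    using regular_curve_speed_ge[OF W reg] by blast
  have cont: "continuous_on {0..1} (\<lambda>t. dcurve \<gamma> t)"
    using W22_closed_continuous_dcurve[OF W] by (rule continuous_on_subset) simp
  show F: "F absolutely_integrable_on {0..1}"
  proof (rule absolutely_integrable_bounded_by)
    show "F \<in> borel_measurable (lebesgue_on {0..1})"
      unfolding F_def
      by (intro borel_measurable_divide borel_measurable_power measurable_compose[OF _ borel_measurable_norm]
          borel_measurable_cross3 continuous_imp_measurable_lebesgue_on cont square_integrable_on_D(4)[OF g2(1)])
    show "(\<lambda>t. (1 / m ^ 3) * (norm (g t))\<^sup>2) integrable_on {0..1}"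
      by (intro integrable_on_mult_right square_integrable_on_D g2)
    fix t :: real assume t: "t \<in> {0..1}"
    have v: "0 < ?v t" using m(1) m(2)[OF t] by linarith
    have "F t \<le> (?v t * norm (g t))\<^sup>2 / ?v t ^ 5"
      unfolding F_def by (intro divide_right_mono power_mono norm_cross3_le) auto
    also have "\<dots> = (norm (g t))\<^sup>2 / ?v t ^ 3"
      using v by (simp add: field_simps eval_nat_numeral)
    also have "\<dots> \<le> (norm (g t))\<^sup>2 / m ^ 3"
      using m(1) m(2)[OF t] v by (intro divide_left_mono mult_pos_pos power_mono zero_less_power) auto
    finally show "norm (F t) \<le> (1 / m ^ 3) * (norm (g t))\<^sup>2"
      by (simp add: F_def)
  qed
  note h2 = W22_closed_weak_second_deriv[OF weak_second_deriv_second_deriv[OF W]]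
  have neg: "negligible {x \<in> {0..1}. second_deriv \<gamma> x \<noteq> g x}"
  proof (rule indefinite_integral_unique_AE)
    show "second_deriv \<gamma> integrable_on {0..1}" "g integrable_on {0..1}"
      using square_integrable_on_D(1)[OF h2(1)] square_integrable_on_D(1)[OF g2(1)]
      by (auto simp: absolutely_integrable_on_def)
  qed (use g2(2) h2(2) in auto)
  have "bending_energy \<gamma> = (\<integral>\<^sup>+ t. indicator {0..1} t * ennreal (F t) \<partial>lborel)"
    unfolding bending_energy_def nn_integral_completion[of lborel, symmetric]
  proof (rule nn_integral_cong_AE, rule AE_I'[of "{x \<in> {0..1}. second_deriv \<gamma> x \<noteq> g x}"])
    show "{x \<in> {0..1}. second_deriv \<gamma> x \<noteq> g x} \<in> null_sets lebesgue"
      using neg by (simp only: negligible_iff_null_sets)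
  qed (auto simp: F_def indicator_def)
  also have "\<dots> = ennreal (integral {0..1} F)"
    by (rule nn_integral_eq_HK_integral[OF F]) (simp add: F_def)
  finally show "bending_energy \<gamma> = ennreal (integral {0..1} F)" .
qed

lemma inv_rtp_nonneg: "0 \<le> inv_rtp \<gamma> s t"
  by (simp add: inv_rtp_def)

lemma borel_measurable_inv_rtp:
  assumes "continuous_on UNIV \<gamma>" "continuous_on UNIV (\<lambda>t. dcurve \<gamma> t)"
  shows "(\<lambda>p. inv_rtp \<gamma> (fst p) (snd p)) \<in> borel_measurable borel"
proof -
  have c: "(\<lambda>p::real \<times> real. \<gamma> (fst p)) \<in> borel_measurable borel" "(\<lambda>p::real \<times> real. \<gamma> (snd p)) \<in> borel_measurable borel"
    "(\<lambda>p::real \<times> real. dcurve \<gamma> (fst p)) \<in> borel_measurable borel"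
    by (auto intro!: borel_measurable_continuous_onI continuous_on_compose2[OF assms(1)]
        continuous_on_compose2[OF assms(2)] continuous_intros)
  show ?thesis
    unfolding inv_rtp_def
    by (intro borel_measurable_divide borel_measurable_times borel_measurable_const borel_measurable_power
        measurable_compose[OF _ borel_measurable_norm] borel_measurable_cross3 borel_measurable_diff c)
qed

lemma borel_measurable_tp_integrand:
  assumes "continuous_on UNIV \<gamma>" "continuous_on UNIV (\<lambda>t. dcurve \<gamma> t)"
  shows "(\<lambda>p. indicator ({0..1} \<times> {0..1}) p *
      ennreal (inv_rtp \<gamma> (fst p) (snd p) powr q * norm (dcurve \<gamma> (fst p)) * norm (dcurve \<gamma> (snd p))))
      \<in> borel_measurable borel"
proof -
  have c: "(\<lambda>p::real \<times> real. norm (dcurve \<gamma> (fst p))) \<in> borel_measurable borel"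
    "(\<lambda>p::real \<times> real. norm (dcurve \<gamma> (snd p))) \<in> borel_measurable borel"
    using assms by (auto intro!: borel_measurable_continuous_onI continuous_on_compose2[OF assms(2)] continuous_intros)
  show ?thesis
    by (intro borel_measurable_times_ennreal borel_measurable_indicator measurable_compose[OF _ measurable_ennreal]
        borel_measurable_times powr_real_measurable borel_measurable_inv_rtp[OF assms] c borel_measurable_const)
       (simp add: borel_closed closed_Times)
qed

text \<open>Tonelli's theorem, so that the parameter change can be carried out in one variable at a
  time.\<close>

lemma tangent_point_iterated:
  assumes "continuous_on UNIV \<gamma>" "continuous_on UNIV (\<lambda>t. dcurve \<gamma> t)"
  shows "tangent_point q \<gamma> = (\<integral>\<^sup>+ s. indicator {0..1} s * (\<integral>\<^sup>+ t. indicator {0..1} t *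
     ennreal (inv_rtp \<gamma> s t powr q * norm (dcurve \<gamma> s) * norm (dcurve \<gamma> t)) \<partial>lborel) \<partial>lborel)"
proof -
  let ?f = "\<lambda>p. indicator ({0..1} \<times> {0..1}) p *
      ennreal (inv_rtp \<gamma> (fst p) (snd p) powr q * norm (dcurve \<gamma> (fst p)) * norm (dcurve \<gamma> (snd p)))"
  have m: "?f \<in> borel_measurable (lborel \<Otimes>\<^sub>M lborel)"
    unfolding lborel_prod using borel_measurable_tp_integrand[OF assms] by simp
  have "tangent_point q \<gamma> = integral\<^sup>N (lborel \<Otimes>\<^sub>M lborel) ?f"
    by (simp add: tangent_point_def lborel_prod)
  also have "\<dots> = (\<integral>\<^sup>+ s. \<integral>\<^sup>+ t. ?f (s, t) \<partial>lborel \<partial>lborel)"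
    by (rule lborel.nn_integral_fst[OF m, symmetric])
  also have "\<dots> = (\<integral>\<^sup>+ s. indicator {0..1} s * (\<integral>\<^sup>+ t. indicator {0..1} t *
     ennreal (inv_rtp \<gamma> s t powr q * norm (dcurve \<gamma> s) * norm (dcurve \<gamma> t)) \<partial>lborel) \<partial>lborel)"
    by (intro nn_integral_cong) (auto simp: indicator_def intro!: nn_integral_cong)
  finally show ?thesis .
qed

section \<open>Behaviour of the energies under normalisation\<close>

context arclength_change
begin

lemma regular_\<Gamma>: "regular_curve \<Gamma>"
  using norm_dcurve_\<Gamma> unfolding regular_curve_def by (metis norm_zero zero_neq_one)

text \<open>The part of \<open>tangent_deriv\<close> along the velocity disappears in the cross
  product, and what remains is homogeneous.\<close>

lemma bending_energy_\<Gamma>: "bending_energy \<Gamma> = ennreal L * bending_energy \<gamma>"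
proof -
  define g where "g = second_deriv \<gamma>"
  have g: "weak_second_deriv \<gamma> g" unfolding g_def by (rule weak_second_deriv_second_deriv[OF W])
  define F where "F t = (norm (cross3 (dcurve \<gamma> t) (g t)))\<^sup>2 / v t ^ 5" for t
  note F = bending_energy_eq[OF W reg g, folded F_def]
  have Fabs: "F absolutely_integrable_on {0..1}" using F(1) by (simp add: F_def[abs_def])
  have pt: "(norm (cross3 (dcurve \<Gamma> u) (\<Gamma>2 g u)))\<^sup>2 / norm (dcurve \<Gamma> u) ^ 5 = (L / v (\<sigma> u)) *\<^sub>R (L * F (\<sigma> u))" for u
  proof -
    define x where "x = dcurve \<gamma> (\<sigma> u)"
    have x: "0 < norm x" using v_pos[of "\<sigma> u"] by (simp add: x_def)
    have "cross3 (dcurve \<Gamma> u) (\<Gamma>2 g u) = (L / norm x ^ 3) *\<^sub>R cross3 x (g (\<sigma> u))"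
      by (simp add: dcurve_\<Gamma> \<Gamma>2_def tangent_deriv_def sgn_div_norm x_def cross_mult_left cross_mult_right
          Cross3.right_diff_distrib power3_eq_cube divide_inverse)
    then have "(norm (cross3 (dcurve \<Gamma> u) (\<Gamma>2 g u)))\<^sup>2 = (L / norm x ^ 3)\<^sup>2 * (norm (cross3 x (g (\<sigma> u))))\<^sup>2"
      by (simp only: norm_scaleR power_mult_distrib power2_abs)
    \<comment> \<open>One factor L / norm x is split off to act as the Jacobian.\<close>
    moreover have "(L / norm x ^ 3)\<^sup>2 = (L / norm x) * (L / norm x ^ 5)"
      by (simp add: power2_eq_square flip: power_add power_Suc)
    ultimately show ?thesis
      by (simp add: norm_dcurve_\<Gamma> F_def x_def[symmetric])
  qed
  have "bending_energy \<Gamma> = ennreal (integral {0..1} (\<lambda>u. (L / v (\<sigma> u)) *\<^sub>R (L * F (\<sigma> u))))"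
    using bending_energy_eq(2)[OF W22_closed_\<Gamma> regular_\<Gamma> weak_second_deriv_\<Gamma>[OF g]] by (simp only: pt)
  also have "integral {0..1} (\<lambda>u. (L / v (\<sigma> u)) *\<^sub>R (L * F (\<sigma> u))) = integral {\<sigma> 0..\<sigma> 1} (\<lambda>t. L * F t)"
    by (rule change_of_variables(2)) (use Fabs in \<open>auto intro: set_integrable_mult_right\<close>)
  also have "\<dots> = L * integral {0..1} F" by (simp add: \<sigma>_0 \<sigma>_1)
  also have "ennreal \<dots> = ennreal L * ennreal (integral {0..1} F)"
    using L by (simp add: ennreal_mult')
  also have "ennreal (integral {0..1} F) = bending_energy \<gamma>"
    using F(2) by (simp add: F_def[abs_def])
  finally show ?thesis .
qed

text \<open>Stated for arbitrary nonnegative Borel functions, since the tangent-point energy may be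
  infinite. The substitution is made along \<open>s\<close>, whose derivative is explicit and
  continuous.\<close>

lemma nn_substitution:
  assumes [measurable]: "\<Phi> \<in> borel_measurable borel"
  shows "(\<integral>\<^sup>+ u. indicator {0..1} u * \<Phi> (\<sigma> u) \<partial>lborel) =
    (\<integral>\<^sup>+ t. indicator {0..1} t * (\<Phi> t * ennreal (v t / L)) \<partial>lborel)"
proof -
  have "\<sigma> \<in> borel_measurable borel"
    using \<sigma>_cont by (intro borel_measurable_continuous_onI) (simp add: continuous_at_imp_continuous_on)
  then have m: "(\<lambda>u. \<Phi> (\<sigma> u)) \<in> borel_measurable borel" by measurable
  have "(\<integral>\<^sup>+ u. \<Phi> (\<sigma> u) * indicator {s 0..s 1} u \<partial>lborel) =
      (\<integral>\<^sup>+ t. \<Phi> (\<sigma> (s t)) * ennreal (v t / L) * indicator {0..1} t \<partial>lborel)"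
    by (rule nn_integral_substitution_aux[OF m])
       (use s_der L in \<open>auto intro!: continuous_intros dcurve_cont\<close>)
  moreover have "s 0 = 0" "s 1 = 1" using s0 s_per[of 0] by auto
  ultimately show ?thesis by (simp add: \<sigma>_s mult_ac)
qed

text \<open>An inverse radius depends on the tangent line and the points only, and dividing lengths
  by \<open>L\<close> multiplies it by \<open>L\<close>. At coincident points both sides are
  0.\<close>

lemma inv_rtp_\<Gamma>: "inv_rtp \<Gamma> u w = L * inv_rtp \<gamma> (\<sigma> u) (\<sigma> w)"
proof -
  define x where "x = dcurve \<gamma> (\<sigma> u)"
  have x: "0 < norm x" using v_pos[of "\<sigma> u"] by (simp add: x_def)
  define y where "y = \<gamma> (\<sigma> w) - \<gamma> (\<sigma> u)"
  have y: "\<Gamma> w - \<Gamma> u = (1 / L) *\<^sub>R y" by (simp add: \<Gamma>_def y_def scaleR_diff_right)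
  have "inv_rtp \<Gamma> u w = 2 * (norm (cross3 x y) / (norm x * L)) / ((norm y)\<^sup>2 / L\<^sup>2)"
    using L x by (simp add: inv_rtp_def norm_dcurve_\<Gamma> y dcurve_\<Gamma> x_def[symmetric] sgn_div_norm
        cross_mult_left cross_mult_right divide_inverse power_mult_distrib power_inverse)
  also have "\<dots> = L * (2 * norm (cross3 x y) / (norm x * (norm y)\<^sup>2))"
    using L by (simp add: field_simps power2_eq_square)
  finally show ?thesis by (simp add: inv_rtp_def x_def y_def)
qed

text \<open>The q-th power of the inverse radius contributes \<open>L\<close> to the power q, and
  each of the two line elements removes one factor.\<close>

lemma tangent_point_\<Gamma>: "tangent_point q \<Gamma> = ennreal (L powr (q - 2)) * tangent_point q \<gamma>"
proof -
  have \<gamma>c: "continuous_on UNIV \<gamma>" and \<Gamma>c: "continuous_on UNIV \<Gamma>"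
    using W22_closed_continuous W W22_closed_\<Gamma> by auto
  note it = tangent_point_iterated[OF \<gamma>c dcurve_cont]
    tangent_point_iterated[OF \<Gamma>c W22_closed_continuous_dcurve[OF W22_closed_\<Gamma>]]
  define A where "A x y = ennreal (inv_rtp \<gamma> x y powr q)" for x y
  have A2: "(\<lambda>p. A (fst p) (snd p)) \<in> borel_measurable borel"
    unfolding A_def using borel_measurable_inv_rtp[OF \<gamma>c dcurve_cont]
    by (intro measurable_compose[OF _ measurable_ennreal] powr_real_measurable) auto
  then have A2': "(\<lambda>p. A (fst p) (snd p)) \<in> borel_measurable (borel \<Otimes>\<^sub>M borel)"
    by (simp add: borel_prod)
  have A1[measurable]: "A x \<in> borel_measurable borel" for x
    using measurable_Pair2[OF A2'] by simp
  have vm[measurable]: "v \<in> borel_measurable borel"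
    by (intro borel_measurable_continuous_onI continuous_on_norm dcurve_cont)
  \<comment> \<open>The inner integral after substitution in the second variable, as a function of
    the still unsubstituted first point.\<close>
  define \<Psi> where "\<Psi> x = (\<integral>\<^sup>+ t. indicator {0..1} t * (A x t * ennreal (v t / L)) \<partial>lborel)" for x
  have [measurable]: "\<Psi> \<in> borel_measurable borel"
  proof -
    have "(\<lambda>p. indicator {0..1} (snd p) * (A (fst p) (snd p) * ennreal (v (snd p) / L)))
        \<in> borel_measurable (borel \<Otimes>\<^sub>M lborel)"
      using A2' by measurable
    then have "(\<lambda>x. \<integral>\<^sup>+ t. indicator {0..1} (snd (x, t)) * (A (fst (x, t)) (snd (x, t)) * ennreal (v (snd (x, t)) / L)) \<partial>lborel)
        \<in> borel_measurable borel"
      by (intro lborel.borel_measurable_nn_integral) (simp add: case_prod_beta)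
    then show ?thesis by (simp add: \<Psi>_def[abs_def])
  qed
  have "tangent_point q \<Gamma> = (\<integral>\<^sup>+ u. indicator {0..1} u * (\<integral>\<^sup>+ w. indicator {0..1} w *
      (ennreal (L powr q) * A (\<sigma> u) (\<sigma> w)) \<partial>lborel) \<partial>lborel)"
    unfolding it using L
    by (simp add: norm_dcurve_\<Gamma> inv_rtp_\<Gamma> A_def powr_mult ennreal_mult'[symmetric] inv_rtp_nonneg)
  also have "\<dots> = (\<integral>\<^sup>+ u. indicator {0..1} u * (ennreal (L powr q) * \<Psi> (\<sigma> u)) \<partial>lborel)"
  proof (intro nn_integral_cong arg_cong2[where f=times] refl)
    fix u
    have "(\<integral>\<^sup>+ w. indicator {0..1} w * (ennreal (L powr q) * A (\<sigma> u) (\<sigma> w)) \<partial>lborel)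
       = (\<integral>\<^sup>+ t. indicator {0..1} t * ((ennreal (L powr q) * A (\<sigma> u) t) * ennreal (v t / L)) \<partial>lborel)"
      by (rule nn_substitution) measurable
    also have "\<dots> = (\<integral>\<^sup>+ t. ennreal (L powr q) * (indicator {0..1} t * (A (\<sigma> u) t * ennreal (v t / L))) \<partial>lborel)"
      by (simp add: mult_ac)
    also have "\<dots> = ennreal (L powr q) * \<Psi> (\<sigma> u)"
      unfolding \<Psi>_def by (rule nn_integral_cmult) measurable
    finally show "(\<integral>\<^sup>+ w. indicator {0..1} w * (ennreal (L powr q) * A (\<sigma> u) (\<sigma> w)) \<partial>lborel) = ennreal (L powr q) * \<Psi> (\<sigma> u)" .
  qed
  also have "\<dots> = (\<integral>\<^sup>+ x. indicator {0..1} x * ((ennreal (L powr q) * \<Psi> x) * ennreal (v x / L)) \<partial>lborel)"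
    by (rule nn_substitution) measurable
  also have "\<dots> = (\<integral>\<^sup>+ x. ennreal (L powr (q - 2)) * (indicator {0..1} x * (\<integral>\<^sup>+ t. indicator {0..1} t *
     ennreal (inv_rtp \<gamma> x t powr q * v x * v t) \<partial>lborel)) \<partial>lborel)"
  proof (rule nn_integral_cong)
    fix x
    have "(ennreal (L powr q) * \<Psi> x) * ennreal (v x / L) = (ennreal (L powr q) * ennreal (v x / L)) * \<Psi> x"
      by (simp add: mult_ac)
    also have "\<dots> = (\<integral>\<^sup>+ t. (ennreal (L powr q) * ennreal (v x / L)) * (indicator {0..1} t * (A x t * ennreal (v t / L))) \<partial>lborel)"
      unfolding \<Psi>_def by (rule nn_integral_cmult[symmetric]) measurable
    also have "\<dots> = (\<integral>\<^sup>+ t. ennreal (L powr (q - 2)) * (indicator {0..1} t * ennreal (inv_rtp \<gamma> x t powr q * v x * v t)) \<partial>lborel)"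
    proof (rule nn_integral_cong)
      fix t
      have "L powr q * (v x / L) * (inv_rtp \<gamma> x t powr q * (v t / L)) = L powr (q - 2) * (inv_rtp \<gamma> x t powr q * v x * v t)"
        using L by (simp add: powr_diff power2_eq_square)
      then have "(ennreal (L powr q) * ennreal (v x / L)) * (A x t * ennreal (v t / L)) =
          ennreal (L powr (q - 2)) * ennreal (inv_rtp \<gamma> x t powr q * v x * v t)"
        using L by (simp add: A_def flip: ennreal_mult)
      then show "(ennreal (L powr q) * ennreal (v x / L)) * (indicator {0..1} t * (A x t * ennreal (v t / L))) =
          ennreal (L powr (q - 2)) * (indicator {0..1} t * ennreal (inv_rtp \<gamma> x t powr q * v x * v t))"
        by (simp add: indicator_def)
    qed
    also have "\<dots> = ennreal (L powr (q - 2)) * (\<integral>\<^sup>+ t. indicator {0..1} t * ennreal (inv_rtp \<gamma> x t powr q * v x * v t) \<partial>lborel)"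
    proof (rule nn_integral_cmult)
      have "(\<lambda>t. indicator {0..1} t * (A x t * ennreal (v x * v t))) \<in> borel_measurable lborel"
        by measurable
      then show "(\<lambda>t. indicator {0..1} t * ennreal (inv_rtp \<gamma> x t powr q * v x * v t)) \<in> borel_measurable lborel"
        by (simp add: A_def mult.assoc flip: ennreal_mult')
    qed
    finally show "indicator {0..1} x * ((ennreal (L powr q) * \<Psi> x) * ennreal (v x / L)) =
       ennreal (L powr (q - 2)) * (indicator {0..1} x * (\<integral>\<^sup>+ t. indicator {0..1} t *
     ennreal (inv_rtp \<gamma> x t powr q * v x * v t) \<partial>lborel))"
      by (simp add: indicator_def)
  qed
  also have "\<dots> = ennreal (L powr (q - 2)) * tangent_point q \<gamma>"
    unfolding it
  proof (rule nn_integral_cmult)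
    have "(\<lambda>p. indicator {0..1} (snd p) * (A (fst p) (snd p) * ennreal (v (fst p) * v (snd p))))
        \<in> borel_measurable (borel \<Otimes>\<^sub>M lborel)"
      using A2' by measurable
    then have "(\<lambda>x. \<integral>\<^sup>+ t. indicator {0..1} (snd (x, t)) * (A (fst (x, t)) (snd (x, t)) * ennreal (v (fst (x, t)) * v (snd (x, t)))) \<partial>lborel)
        \<in> borel_measurable borel"
      by (intro lborel.borel_measurable_nn_integral) (simp add: case_prod_beta)
    then have "(\<lambda>x. \<integral>\<^sup>+ t. indicator {0..1} t * ennreal (inv_rtp \<gamma> x t powr q * v x * v t) \<partial>lborel) \<in> borel_measurable borel"
      by (simp add: A_def mult.assoc flip: ennreal_mult')
    then show "(\<lambda>x. indicator {0..1} x * (\<integral>\<^sup>+ t. indicator {0..1} t * ennreal (inv_rtp \<gamma> x t powr q * v x * v t) \<partial>lborel)) \<in> borel_measurable lborel"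
      by measurable
  qed
  finally show ?thesis .
qed

text \<open>The exponent 1 / (q - 2) reduces the scaling factor to \<open>L\<close> itself, matching
  the bending energy.\<close>

lemma tp_power_\<Gamma>:
  assumes q: "2 < q"
  shows "tp_power q \<Gamma> = ennreal L * tp_power q \<gamma>"
proof (cases "tangent_point q \<gamma> = \<infinity>")
  case True
  then show ?thesis using L by (simp add: tp_power_def tangent_point_\<Gamma> ennreal_mult_top)
next
  case False
  then have "tangent_point q \<Gamma> \<noteq> \<infinity>"
    by (simp add: tangent_point_\<Gamma> ennreal_mult_eq_top_iff)
  moreover have "(L powr (q - 2) * enn2real (tangent_point q \<gamma>)) powr (1 / (q - 2)) =
      L * enn2real (tangent_point q \<gamma>) powr (1 / (q - 2))"
    using L q by (simp add: powr_mult powr_powr)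
  ultimately show ?thesis
    using False L by (simp add: tp_power_def tangent_point_\<Gamma> enn2real_mult ennreal_mult')
qed

lemma S_theta_\<Gamma>:
  assumes "2 < q"
  shows "S_theta q \<theta> \<Gamma> = ennreal L * E_theta q \<theta> \<gamma>"
proof -
  have "S_theta q \<theta> \<Gamma> = ennreal L * bending_energy \<gamma> + ennreal \<theta> * (ennreal L * tp_power q \<gamma>)"
    unfolding S_theta_def E_theta_def curve_length_\<Gamma> bending_energy_\<Gamma> tp_power_\<Gamma>[OF assms] by simp
  then show ?thesis
    unfolding E_theta_def distrib_left by (simp only: mult.left_commute)
qed

end

section \<open>Existence and symmetry of the arclength change\<close>

lemma curve_length_pos:
  assumes W: "W22_closed \<gamma>" and reg: "regular_curve \<gamma>"
  shows "0 < curve_length \<gamma>"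
proof -
  obtain m where m: "0 < m" "\<And>t. t \<in> {0..1} \<Longrightarrow> m \<le> norm (dcurve \<gamma> t)"
    using regular_curve_speed_ge[OF W reg] by blast
  have "integral {0..1} (\<lambda>t::real. m) \<le> integral {0..1} (\<lambda>t. norm (dcurve \<gamma> t))"
    using m(2)
    by (intro integral_le integrable_continuous_interval continuous_on_norm
        continuous_on_subset[OF W22_closed_continuous_dcurve[OF W]] continuous_on_const) auto
  then show ?thesis using m(1) by (simp add: curve_length_def)
qed

lemma arclength_function:
  assumes W: "W22_closed \<gamma>" and reg: "regular_curve \<gamma>"
  obtains s \<sigma> where "arclength_change \<gamma> s \<sigma> (curve_length \<gamma>)"
proof -
  define L where "L = curve_length \<gamma>"
  have L: "0 < L" unfolding L_def by (rule curve_length_pos[OF W reg])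
  have vc: "continuous_on UNIV (\<lambda>t. norm (dcurve \<gamma> t))"
    by (intro continuous_on_norm W22_closed_continuous_dcurve[OF W])
  obtain S where S: "\<And>t. (S has_real_derivative norm (dcurve \<gamma> t)) (at t)" "S 0 = 0"
    using has_real_derivative_antiderivative[OF vc] by blast
  define s where "s t = S t / L" for t
  have s_der: "(s has_real_derivative norm (dcurve \<gamma> t) / L) (at t)" for t
    unfolding s_def by (rule DERIV_cdivide[OF S(1)])
  have s0: "s 0 = 0" by (simp add: s_def S)
  have "((\<lambda>t. norm (dcurve \<gamma> t)) has_integral S 1 - S 0) {0..1}"
    using S(1) by (intro fundamental_theorem_of_calculus)
      (auto simp: has_real_derivative_iff_has_vector_derivative[symmetric] intro: has_field_derivative_at_within)
  then have "S 1 = L" by (simp add: integral_unique L_def curve_length_def S(2))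
  then have s1: "s 1 = 1" using L by (simp add: s_def)
  \<comment> \<open>The speed is periodic, so s (t + 1) - s t has derivative zero; its value at 0 is
    1 by the normalisation.\<close>
  have s_per: "s (t + 1) = s t + 1" for t
  proof -
    have "((\<lambda>t. s (t + 1) - s t) has_real_derivative norm (dcurve \<gamma> (t + 1)) / L - norm (dcurve \<gamma> t) / L) (at t)" for t
      by (intro DERIV_diff s_der DERIV_shift[THEN iffD1])
    moreover have "dcurve \<gamma> (t + 1) = dcurve \<gamma> t" for t
      using periodic1_dcurve[OF W] by (simp add: periodic1_def)
    ultimately have "s (t + 1) - s t = s (0 + 1) - s 0"
      by (intro DERIV_zero_imp_eq[of "\<lambda>t. s (t + 1) - s t"]) simp
    then show ?thesis using s0 s1 by simp
  qed
  have s_mono: "s x < s y" if "x < y" for x y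
    by (rule DERIV_pos_imp_increasing[OF that]) (use s_der L reg in \<open>auto intro!: exI divide_pos_pos simp: regular_curve_def\<close>)
  \<comment> \<open>Integers are fixed points, so every real number is caught between two values of
    \<open>s\<close> and the intermediate value theorem gives surjectivity.\<close>
  have s_int: "s (of_int k) = of_int k" for k
  proof -
    have "periodic1 (\<lambda>u. vec (s u - u))" by (simp add: periodic1_def s_per)
    from periodic1_int[OF this, of 0 k] show ?thesis by (simp add: vec_eq_iff s0)
  qed
  have "\<exists>t. s t = u" for u
  proof -
    have "s (of_int \<lfloor>u\<rfloor>) \<le> u" "u \<le> s (of_int (\<lfloor>u\<rfloor> + 1))" unfolding s_int by linarith+
    then show ?thesis
      using IVT[of s "of_int \<lfloor>u\<rfloor>" u "of_int (\<lfloor>u\<rfloor> + 1)"] DERIV_isCont[OF s_der] by auto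
  qed
  then obtain \<sigma> where s\<sigma>: "\<And>u. s (\<sigma> u) = u" by metis
  have "\<sigma> (s t) = t" for t
    using s\<sigma>[of "s t"] s_mono[of t "\<sigma> (s t)"] s_mono[of "\<sigma> (s t)" t]
    by (cases t "\<sigma> (s t)" rule: linorder_cases) auto
  then have "arclength_change \<gamma> s \<sigma> L"
    by unfold_locales (use W reg L s_der s0 s_per s\<sigma> in auto)
  then show ?thesis using that by (simp add: L_def)
qed

text \<open>The invariance of the speed makes \<open>s\<close>, hence \<sigma>, odd and compatible
  with the half shift. The reflection \<psi>_1 needs no separate argument: it is the half shift
  followed by a sign change.\<close>

lemma (in arclength_change) D2_symmetric_\<Gamma>:
  assumes sym: "D2_symmetric \<gamma>"
  shows "D2_symmetric \<Gamma>"
proof -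
  have odd: "s (- t) = - s t" for t
  proof -
    have "((\<lambda>t. s t + s (- t)) has_real_derivative v t / L + v (- t) / L * (- 1)) (at t)" for t
      by (intro DERIV_add s_der DERIV_chain2[OF s_der]) (auto intro!: derivative_eq_intros)
    then have "s t + s (- t) = s 0 + s (- 0)"
      by (intro DERIV_zero_imp_eq[of "\<lambda>t. s t + s (- t)"]) (simp add: D2_symmetric_speed[OF W sym])
    then show ?thesis by (simp add: s0)
  qed
  have half: "s (t - 1/2) = s t - 1/2" for t
  proof -
    have "((\<lambda>t. s t - s (t - 1/2)) has_real_derivative v t / L - v (t - 1/2) / L * 1) (at t)" for t
      by (intro DERIV_diff s_der DERIV_chain2[OF s_der]) (auto intro!: derivative_eq_intros)
    then have c: "s t - s (t - 1/2) = s 1 - s (1 - 1/2)" for t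
      by (intro DERIV_zero_imp_eq[of "\<lambda>t. s t - s (t - 1/2)"]) (simp add: D2_symmetric_speed[OF W sym])
    \<comment> \<open>Evaluating the constant difference at 1/2 gives s (1/2) - s 0 = s 1 - s (1/2),
      so the constant is 1/2.\<close>
    have "s 1 = 1" using s_per[of 0] s0 by simp
    then show ?thesis using c[of t] c[of "1/2"] s0 by simp
  qed
  have \<sigma>odd: "\<sigma> (- u) = - \<sigma> u" for u
    by (rule \<sigma>_cong) (simp add: odd s_\<sigma>)
  have \<sigma>half: "\<sigma> (u - 1/2) = \<sigma> u - 1/2" for u
    by (rule \<sigma>_cong) (simp add: half s_\<sigma>)
  have \<sigma>refl: "\<sigma> (- u + 1/2) = - \<sigma> u + 1/2" for u
    using \<sigma>odd[of "u - 1/2"] by (simp add: \<sigma>half)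
  have scale: "R1 (c *\<^sub>R x) = c *\<^sub>R R1 x" "R2 (c *\<^sub>R x) = c *\<^sub>R R2 x" "R3 (c *\<^sub>R x) = c *\<^sub>R R3 x" for c x
    using R_linear by (auto intro: linear_scale bounded_linear.linear)
  show ?thesis
    using sym unfolding D2_symmetric_def \<Gamma>_def scale \<sigma>refl \<sigma>half \<sigma>odd by simp
qed

lemma arclength_reparametrization:
  assumes \<gamma>: "\<gamma> \<in> Sigma_K \<gamma>0" and q: "2 < q"
  obtains \<Gamma> where "\<Gamma> \<in> Sigma_K \<gamma>0" "\<And>t. norm (dcurve \<Gamma> t) = 1" "S_theta q \<theta> \<Gamma> = S_theta q \<theta> \<gamma>"
proof -
  have W: "W22_closed \<gamma>" and reg: "regular_curve \<gamma>" and inj: "injective_closed \<gamma>"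
    and iso: "ambient_isotopic (\<gamma>0 ` {0..1}) (\<gamma> ` {0..1})" and sym: "D2_symmetric \<gamma>"
    using \<gamma> by (auto simp: Sigma_K_def Omega1_def)
  obtain s \<sigma> where "arclength_change \<gamma> s \<sigma> (curve_length \<gamma>)"
    using arclength_function[OF W reg] by blast
  then interpret arclength_change \<gamma> s \<sigma> "curve_length \<gamma>" .
  have "ambient_isotopic (\<gamma>0 ` {0..1}) (\<Gamma> ` {0..1})"
    unfolding \<Gamma>_image using L by (intro ambient_isotopic_trans[OF iso] ambient_isotopic_scaleR) simp
  then have "\<Gamma> \<in> Sigma_K \<gamma>0"
    using W22_closed_\<Gamma> regular_\<Gamma> injective_closed_\<Gamma>[OF inj] periodic1_\<Gamma> D2_symmetric_\<Gamma>[OF sym]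
    by (simp add: Sigma_K_def Omega1_def W22_closed_continuous curve_length_\<Gamma>)
  moreover have "S_theta q \<theta> \<Gamma> = S_theta q \<theta> \<gamma>"
    using S_theta_\<Gamma>[OF q] by (simp add: S_theta_def)
  ultimately show ?thesis using that norm_dcurve_\<Gamma> by blast
qed

section \<open>Compactness and lower semicontinuity\<close>

text \<open>For unit tangents the second derivative is orthogonal to the tangent almost everywhere,
  so the cross product has the same norm as the second derivative.\<close>

lemma bending_energy_unit_speed:
  assumes W: "W22_closed \<gamma>" and unit: "\<And>t. norm (dcurve \<gamma> t) = 1" and g: "weak_second_deriv \<gamma> g"
  shows "bending_energy \<gamma> = ennreal (integral {0..1} (\<lambda>t. (norm (g t))\<^sup>2))"
proof -
  note g2 = W22_closed_weak_second_deriv[OF g]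
  have reg: "regular_curve \<gamma>"
    using unit unfolding regular_curve_def by (metis norm_zero zero_neq_one)
  have "negligible {t \<in> {0..1}. dcurve \<gamma> t \<bullet> g t \<noteq> 0}"
    using square_integrable_on_D(1)[OF g2(1)]
    by (intro indefinite_integral_orthogonal_AE[where c=1] g2(2) unit) (simp_all add: absolutely_integrable_on_def)
  then have "integral {0..1} (\<lambda>t. (norm (g t))\<^sup>2) =
      integral {0..1} (\<lambda>t. (norm (cross3 (dcurve \<gamma> t) (g t)))\<^sup>2 / norm (dcurve \<gamma> t) ^ 5)"
    by (rule integral_spike) (auto simp: norm_cross unit)
  then show ?thesis
    using bending_energy_eq(2)[OF W reg g] by simp
qed

text \<open>
  At coincident points \<open>inv_rtp\<close> is \<open>0\<close> because of division by zero, so that the integrand is lower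
  semicontinuous everywhere and Fatou needs no exceptional null set.
\<close>

lemma tangent_point_le_limit:
  assumes q: "0 < q"
    and cont: "\<And>n. continuous_on UNIV (\<gamma> n)" "\<And>n. continuous_on UNIV (\<lambda>t. dcurve (\<gamma> n) t)"
    and lim: "\<And>t. (\<lambda>n. \<gamma> n t) \<longlonglongrightarrow> \<Gamma> t" "\<And>t. (\<lambda>n. dcurve (\<gamma> n) t) \<longlonglongrightarrow> dcurve \<Gamma> t"
    and nz: "\<And>t. dcurve \<Gamma> t \<noteq> 0"
    and TP: "(\<lambda>n. tangent_point q (\<gamma> n)) \<longlonglongrightarrow> P"
  shows "tangent_point q \<Gamma> \<le> P"
proof -
  define f where "f \<gamma> p = indicator ({0..1} \<times> {0..1}) p *
      ennreal (inv_rtp \<gamma> (fst p) (snd p) powr q * norm (dcurve \<gamma> (fst p)) * norm (dcurve \<gamma> (snd p)))"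
    for \<gamma> and p :: "real \<times> real"
  have "f \<Gamma> p \<le> liminf (\<lambda>n. f (\<gamma> n) p)" for p
  proof (cases "\<Gamma> (fst p) = \<Gamma> (snd p)")
    case True
    then have "f \<Gamma> p = 0" by (simp add: f_def inv_rtp_def)
    then show ?thesis by simp
  next
    case False
    have "(\<lambda>n. cross3 (dcurve (\<gamma> n) (fst p)) (\<gamma> n (snd p) - \<gamma> n (fst p)))
        \<longlonglongrightarrow> cross3 (dcurve \<Gamma> (fst p)) (\<Gamma> (snd p) - \<Gamma> (fst p))"
      using continuous_on_cross3_pair
      by (intro continuous_on_tendsto_compose[of UNIV "\<lambda>p. cross3 (fst p) (snd p)"
            "\<lambda>n. (dcurve (\<gamma> n) (fst p), \<gamma> n (snd p) - \<gamma> n (fst p))"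
            "(dcurve \<Gamma> (fst p), \<Gamma> (snd p) - \<Gamma> (fst p))", simplified] tendsto_intros lim)
    then have "(\<lambda>n. inv_rtp (\<gamma> n) (fst p) (snd p)) \<longlonglongrightarrow> inv_rtp \<Gamma> (fst p) (snd p)"
      unfolding inv_rtp_def using False nz by (intro tendsto_intros lim) auto
    then have pw: "(\<lambda>n. inv_rtp (\<gamma> n) (fst p) (snd p) powr q) \<longlonglongrightarrow> inv_rtp \<Gamma> (fst p) (snd p) powr q"
      using q by (intro tendsto_powr') (auto simp: inv_rtp_nonneg)
    have "(\<lambda>n. ennreal (inv_rtp (\<gamma> n) (fst p) (snd p) powr q * norm (dcurve (\<gamma> n) (fst p)) * norm (dcurve (\<gamma> n) (snd p))))
        \<longlonglongrightarrow> ennreal (inv_rtp \<Gamma> (fst p) (snd p) powr q * norm (dcurve \<Gamma> (fst p)) * norm (dcurve \<Gamma> (snd p)))"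
      by (intro tendsto_ennrealI tendsto_mult tendsto_norm pw lim)
    then have "(\<lambda>n. f (\<gamma> n) p) \<longlonglongrightarrow> f \<Gamma> p"
      unfolding f_def by (cases "p \<in> {0..1} \<times> {0..1}") (simp_all add: indicator_def)
    then show ?thesis by (simp add: lim_imp_Liminf)
  qed
  then have "(\<integral>\<^sup>+ p. f \<Gamma> p \<partial>lborel) \<le> (\<integral>\<^sup>+ p. liminf (\<lambda>n. f (\<gamma> n) p) \<partial>lborel)"
    by (intro nn_integral_mono)
  also have "\<dots> \<le> liminf (\<lambda>n. \<integral>\<^sup>+ p. f (\<gamma> n) p \<partial>lborel)"
    unfolding f_def using borel_measurable_tp_integrand[OF cont] by (intro nn_integral_liminf) simp
  also have "\<dots> = P"
    using TP unfolding tangent_point_def f_def by (intro lim_imp_Liminf) simp_all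
  finally show ?thesis unfolding tangent_point_def f_def .
qed

section \<open>Injectivity and knot class near a bilipschitz curve\<close>

lemma real_shift_half: obtains k :: int where "\<bar>s - of_int k - t\<bar> \<le> (1/2::real)"
proof -
  have "\<bar>s - of_int (round (s - t)) - t\<bar> \<le> 1/2"
    using of_int_round_abs_le[of "s - t"] by (simp add: algebra_simps abs_minus_commute)
  then show ?thesis using that by blast
qed

lemma bilipschitz_imp_injective_closed:
  assumes per: "periodic1 \<gamma>" and c: "0 < c"
    and bl: "\<And>s t. \<bar>t - s\<bar> \<le> 1/2 \<Longrightarrow> c * \<bar>t - s\<bar> \<le> norm (\<gamma> t - \<gamma> s)"
  shows "injective_closed \<gamma>"
  unfolding injective_closed_def
proof (intro allI impI)
  fix s t assume eq: "\<gamma> s = \<gamma> t"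
  obtain k :: int where k: "\<bar>s - of_int k - t\<bar> \<le> 1/2" by (rule real_shift_half)
  have "c * \<bar>s - of_int k - t\<bar> \<le> norm (\<gamma> (s - of_int k) - \<gamma> t)" by (rule bl[OF k])
  also have "\<dots> = 0" by (simp add: periodic1_diff_int[OF per] eq)
  finally have "s - t = of_int k" using c by (simp add: mult_le_0_iff)
  then show "s - t \<in> \<int>" by simp
qed

text \<open>The displacement \<Gamma> - \<gamma> is c/6-Lipschitz in the parameter; dividing by the
  bilipschitz constant it is 1/6-Lipschitz in space. Since 3 * (1/6) < 1,
  \<open>ambient_isotopic_displacement\<close> applies.\<close>

lemma ambient_isotopic_C1_close:
  assumes per: "periodic1 \<gamma>" "periodic1 \<Gamma>" and c: "0 < c"
    and bl: "\<And>s t. \<bar>t - s\<bar> \<le> 1/2 \<Longrightarrow> c * \<bar>t - s\<bar> \<le> norm (\<gamma> t - \<gamma> s)"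
    and der: "\<And>t. (\<gamma> has_vector_derivative \<gamma>' t) (at t)" "\<And>t. (\<Gamma> has_vector_derivative \<Gamma>' t) (at t)"
    and close: "\<And>t. norm (\<Gamma>' t - \<gamma>' t) \<le> c / 6"
  shows "ambient_isotopic (\<gamma> ` {0..1}) (\<Gamma> ` {0..1})"
proof -
  have inj: "injective_closed \<gamma>" by (rule bilipschitz_imp_injective_closed[OF per(1) c bl])
  define d where "d t = \<Gamma> t - \<gamma> t" for t
  have d_per: "d (t - of_int k) = d t" for t k
    by (simp add: d_def periodic1_diff_int[OF per(1)] periodic1_diff_int[OF per(2)])
  have d_der: "(d has_vector_derivative (\<Gamma>' t - \<gamma>' t)) (at t)" for t
    unfolding d_def by (intro has_vector_derivative_diff der)
  have "onorm (\<lambda>h. h *\<^sub>R (\<Gamma>' t - \<gamma>' t)) \<le> c / 6" for t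
    by (rule onorm_le) (use mult_left_mono[OF close[of t] abs_ge_zero] in \<open>simp add: mult.commute\<close>)
  then have d_lip: "norm (d t - d s) \<le> c / 6 * \<bar>t - s\<bar>" for s t
    using differentiable_bound[of UNIV d "\<lambda>x h. h *\<^sub>R (\<Gamma>' x - \<gamma>' x)" "c / 6" t s] d_der
    by (simp add: has_vector_derivative_def)
  \<comment> \<open>The parameter of a point is determined up to an integer by injectivity, and
    \<Gamma> is periodic, so the choice does not affect the value.\<close>
  define f where "f x = \<Gamma> (SOME t. \<gamma> t = x)" for x
  have f: "f (\<gamma> t) = \<Gamma> t" for t
  proof -
    have "\<gamma> (SOME t'. \<gamma> t' = \<gamma> t) = \<gamma> t" by (rule someI) (rule refl)
    then have "(SOME t'. \<gamma> t' = \<gamma> t) - t \<in> \<int>" using inj by (simp add: injective_closed_def)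
    then obtain k where "(SOME t'. \<gamma> t' = \<gamma> t) = t + of_int k" by (auto elim!: Ints_cases simp: algebra_simps)
    then show ?thesis by (simp add: f_def periodic1_int[OF per(2)])
  qed
  have "ambient_isotopic (\<gamma> ` {0..1}) (f ` \<gamma> ` {0..1})"
  proof (rule ambient_isotopic_displacement[where L="1/6"])
    fix x y assume "x \<in> \<gamma> ` {0..1}" "y \<in> \<gamma> ` {0..1}"
    then obtain s t where st: "x = \<gamma> s" "y = \<gamma> t" by auto
    obtain k :: int where k: "\<bar>s - of_int k - t\<bar> \<le> 1/2" by (rule real_shift_half)
    have "norm ((f x - x) - (f y - y)) = norm (d (s - of_int k) - d t)"
      by (simp add: st f d_per) (simp add: d_def)
    also have "\<dots> \<le> 1/6 * (c * \<bar>s - of_int k - t\<bar>)"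
      using d_lip[of "s - of_int k" t] by simp
    also have "\<dots> \<le> 1/6 * norm (\<gamma> (s - of_int k) - \<gamma> t)"
      using bl[OF k] by (intro mult_left_mono) auto
    also have "\<gamma> (s - of_int k) = x" by (simp add: st periodic1_diff_int[OF per(1)])
    finally show "norm ((f x - x) - (f y - y)) \<le> 1/6 * norm (x - y)" by (simp add: st)
  qed auto
  moreover have "f ` \<gamma> ` {0..1} = \<Gamma> ` {0..1}" by (simp add: image_image f)
  ultimately show ?thesis by simp
qed

text \<open>Arzela-Ascoli is applied to the derivatives on one period. The curves are recovered by
  termwise differentiation, for which convergence at the single point 0 suffices; that hypothesis
  excludes drift by translations.\<close>

lemma closed_curves_C1_compact:
  fixes \<gamma> :: "nat \<Rightarrow> curve"
  assumes per: "\<And>n. periodic1 (\<gamma> n)" "\<And>n. periodic1 (\<lambda>t. dcurve (\<gamma> n) t)"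
    and der: "\<And>n t. (\<gamma> n has_vector_derivative dcurve (\<gamma> n) t) (at t)"
    and bound: "\<And>n t. norm (dcurve (\<gamma> n) t) \<le> B"
    and hold: "\<And>n s t. \<bar>t - s\<bar> \<le> 1 \<Longrightarrow> norm (dcurve (\<gamma> n) t - dcurve (\<gamma> n) s) \<le> C * sqrt \<bar>t - s\<bar>"
    and z: "(\<lambda>n. \<gamma> n 0) \<longlonglongrightarrow> z"
  obtains \<Gamma> k where "strict_mono (k :: nat \<Rightarrow> nat)" "\<And>t. (\<lambda>n. \<gamma> (k n) t) \<longlonglongrightarrow> \<Gamma> t"
    "\<And>t. (\<Gamma> has_vector_derivative dcurve \<Gamma> t) (at t)"
    "\<And>e. 0 < e \<Longrightarrow> \<exists>N. \<forall>n\<ge>N. \<forall>t. norm (dcurve (\<gamma> (k n)) t - dcurve \<Gamma> t) \<le> e"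
proof -
  have "0 \<le> C" using order_trans[OF norm_ge_zero hold[of 1 0 0]] by simp
  obtain T k where k: "strict_mono (k :: nat \<Rightarrow> nat)"
    and T: "\<And>e. 0 < e \<Longrightarrow> \<exists>N. \<forall>n x. N \<le> n \<and> x \<in> {0..1} \<longrightarrow> norm (dcurve (\<gamma> (k n)) x - T x) < e"
  proof (rule Arzela_Ascoli[of "{0..1::real}" "\<lambda>n t. dcurve (\<gamma> n) t" B])
    show "compact {0..1::real}" by simp
    show "norm (dcurve (\<gamma> n) x) \<le> B" for n x by (rule bound)
    fix x e :: real assume "x \<in> {0..1}" "0 < e"
    \<comment> \<open>Inverts the Hoelder modulus: C * sqrt d = C * e / (C + 1) < e, also when C =
      0.\<close>
    define d where "d = (e / (C + 1))\<^sup>2"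
    have d: "0 < d" using \<open>0 < e\<close> \<open>0 \<le> C\<close> by (simp add: d_def)
    have "norm (dcurve (\<gamma> n) x - dcurve (\<gamma> n) y) < e" if "y \<in> {0..1}" "norm (x - y) < d" for n y
    proof -
      have "norm (dcurve (\<gamma> n) x - dcurve (\<gamma> n) y) \<le> C * sqrt \<bar>x - y\<bar>"
        using that \<open>x \<in> {0..1}\<close> by (intro hold) auto
      also have "\<dots> \<le> C * sqrt d"
        using that \<open>0 \<le> C\<close> by (intro mult_left_mono real_sqrt_le_mono) auto
      also have "sqrt d = e / (C + 1)" using \<open>0 < e\<close> \<open>0 \<le> C\<close> by (simp add: d_def)
      also have "C * (e / (C + 1)) < e" using \<open>0 < e\<close> \<open>0 \<le> C\<close> by (simp add: field_simps)
      finally show ?thesis .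
    qed
    then show "\<exists>d. 0 < d \<and> (\<forall>n y. y \<in> {0..1} \<and> norm (x - y) < d \<longrightarrow> norm (dcurve (\<gamma> n) x - dcurve (\<gamma> n) y) < e)"
      using d by blast
  qed (rule that)
  \<comment> \<open>Periodic extension of the limit, which makes the convergence uniform on the
    whole line.\<close>
  define T' where "T' t = T (t - of_int \<lfloor>t\<rfloor>)" for t
  have T': "\<exists>N. \<forall>n\<ge>N. \<forall>t. norm (dcurve (\<gamma> (k n)) t - T' t) \<le> e" if e: "0 < e" for e
  proof -
    obtain N where N: "\<And>n x. N \<le> n \<Longrightarrow> x \<in> {0..1} \<Longrightarrow> norm (dcurve (\<gamma> (k n)) x - T x) < e"
      using T[OF e] by blast
    have "norm (dcurve (\<gamma> (k n)) t - T' t) \<le> e" if "N \<le> n" for n t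
    proof -
      have "t - of_int \<lfloor>t\<rfloor> \<in> {0..1}" by (simp; linarith)
      from N[OF that this] show ?thesis
        by (simp add: T'_def periodic1_diff_int[OF per(2)])
    qed
    then show ?thesis by blast
  qed
  have "\<exists>\<Gamma>. \<forall>x\<in>UNIV. (\<lambda>n. \<gamma> (k n) x) \<longlonglongrightarrow> \<Gamma> x \<and> (\<Gamma> has_derivative (\<lambda>h. h *\<^sub>R T' x)) (at x within UNIV)"
  proof (rule has_derivative_sequence)
    show "(\<gamma> (k n) has_derivative (\<lambda>h. h *\<^sub>R dcurve (\<gamma> (k n)) x)) (at x within UNIV)" for n x
      using der[of "k n" x] by (simp add: has_vector_derivative_def)
    show "(\<lambda>n. \<gamma> (k n) 0) \<longlonglongrightarrow> z"
      using LIMSEQ_subseq_LIMSEQ[OF z k] by (simp add: o_def)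
    fix e :: real assume "0 < e"
    from T'[OF this] obtain N where N: "\<And>n t. N \<le> n \<Longrightarrow> norm (dcurve (\<gamma> (k n)) t - T' t) \<le> e" by blast
    show "\<forall>\<^sub>F n in sequentially. \<forall>x\<in>UNIV. \<forall>h. norm (h *\<^sub>R dcurve (\<gamma> (k n)) x - h *\<^sub>R T' x) \<le> e * norm h"
      unfolding eventually_sequentially
      by (intro exI[of _ N] allI impI ballI)
         (use mult_left_mono[OF N abs_ge_zero] in \<open>simp add: mult.commute flip: scaleR_diff_right\<close>)
  qed auto
  then obtain \<Gamma> where \<Gamma>: "\<And>x. (\<lambda>n. \<gamma> (k n) x) \<longlonglongrightarrow> \<Gamma> x" "\<And>x. (\<Gamma> has_vector_derivative T' x) (at x)"
    by (auto simp: has_vector_derivative_def)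
  have "dcurve \<Gamma> t = T' t" for t using \<Gamma>(2) by (rule vector_derivative_at)
  then show ?thesis using that[of k \<Gamma>] k \<Gamma> T' by simp
qed


text \<open>Finite energy allows both parts to be named as real numbers, so that convergent
  subsequences can be extracted. Positivity of \<theta> prevents an infinite tangent-point term from
  being multiplied away.\<close>

lemma S_theta_unit_speed:
  assumes W: "W22_closed \<gamma>" and unit: "\<And>t. norm (dcurve \<gamma> t) = 1"
    and q: "2 < q" and \<theta>: "0 < \<theta>" and fin: "S_theta q \<theta> \<gamma> < \<infinity>"
  obtains p where "0 \<le> p" "tangent_point q \<gamma> = ennreal p"
    "S_theta q \<theta> \<gamma> = ennreal (integral {0..1} (\<lambda>t. (norm (second_deriv \<gamma> t))\<^sup>2) + \<theta> * p powr (1 / (q - 2)))"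
proof -
  note sd = weak_second_deriv_second_deriv[OF W]
  have b: "0 \<le> integral {0..1} (\<lambda>t. (norm (second_deriv \<gamma> t))\<^sup>2)"
    by (intro integral_nonneg square_integrable_on_D W22_closed_weak_second_deriv[OF sd]) auto
  have "curve_length \<gamma> = 1" by (simp add: curve_length_def unit)
  then have S: "S_theta q \<theta> \<gamma> = ennreal (integral {0..1} (\<lambda>t. (norm (second_deriv \<gamma> t))\<^sup>2)) + ennreal \<theta> * tp_power q \<gamma>"
    by (simp add: S_theta_def E_theta_def bending_energy_unit_speed[OF W unit sd])
  have nt: "tangent_point q \<gamma> \<noteq> \<infinity>"
    using fin \<theta> unfolding S by (auto simp: tp_power_def ennreal_mult_top)
  define p where "p = enn2real (tangent_point q \<gamma>)"
  have p: "tangent_point q \<gamma> = ennreal p" using nt by (simp add: p_def less_top)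
  show ?thesis
  proof (rule that[OF _ p])
    show "0 \<le> p" by (simp add: p_def)
    show "S_theta q \<theta> \<gamma> = ennreal (integral {0..1} (\<lambda>t. (norm (second_deriv \<gamma> t))\<^sup>2) + \<theta> * p powr (1 / (q - 2)))"
      using nt b \<theta> unfolding S by (subst ennreal_plus) (auto simp: tp_power_def p_def ennreal_mult')
  qed
qed

text \<open>The base point is fixed by \<open>R3\<close>, so it lies on the third axis, and
  \<open>R2\<close> carries it to the opposite point \<gamma> (1/2) = - \<gamma> 0. These two are
  joined by an arc of length at most 1/2.\<close>

lemma D2_symmetric_norm_le:
  assumes sym: "D2_symmetric \<gamma>" and lip: "\<And>s t. norm (\<gamma> t - \<gamma> s) \<le> \<bar>t - s\<bar>"
  shows "norm (\<gamma> 0) \<le> 1"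
proof -
  have "R3 (\<gamma> 0) = \<gamma> 0" "R2 (\<gamma> 0) = \<gamma> (1/2)"
    using sym unfolding D2_symmetric_def by (metis minus_zero, metis cancel_comm_monoid_add_class.diff_cancel)
  then have "(\<gamma> 0)$1 = 0" "(\<gamma> 0)$2 = 0" "\<gamma> (1/2) = R2 (\<gamma> 0)"
    by (simp_all add: R3_def vec_eq_iff forall_3)
  then have "\<gamma> (1/2) = - \<gamma> 0"
    by (simp add: R2_def vec_eq_iff forall_3)
  then have "norm (- (2 *\<^sub>R \<gamma> 0)) \<le> \<bar>1/2 - 0\<bar>"
    using lip[of "1/2" 0] by (simp add: scaleR_2)
  then show ?thesis by simp
qed

section \<open>Existence of a symmetric minimiser\<close>

theorem theorem4p1:
  fixes q \<theta> :: real and \<gamma>0 :: curve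
  assumes "2 < q" "q \<le> 4"
    and "closed_knot \<gamma>0"
    and "Sigma_K \<gamma>0 \<noteq> {}"
    and "0 < \<theta>"
  shows "\<exists>\<Gamma>. \<Gamma> \<in> Sigma_K \<gamma>0 \<and> arclength_param \<Gamma> \<and> curve_length \<Gamma> = 1 \<and>
           S_theta q \<theta> \<Gamma> = (INF \<gamma>\<in>Sigma_K \<gamma>0. S_theta q \<theta> \<gamma>)"
proof -
  note q = assms(1) and \<theta> = assms(5)
  define I where "I = (INF \<gamma>\<in>Sigma_K \<gamma>0. S_theta q \<theta> \<gamma>)"
  have I_le: "I \<le> S_theta q \<theta> \<gamma>" if "\<gamma> \<in> Sigma_K \<gamma>0" for \<gamma>
    unfolding I_def by (rule INF_lower[OF that])
  have unit_len: "curve_length \<Gamma> = 1 \<and> arclength_param \<Gamma>" if "\<And>t. norm (dcurve \<Gamma> t) = 1" for \<Gamma>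
    using that by (simp add: curve_length_def arclength_param_def)
  have "\<exists>\<Gamma>\<in>Sigma_K \<gamma>0. (\<forall>t. norm (dcurve \<Gamma> t) = 1) \<and> S_theta q \<theta> \<Gamma> \<le> I"
  proof (cases "I = \<infinity>")
    \<comment> \<open>Every competitor then has infinite energy, and any normalised one is a
      minimiser.\<close>
    case True
    obtain \<gamma> where "\<gamma> \<in> Sigma_K \<gamma>0" using assms(4) by auto
    then show ?thesis
      using arclength_reparametrization[OF _ q, of \<gamma> \<gamma>0 \<theta>] True by (metis infinity_ennreal_def top_greatest)
  next
    case False
    define i where "i = enn2real I"
    have i: "I = ennreal i" "0 \<le> i" using False by (auto simp: i_def less_top)
    have "\<exists>\<Gamma>. \<Gamma> \<in> Sigma_K \<gamma>0 \<and> (\<forall>t. norm (dcurve \<Gamma> t) = 1) \<and> S_theta q \<theta> \<Gamma> < ennreal (i + 1 / real (Suc n))" for n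
    proof -
      have "I < ennreal (i + 1 / real (Suc n))"
        unfolding i using i(2) by (intro ennreal_lessI) (auto intro: add_nonneg_pos)
      then obtain \<gamma> where "\<gamma> \<in> Sigma_K \<gamma>0" "S_theta q \<theta> \<gamma> < ennreal (i + 1 / real (Suc n))"
        unfolding I_def INF_less_iff by blast
      then show ?thesis using arclength_reparametrization[OF _ q, of \<gamma> \<gamma>0 \<theta>] by metis
    qed
    then obtain \<gamma> where \<gamma>: "\<And>n. \<gamma> n \<in> Sigma_K \<gamma>0" and unit: "\<And>n t. norm (dcurve (\<gamma> n) t) = 1"
      and S: "\<And>n. S_theta q \<theta> (\<gamma> n) < ennreal (i + 1 / real (Suc n))"
      by metis
    have W: "W22_closed (\<gamma> n)" and inj: "injective_closed (\<gamma> n)" and sym: "D2_symmetric (\<gamma> n)"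
      and per: "periodic1 (\<gamma> n)" and iso: "ambient_isotopic (\<gamma>0 ` {0..1}) (\<gamma> n ` {0..1})" for n
      using \<gamma>[of n] by (auto simp: Sigma_K_def Omega1_def)
    note der = W22_closed_has_vector_derivative[OF W]
    note sd = weak_second_deriv_second_deriv[OF W]
    note sd2 = W22_closed_weak_second_deriv[OF sd]
    define b where "b n = integral {0..1} (\<lambda>t. (norm (second_deriv (\<gamma> n) t))\<^sup>2)" for n
    have b0: "0 \<le> b n" for n
      unfolding b_def by (intro integral_nonneg square_integrable_on_D sd2) auto
    have "\<exists>p\<ge>0. tangent_point q (\<gamma> n) = ennreal p \<and> S_theta q \<theta> (\<gamma> n) = ennreal (b n + \<theta> * p powr (1 / (q - 2)))" for n
      using S_theta_unit_speed[OF W unit q \<theta>, of n] S[of n] unfolding b_def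
      by (metis ennreal_less_top infinity_ennreal_def order_less_trans)
    then obtain p where p0: "\<And>n. 0 \<le> p n" and TP: "\<And>n. tangent_point q (\<gamma> n) = ennreal (p n)"
      and S_eq: "\<And>n. S_theta q \<theta> (\<gamma> n) = ennreal (b n + \<theta> * p n powr (1 / (q - 2)))"
      by metis
    define e where "e n = b n + \<theta> * p n powr (1 / (q - 2))" for n
    have e_less: "e n < i + 1 / real (Suc n)" for n
      using S[of n] b0[of n] \<theta> unfolding S_eq e_def by (subst (asm) ennreal_less_iff) auto
    have e_ge: "i \<le> e n" for n
      using I_le[OF \<gamma>[of n]] b0[of n] \<theta> unfolding S_eq i e_def by (subst (asm) ennreal_le_iff) auto
    have e_lim: "e \<longlonglongrightarrow> i"
    proof (rule tendsto_sandwich[OF _ _ tendsto_const])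
      have "(\<lambda>n. i + 1 / real (Suc n)) \<longlonglongrightarrow> i + 0"
        by (intro tendsto_intros LIMSEQ_Suc lim_const_over_n)
      then show "(\<lambda>n. i + 1 / real (Suc n)) \<longlonglongrightarrow> i" by simp
    qed (use e_less e_ge in \<open>auto intro!: always_eventually less_imp_le\<close>)
    have e_bd: "e n \<le> i + 1" for n
    proof -
      have "1 / real (Suc n) \<le> 1" by simp
      then show ?thesis using e_less[of n] by linarith
    qed
    define M where "M = i + 1"
    have bM: "b n \<le> M" for n
      using e_bd[of n] \<theta> by (simp add: e_def M_def) (smt (verit) mult_nonneg_nonneg powr_ge_zero)
    \<comment> \<open>Discarding the bending part leaves \<theta> * p^(1/(q-2)) \<le> M; solving for
      \<open>p\<close> gives this bound.\<close>
    define P where "P = (M / \<theta>) powr (q - 2)"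
    have P: "0 < P" using \<theta> i(2) by (simp add: P_def M_def)
    have pP: "p n \<le> P" for n
    proof -
      have "p n powr (1 / (q - 2)) \<le> M / \<theta>"
        using e_bd[of n] b0[of n] \<theta> by (simp add: e_def M_def field_simps)
      then have "(p n powr (1 / (q - 2))) powr (q - 2) \<le> P"
        unfolding P_def using q by (intro powr_mono2) auto
      then show ?thesis using q p0[of n] by (simp add: powr_powr)
    qed
    have lip: "norm (\<gamma> n t - \<gamma> n s) \<le> \<bar>t - s\<bar>" for n s t
      by (rule unit_speed_lipschitz[OF der unit])
    \<comment> \<open>One compactness argument for three quantities. Convergence of the total energy
      does not make its two parts converge, but semicontinuity is applied to each part separately;
      the base point is the anchor for the C^1 compactness.\<close>
    define X where "X n = (b n, p n, \<gamma> n 0)" for n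
    have "bounded (range X)"
    proof (rule boundedI)
      fix x assume "x \<in> range X"
      then obtain n where x: "x = X n" by auto
      have "norm x \<le> norm (b n) + norm (p n, \<gamma> n 0)"
        unfolding x X_def by (rule norm_Pair_le)
      also have "norm (p n, \<gamma> n 0) \<le> norm (p n) + norm (\<gamma> n 0)" by (rule norm_Pair_le)
      finally show "norm x \<le> M + (P + 1)"
        using bM[of n] pP[of n] b0[of n] p0[of n] D2_symmetric_norm_le[OF sym lip, of n] by simp
    qed
    then obtain x r where r: "strict_mono (r :: nat \<Rightarrow> nat)" and x: "(X \<circ> r) \<longlonglongrightarrow> x"
      using bounded_imp_convergent_subsequence by blast
    obtain b' p' z where x_eq: "x = (b', p', z)" by (cases x)
    have lims: "(\<lambda>n. b (r n)) \<longlonglongrightarrow> b'" "(\<lambda>n. p (r n)) \<longlonglongrightarrow> p'" "(\<lambda>n. \<gamma> (r n) 0) \<longlonglongrightarrow> z"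
      using tendsto_fst[OF x] tendsto_fst[OF tendsto_snd[OF x]] tendsto_snd[OF tendsto_snd[OF x]]
      by (simp_all add: X_def o_def x_eq)
    have hold: "norm (dcurve (\<gamma> n) t - dcurve (\<gamma> n) s) \<le> (M + 1) * sqrt \<bar>t - s\<bar>" if "\<bar>t - s\<bar> \<le> 1" for n s t
      by (rule W22_closed_holder[OF W sd _ that]) (use bM in \<open>simp add: b_def\<close>)
    obtain \<Gamma> k where k: "strict_mono (k :: nat \<Rightarrow> nat)" and lim: "\<And>t. (\<lambda>n. \<gamma> (r (k n)) t) \<longlonglongrightarrow> \<Gamma> t"
      and \<Gamma>_der: "\<And>t. (\<Gamma> has_vector_derivative dcurve \<Gamma> t) (at t)"
      and C1: "\<And>e. 0 < e \<Longrightarrow> \<exists>N. \<forall>n\<ge>N. \<forall>t. norm (dcurve (\<gamma> (r (k n))) t - dcurve \<Gamma> t) \<le> e"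
      using closed_curves_C1_compact[of "\<lambda>n. \<gamma> (r n)" 1 "M + 1" z, OF per periodic1_dcurve[OF W] der _ hold lims(3)]
      by (metis unit order_refl)
    define \<phi> where "\<phi> n = r (k n)" for n
    have \<phi>: "strict_mono \<phi>" using strict_mono_o[OF r k] by (simp add: \<phi>_def[abs_def] o_def)
    note lim = lim[folded \<phi>_def] and C1 = C1[folded \<phi>_def]
    have b_lim: "(\<lambda>n. b (\<phi> n)) \<longlonglongrightarrow> b'" and p_lim: "(\<lambda>n. p (\<phi> n)) \<longlonglongrightarrow> p'"
      using LIMSEQ_subseq_LIMSEQ[OF lims(1) k] LIMSEQ_subseq_LIMSEQ[OF lims(2) k] by (simp_all add: o_def \<phi>_def)
    have dlim: "(\<lambda>n. dcurve (\<gamma> (\<phi> n)) t) \<longlonglongrightarrow> dcurve \<Gamma> t" for t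
      unfolding LIMSEQ_iff
    proof (intro allI impI)
      fix d :: real assume "0 < d"
      then obtain N where "\<And>n. N \<le> n \<Longrightarrow> norm (dcurve (\<gamma> (\<phi> n)) t - dcurve \<Gamma> t) \<le> d / 2" using C1[of "d / 2"] by auto
      then show "\<exists>N. \<forall>n\<ge>N. norm (dcurve (\<gamma> (\<phi> n)) t - dcurve \<Gamma> t) < d"
        using \<open>0 < d\<close> by (intro exI[of _ N]) force
    qed
    have \<Gamma>_unit: "norm (dcurve \<Gamma> t) = 1" for t
      using tendsto_norm[OF dlim[of t]] by (simp add: unit LIMSEQ_const_iff)
    have \<Gamma>_per: "periodic1 \<Gamma>"
      unfolding periodic1_def
    proof
      fix t show "\<Gamma> (t + 1) = \<Gamma> t"
        using LIMSEQ_unique[OF lim[of "t + 1"]] lim[of t] per by (simp add: periodic1_def)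
    qed
    have \<Gamma>_sym: "D2_symmetric \<Gamma>"
      unfolding D2_symmetric_def
    proof (intro allI conjI)
      fix t
      show "R1 (\<Gamma> (- t + 1/2)) = \<Gamma> t"
        using LIMSEQ_unique[OF bounded_linear.tendsto[OF R_linear(1) lim[of "- t + 1/2"]]] lim[of t] sym
        unfolding D2_symmetric_def by simp
      show "R2 (\<Gamma> (t - 1/2)) = \<Gamma> t"
        using LIMSEQ_unique[OF bounded_linear.tendsto[OF R_linear(2) lim[of "t - 1/2"]]] lim[of t] sym
        unfolding D2_symmetric_def by simp
      show "R3 (\<Gamma> (- t)) = \<Gamma> t"
        using LIMSEQ_unique[OF bounded_linear.tendsto[OF R_linear(3) lim[of "- t"]]] lim[of t] sym
        unfolding D2_symmetric_def by simp
    qed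
    \<comment> \<open>On any subinterval the integrals of the second derivatives are increments of
      the tangents; uniform convergence of the tangents contributes d / 2 at each endpoint.\<close>
    obtain G where G: "G square_integrable_on {0..1}"
      "\<And>s t. 0 \<le> s \<Longrightarrow> s \<le> t \<Longrightarrow> t \<le> 1 \<Longrightarrow> dcurve \<Gamma> t - dcurve \<Gamma> s = integral {s..t} G"
      "integral {0..1} (\<lambda>t. (norm (G t))\<^sup>2) \<le> b'"
    proof (rule L2_weak_limit[of 0 1 "\<lambda>n. second_deriv (\<gamma> (\<phi> n))" "\<lambda>t. dcurve \<Gamma> t" b'])
      show "second_deriv (\<gamma> (\<phi> n)) square_integrable_on {0..1}" for n by (rule sd2)
      show "(\<lambda>n. integral {0..1} (\<lambda>t. (norm (second_deriv (\<gamma> (\<phi> n)) t))\<^sup>2)) \<longlonglongrightarrow> b'"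
        using b_lim by (simp add: b_def)
      fix d :: real assume "0 < d"
      then obtain N where N: "\<And>n t. N \<le> n \<Longrightarrow> norm (dcurve (\<gamma> (\<phi> n)) t - dcurve \<Gamma> t) \<le> d / 2" using C1[of "d / 2"] by auto
      have "norm (integral {s..t} (second_deriv (\<gamma> (\<phi> n))) - (dcurve \<Gamma> t - dcurve \<Gamma> s)) \<le> d"
        if "N \<le> n" "0 \<le> s" "s \<le> t" "t \<le> 1" for n s t
      proof -
        have "integral {s..t} (second_deriv (\<gamma> (\<phi> n))) - (dcurve \<Gamma> t - dcurve \<Gamma> s) =
            (dcurve (\<gamma> (\<phi> n)) t - dcurve \<Gamma> t) - (dcurve (\<gamma> (\<phi> n)) s - dcurve \<Gamma> s)"
          by (simp flip: sd2(2)[OF that(2-4)])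
        then have "norm (integral {s..t} (second_deriv (\<gamma> (\<phi> n))) - (dcurve \<Gamma> t - dcurve \<Gamma> s)) =
            norm ((dcurve (\<gamma> (\<phi> n)) t - dcurve \<Gamma> t) - (dcurve (\<gamma> (\<phi> n)) s - dcurve \<Gamma> s))"
          by (rule arg_cong)
        then show ?thesis
          using norm_triangle_ineq4[of "dcurve (\<gamma> (\<phi> n)) t - dcurve \<Gamma> t" "dcurve (\<gamma> (\<phi> n)) s - dcurve \<Gamma> s"]
            N[OF that(1), of t] N[OF that(1), of s] by argo
      qed
      then show "\<exists>N. \<forall>n\<ge>N. \<forall>s t. 0 \<le> s \<longrightarrow> s \<le> t \<longrightarrow> t \<le> 1 \<longrightarrow>
          norm (integral {s..t} (second_deriv (\<gamma> (\<phi> n))) - (dcurve \<Gamma> t - dcurve \<Gamma> s)) \<le> d"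
        by blast
    qed (use that in auto)
    have \<Gamma>_weak: "weak_second_deriv \<Gamma> G"
      using G(1,2) by (simp add: weak_second_deriv_def square_integrable_on_def)
    have \<Gamma>_W: "W22_closed \<Gamma>"
      unfolding W22_closed_def using \<Gamma>_per \<Gamma>_weak \<Gamma>_der differentiableI_vector by blast
    obtain c where c: "0 < c" and bl: "\<And>n s t. \<bar>t - s\<bar> \<le> 1/2 \<Longrightarrow> c * \<bar>t - s\<bar> \<le> norm (\<gamma> n t - \<gamma> n s)"
    proof -
      have "0 \<le> M + 1" using i(2) by (simp add: M_def)
      then obtain c where c: "0 < c" "\<And>\<gamma> s t. \<lbrakk>W22_closed \<gamma>; injective_closed \<gamma>; \<And>t. norm (dcurve \<gamma> t) = 1;
         \<And>s t. \<bar>t - s\<bar> \<le> 1 \<Longrightarrow> norm (dcurve \<gamma> t - dcurve \<gamma> s) \<le> (M + 1) * sqrt \<bar>t - s\<bar>;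
         tangent_point q \<gamma> \<le> ennreal P; \<bar>t - s\<bar> \<le> 1/2\<rbrakk> \<Longrightarrow> c * \<bar>t - s\<bar> \<le> norm (\<gamma> t - \<gamma> s)"
        using uniform_bilipschitz[OF q _ P] by blast
      have "tangent_point q (\<gamma> n) \<le> ennreal P" for n
        unfolding TP by (rule ennreal_leI[OF pP])
      then show ?thesis
        by (intro that[OF c(1)] c(2) W inj unit hold) auto
    qed
    \<comment> \<open>A limit of injective curves may touch itself; the bound with a common
      \<open>c\<close> passes to the limit and rules this out.\<close>
    have \<Gamma>_bl: "c * \<bar>t - s\<bar> \<le> norm (\<Gamma> t - \<Gamma> s)" if "\<bar>t - s\<bar> \<le> 1/2" for s t
      by (rule LIMSEQ_le_const[OF tendsto_norm[OF tendsto_diff[OF lim lim]]]) (use bl[OF that] in auto)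
    have \<Gamma>_inj: "injective_closed \<Gamma>"
      by (rule bilipschitz_imp_injective_closed[OF \<Gamma>_per c \<Gamma>_bl])
    have \<Gamma>_iso: "ambient_isotopic (\<gamma>0 ` {0..1}) (\<Gamma> ` {0..1})"
    proof -
      obtain N where N: "\<And>n t. N \<le> n \<Longrightarrow> norm (dcurve (\<gamma> (\<phi> n)) t - dcurve \<Gamma> t) \<le> c / 6"
        using C1[of "c / 6"] c by auto
      have "ambient_isotopic (\<gamma> (\<phi> N) ` {0..1}) (\<Gamma> ` {0..1})"
        by (rule ambient_isotopic_C1_close[OF per \<Gamma>_per c bl der \<Gamma>_der])
           (use N[of N] in \<open>auto simp: norm_minus_commute\<close>)
      then show ?thesis by (rule ambient_isotopic_trans[OF iso])
    qed
    have \<Gamma>_reg: "regular_curve \<Gamma>"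
      using \<Gamma>_unit unfolding regular_curve_def by (metis norm_zero zero_neq_one)
    have \<Gamma>_in: "\<Gamma> \<in> Sigma_K \<gamma>0"
      using \<Gamma>_W \<Gamma>_reg \<Gamma>_inj \<Gamma>_iso \<Gamma>_per \<Gamma>_sym unit_len[OF \<Gamma>_unit]
      by (simp add: Sigma_K_def Omega1_def W22_closed_continuous)
    have "bending_energy \<Gamma> \<le> ennreal b'"
      unfolding bending_energy_unit_speed[OF \<Gamma>_W \<Gamma>_unit \<Gamma>_weak] by (rule ennreal_leI[OF G(3)])
    moreover have p'0: "0 \<le> p'"
      by (rule LIMSEQ_le_const[OF p_lim]) (use p0 in auto)
    moreover have TP\<Gamma>: "tangent_point q \<Gamma> \<le> ennreal p'"
    proof (rule tangent_point_le_limit[OF _ _ _ lim dlim])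
      show "continuous_on UNIV (\<gamma> (\<phi> n))" "continuous_on UNIV (\<lambda>t. dcurve (\<gamma> (\<phi> n)) t)" for n
        by (rule W22_closed_continuous[OF W], rule W22_closed_continuous_dcurve[OF W])
      show "dcurve \<Gamma> t \<noteq> 0" for t using \<Gamma>_reg by (simp add: regular_curve_def)
      show "(\<lambda>n. tangent_point q (\<gamma> (\<phi> n))) \<longlonglongrightarrow> ennreal p'"
        unfolding TP by (rule tendsto_ennrealI[OF p_lim])
    qed (use q in simp)
    moreover have "tp_power q \<Gamma> \<le> ennreal (p' powr (1 / (q - 2)))"
    proof -
      have "enn2real (tangent_point q \<Gamma>) \<le> p'" using TP\<Gamma> p'0 by (simp add: enn2real_leI)
      then show ?thesis
        using TP\<Gamma> q by (auto simp: tp_power_def top_unique intro!: ennreal_leI powr_mono2)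
    qed
    ultimately have "S_theta q \<theta> \<Gamma> \<le> ennreal b' + ennreal \<theta> * ennreal (p' powr (1 / (q - 2)))"
      using unit_len[OF \<Gamma>_unit] by (simp add: S_theta_def E_theta_def) (intro add_mono mult_left_mono; simp)
    also have "\<dots> = ennreal (b' + \<theta> * p' powr (1 / (q - 2)))"
      using \<theta> LIMSEQ_le_const[OF b_lim, of 0] b0 by (subst ennreal_plus) (auto simp: ennreal_mult')
    \<comment> \<open>The total energies tend to \<open>i\<close>, while their two parts converge
      along \<phi>. The exponent 1 / (q - 2) is positive, so the power is continuous even when p' =
      0.\<close>
    also have "b' + \<theta> * p' powr (1 / (q - 2)) = i"
    proof (rule LIMSEQ_unique)
      show "(\<lambda>n. e (\<phi> n)) \<longlonglongrightarrow> i"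
        using LIMSEQ_subseq_LIMSEQ[OF e_lim \<phi>] by (simp add: o_def)
      show "(\<lambda>n. e (\<phi> n)) \<longlonglongrightarrow> b' + \<theta> * p' powr (1 / (q - 2))"
        unfolding e_def using q p0
        by (intro tendsto_add b_lim tendsto_mult tendsto_const tendsto_powr'[OF p_lim tendsto_const]) auto
    qed
    finally show ?thesis using \<Gamma>_in \<Gamma>_unit i by auto
  qed
  then obtain \<Gamma> where \<Gamma>: "\<Gamma> \<in> Sigma_K \<gamma>0" "\<And>t. norm (dcurve \<Gamma> t) = 1" "S_theta q \<theta> \<Gamma> \<le> I" by blast
  have "S_theta q \<theta> \<Gamma> = I" using I_le[OF \<Gamma>(1)] \<Gamma>(3) by (rule antisym[rotated])
  then show ?thesis using \<Gamma>(1) unit_len[OF \<Gamma>(2)] unfolding I_def by blast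
qed

end
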